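(* Let $K$ be a complete multicomplex. Then there exists a submulticomplex $L\subseteq K$ with the following properties: (1) $L$ is complete and minimal; (2) $L$ has the same vertices as $K$; (3) there exists a simplicial retraction $r\colon K\to L$; (4) the geometric realization of $r$ realizes $|L|$ as a strong deformation retract of $|K|$ (in particular, the inclusion of $|L|$ in $|K|$ is a homotopy equivalence). Moreover, such a submulticomplex $L$ is unique up to simplicial isomorphism.
   Context: **Multicomplexes.** A multicomplex is a triple $K=(V,I,\Omega)$, where $V$ is a set (the vertices), $I=\bigcup_A I_A$ with $A$ ranging over the finite subsets of $V$, each $I_A$ is a (possibly empty) set (the simplices with vertex set $A$), $I_A$ is a singleton when $A$ is a singleton, and $\Omega$ is a family of maps $\partial_{A,B}\colon I_A\to I_B$ (for $A\supseteq B$) such that $\partial_{A,A}=\mathrm{Id}$ and $\partial_{B,C}\circ\partial_{A,B}=\partial_{A,C}$ for $A\supseteq B\supseteq C$. A simplex in $I_A$ has dimension $|A|-1$. A submulticomplex is given by subsets of vertices and simplices closed under the boundary maps, with the restricted boundary maps. A simplicial map $K\to K'$ consists of a map $f\colon V\to V'$ and maps $f_A\colon I_A\to I'_{f(A)}$ commuting with the boundary maps; it is a simplicial embedding if $f$ and all the $f_A$ are injective. The geometric realization $|K|$ is the CW complex obtained by taking one affine simplex with vertex set $A$ for every $\sigma\in I_A$ and gluing the face spanned by $B\subseteq A$ to the simplex corresponding to $\partial_{A,B}\sigma$ via the affine map that is the identity on $B$, with the weak topology. Simplicial maps induce continuous maps on geometric realizations; the standard simplex $\Delta^n$ and its boundary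 are regarded as multicomplexes. **Complete / minimal.** $K$ is complete (resp. minimal) if every continuous map $f\colon|\Delta^n|\to|K|$ ($n\geq 1$) whose restriction to $\partial|\Delta^n|$ is (induced by) a simplicial embedding is homotopic relative to $\partial|\Delta^n|$ to at least one (resp. at most one) simplicial embedding $\Delta^n\to K$. *)

theory Defs
  imports "HOL-Analysis.Analysis"
begin

section \<open>Multicomplexes\<close>

text \<open>
  \<open>simplices K A\<close> is the set of simplices with vertex set \<open>A\<close> and \<open>bd K A B\<close> is the boundary
  map from \<open>simplices K A\<close> to \<open>simplices K B\<close>. Only nonempty vertex sets carry simplices. The
  family \<open>simplices K\<close> is indexed by \<open>A\<close> and its members need not be disjoint as sets: the simplex
  meant by \<open>\<sigma> \<in> simplices K A\<close> is the pair \<open>(A, \<sigma>)\<close>.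
\<close>

record ('v, 's) multicomplex =
  vertices :: "'v set"
  simplices :: "'v set \<Rightarrow> 's set"
  bd :: "'v set \<Rightarrow> 'v set \<Rightarrow> 's \<Rightarrow> 's"

locale multicomplex =
  fixes K :: "('v, 's) multicomplex"
  assumes vertex_set: "\<sigma> \<in> simplices K A \<Longrightarrow> finite A \<and> A \<noteq> {} \<and> A \<subseteq> vertices K"
    and vertex_simplex: "v \<in> vertices K \<Longrightarrow> \<exists>\<sigma>. simplices K {v} = {\<sigma>}"
    and bd_closed: "\<lbrakk>\<sigma> \<in> simplices K A; B \<subseteq> A; B \<noteq> {}\<rbrakk> \<Longrightarrow> bd K A B \<sigma> \<in> simplices K B"
    and bd_self: "\<sigma> \<in> simplices K A \<Longrightarrow> bd K A A \<sigma> = \<sigma>"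
    and bd_bd: "\<lbrakk>\<sigma> \<in> simplices K A; B \<subseteq> A; C \<subseteq> B; C \<noteq> {}\<rbrakk>
                  \<Longrightarrow> bd K B C (bd K A B \<sigma>) = bd K A C \<sigma>"

definition submulticomplex ::
    "('v, 's) multicomplex \<Rightarrow> ('v, 's) multicomplex \<Rightarrow> bool" where
  "submulticomplex L K \<longleftrightarrow>
     multicomplex L \<and> multicomplex K \<and>
     vertices L \<subseteq> vertices K \<and>
     (\<forall>A. simplices L A \<subseteq> simplices K A) \<and>
     (\<forall>A B. \<forall>\<sigma>\<in>simplices L A. B \<subseteq> A \<and> B \<noteq> {} \<longrightarrow> bd L A B \<sigma> = bd K A B \<sigma>)"

section \<open>Simplicial maps\<close>

record ('v, 's, 'w, 't) smap =
  vmap :: "'v \<Rightarrow> 'w"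
  simap :: "'v set \<Rightarrow> 's \<Rightarrow> 't"

definition simplicial_map ::
    "('v, 's) multicomplex \<Rightarrow> ('w, 't) multicomplex \<Rightarrow> ('v, 's, 'w, 't) smap \<Rightarrow> bool" where
  "simplicial_map K K' \<phi> \<longleftrightarrow>
     vmap \<phi> ` vertices K \<subseteq> vertices K' \<and>
     (\<forall>A. \<forall>\<sigma>\<in>simplices K A. simap \<phi> A \<sigma> \<in> simplices K' (vmap \<phi> ` A)) \<and>
     (\<forall>A B. \<forall>\<sigma>\<in>simplices K A. B \<subseteq> A \<and> B \<noteq> {} \<longrightarrow>
        bd K' (vmap \<phi> ` A) (vmap \<phi> ` B) (simap \<phi> A \<sigma>) = simap \<phi> B (bd K A B \<sigma>))"

definition simplicial_embedding ::
    "('v, 's) multicomplex \<Rightarrow> ('w, 't) multicomplex \<Rightarrow> ('v, 's, 'w, 't) smap \<Rightarrow> bool" where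
  "simplicial_embedding K K' \<phi> \<longleftrightarrow>
     simplicial_map K K' \<phi> \<and> inj_on (vmap \<phi>) (vertices K) \<and>
     (\<forall>A. inj_on (simap \<phi> A) (simplices K A))"

text \<open>Equality of simplicial maps with domain \<open>K\<close>; the values of a \<open>smap\<close> outside the vertices and
  simplices of its domain are irrelevant.\<close>

definition smap_eq_on ::
    "('v, 's) multicomplex \<Rightarrow> ('v, 's, 'w, 't) smap \<Rightarrow> ('v, 's, 'w, 't) smap \<Rightarrow> bool" where
  "smap_eq_on K \<phi> \<psi> \<longleftrightarrow>
     (\<forall>v\<in>vertices K. vmap \<phi> v = vmap \<psi> v) \<and>
     (\<forall>A. \<forall>\<sigma>\<in>simplices K A. simap \<phi> A \<sigma> = simap \<psi> A \<sigma>)"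

definition smap_id :: "('v, 's, 'v, 's) smap" where
  "smap_id = \<lparr>vmap = (\<lambda>v. v), simap = (\<lambda>A \<sigma>. \<sigma>)\<rparr>"

definition smap_comp ::
    "('w, 't, 'x, 'u) smap \<Rightarrow> ('v, 's, 'w, 't) smap \<Rightarrow> ('v, 's, 'x, 'u) smap" where
  "smap_comp \<psi> \<phi> = \<lparr>vmap = vmap \<psi> \<circ> vmap \<phi>, simap = (\<lambda>A. simap \<psi> (vmap \<phi> ` A) \<circ> simap \<phi> A)\<rparr>"

definition simplicially_isomorphic ::
    "('v, 's) multicomplex \<Rightarrow> ('w, 't) multicomplex \<Rightarrow> bool" where
  "simplicially_isomorphic K K' \<longleftrightarrow>
     (\<exists>\<phi> \<psi>. simplicial_map K K' \<phi> \<and> simplicial_map K' K \<psi> \<and>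
        smap_eq_on K (smap_comp \<psi> \<phi>) smap_id \<and> smap_eq_on K' (smap_comp \<phi> \<psi>) smap_id)"

definition simplicial_retraction ::
    "('v, 's) multicomplex \<Rightarrow> ('v, 's) multicomplex \<Rightarrow> ('v, 's, 'v, 's) smap \<Rightarrow> bool" where
  "simplicial_retraction K L r \<longleftrightarrow>
     submulticomplex L K \<and> simplicial_map K L r \<and> smap_eq_on L r smap_id"

section \<open>Geometric realization\<close>

text \<open>The affine simplex with vertex set \<open>A\<close>, in barycentric coordinates.\<close>

definition affine_simplex :: "'v set \<Rightarrow> ('v \<Rightarrow> real) set" where
  "affine_simplex A = {t. (\<forall>v. 0 \<le> t v) \<and> (\<forall>v. v \<notin> A \<longrightarrow> t v = 0) \<and> (\<Sum>v\<in>A. t v) = 1}"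

type_synonym ('v, 's) mpoint = "('v set \<times> 's) \<times> ('v \<Rightarrow> real)"

definition disjoint_simplices :: "('v, 's) multicomplex \<Rightarrow> ('v, 's) mpoint topology" where
  "disjoint_simplices K =
     sum_topology (\<lambda>(A, \<sigma>). subtopology (powertop_real UNIV) (affine_simplex A))
       {(A, \<sigma>). \<sigma> \<in> simplices K A}"

text \<open>The elementary identifications: the face spanned by \<open>B\<close> of a simplex \<open>\<sigma>\<close> is glued to the
  simplex \<open>bd K A B \<sigma>\<close>.\<close>

inductive face_rel :: "('v, 's) multicomplex \<Rightarrow> ('v, 's) mpoint \<Rightarrow> ('v, 's) mpoint \<Rightarrow> bool"
  for K where
  "\<lbrakk>\<sigma> \<in> simplices K A; B \<subseteq> A; B \<noteq> {}; t \<in> affine_simplex B\<rbrakk>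
     \<Longrightarrow> face_rel K ((A, \<sigma>), t) ((B, bd K A B \<sigma>), t)"

text \<open>
  A class of the equivalence relation generated by \<open>face_rel\<close> has exactly one representative all of
  whose barycentric coordinates are positive. It serves as the point of the realization, and \<open>glue\<close>
  is the quotient projection (see \<open>glue_eq_iff\<close> and \<open>quotient_map_glue\<close>). With this choice of
  points, the realization of a submulticomplex is a subset of the realization.
\<close>

definition glue :: "('v, 's) multicomplex \<Rightarrow> ('v, 's) mpoint \<Rightarrow> ('v, 's) mpoint" where
  "glue K = (\<lambda>((A, \<sigma>), t). (({v. t v \<noteq> 0}, bd K A {v. t v \<noteq> 0} \<sigma>), t))"

definition realization :: "('v, 's) multicomplex \<Rightarrow> ('v, 's) mpoint topology" where
  "realization K =
     topology (\<lambda>U. U \<subseteq> glue K ` topspace (disjoint_simplices K) \<and>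
       openin (disjoint_simplices K) {x \<in> topspace (disjoint_simplices K). glue K x \<in> U})"

text \<open>The map induced by a simplicial map is affine on each simplex; it is compatible with the
  gluing by \<open>realization_map_glue\<close>.\<close>

definition realization_map :: "('v, 's, 'w, 't) smap \<Rightarrow> ('v, 's) mpoint \<Rightarrow> ('w, 't) mpoint" where
  "realization_map \<phi> =
     (\<lambda>((A, \<sigma>), t). ((vmap \<phi> ` A, simap \<phi> A \<sigma>), (\<lambda>w. \<Sum>v | v \<in> A \<and> vmap \<phi> v = w. t v)))"

lemma topspace_disjoint_simplices:
  "topspace (disjoint_simplices K) =
     {((A, \<sigma>), t). \<sigma> \<in> simplices K A \<and> t \<in> affine_simplex A}"
  by (auto simp: disjoint_simplices_def)

lemma istopology_quotient:
  "istopology (\<lambda>U. U \<subseteq> f ` topspace X \<and> openin X {x \<in> topspace X. f x \<in> U})"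
proof -
  have 1: "{x \<in> topspace X. f x \<in> S \<inter> T}
      = {x \<in> topspace X. f x \<in> S} \<inter> {x \<in> topspace X. f x \<in> T}" for S T
    by auto
  have 2: "{x \<in> topspace X. f x \<in> \<Union>\<K>} = (\<Union>S\<in>\<K>. {x \<in> topspace X. f x \<in> S})" for \<K>
    by auto
  show ?thesis
    unfolding istopology_def 1 2 by blast
qed

lemma openin_realization:
  "openin (realization K) U \<longleftrightarrow> U \<subseteq> glue K ` topspace (disjoint_simplices K) \<and>
     openin (disjoint_simplices K) {x \<in> topspace (disjoint_simplices K). glue K x \<in> U}"
  unfolding realization_def by (subst topology_inverse'[OF istopology_quotient]) (rule refl)

lemma topspace_realization:
  "topspace (realization K) = glue K ` topspace (disjoint_simplices K)"
proof
  show "topspace (realization K) \<subseteq> glue K ` topspace (disjoint_simplices K)"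
    using openin_realization[of K "topspace (realization K)"] by blast
  have "{x \<in> topspace (disjoint_simplices K). glue K x \<in> glue K ` topspace (disjoint_simplices K)}
      = topspace (disjoint_simplices K)"
    by auto
  then have "openin (realization K) (glue K ` topspace (disjoint_simplices K))"
    by (simp add: openin_realization)
  then show "glue K ` topspace (disjoint_simplices K) \<subseteq> topspace (realization K)"
    by (rule openin_subset)
qed

lemma quotient_map_glue: "quotient_map (disjoint_simplices K) (realization K) (glue K)"
  by (simp add: quotient_map_def topspace_realization openin_realization)

lemma affine_simplex_support:
  assumes "t \<in> affine_simplex A" "finite A"
  shows "{v. t v \<noteq> 0} \<subseteq> A" "{v. t v \<noteq> 0} \<noteq> {}" "t \<in> affine_simplex {v. t v \<noteq> 0}"
proof -
  show sub: "{v. t v \<noteq> 0} \<subseteq> A"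
    using assms by (auto simp: affine_simplex_def)
  have "(\<Sum>v | t v \<noteq> 0. t v) = (\<Sum>v\<in>A. t v)"
    using sub assms by (intro sum.mono_neutral_left) auto
  then show "t \<in> affine_simplex {v. t v \<noteq> 0}"
    using assms by (auto simp: affine_simplex_def)
  then show "{v. t v \<noteq> 0} \<noteq> {}"
    unfolding affine_simplex_def by force
qed

lemma (in multicomplex) glue_eq_iff:
  assumes "x \<in> topspace (disjoint_simplices K)" "y \<in> topspace (disjoint_simplices K)"
  shows "glue K x = glue K y \<longleftrightarrow> equivclp (face_rel K) x y"
proof
  have face: "face_rel K z (glue K z)" if z_in: "z \<in> topspace (disjoint_simplices K)" for z
  proof -
    obtain A \<sigma> t where z: "z = ((A, \<sigma>), t)" "\<sigma> \<in> simplices K A" "t \<in> affine_simplex A"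
      using z_in by (auto simp: topspace_disjoint_simplices)
    show ?thesis
      using face_rel.intros[of \<sigma> K A "{v. t v \<noteq> 0}" t] vertex_set[OF z(2)] z
        affine_simplex_support[OF z(3)] by (auto simp: glue_def)
  qed
  assume "glue K x = glue K y"
  then show "equivclp (face_rel K) x y"
    using face[OF assms(1)] face[OF assms(2)]
    by (metis equivclp_sym equivclp_trans r_into_equivclp)
next
  have eq: "glue K a = glue K b" if "face_rel K a b" for a b
    using that
  proof cases
    case (1 \<sigma> A B t)
    have "finite B"
      using 1 vertex_set finite_subset by blast
    then show ?thesis
      using 1 affine_simplex_support[of t B] bd_bd[of \<sigma> A B "{v. t v \<noteq> 0}"]
      by (simp add: glue_def)
  qed
  assume "equivclp (face_rel K) x y"
  then show "glue K x = glue K y"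
    by (induction rule: equivclp_induct) (auto dest: eq)
qed

lemma realization_map_glue:
  assumes "multicomplex K" "simplicial_map K K' \<phi>" "x \<in> topspace (disjoint_simplices K)"
  shows "realization_map \<phi> x \<in> topspace (disjoint_simplices K')"
    and "realization_map \<phi> (glue K x) = glue K' (realization_map \<phi> x)"
proof -
  interpret multicomplex K by fact
  obtain A \<sigma> t where x: "x = ((A, \<sigma>), t)" "\<sigma> \<in> simplices K A" "t \<in> affine_simplex A"
    using assms(3) by (auto simp: topspace_disjoint_simplices)
  define B where "B = {v. t v \<noteq> 0}"
  define p where "p = (\<lambda>w. \<Sum>v | v \<in> A \<and> vmap \<phi> v = w. t v)"
  have fin: "finite A" and t0: "\<And>v. 0 \<le> t v" and sum1: "(\<Sum>v\<in>A. t v) = 1"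
    using vertex_set[OF x(2)] x(3) by (auto simp: affine_simplex_def)
  have B: "B \<subseteq> A" "B \<noteq> {}"
    using affine_simplex_support[OF x(3) fin] by (auto simp: B_def)
  have "(\<Sum>w\<in>vmap \<phi> ` A. p w) = 1"
    unfolding p_def using sum.image_gen[OF fin, of t "vmap \<phi>"] sum1 by (simp add: conj_commute)
  moreover have "p w = 0" if "w \<notin> vmap \<phi> ` A" for w
    using that by (auto simp: p_def intro!: sum.neutral)
  moreover have "0 \<le> p w" for w
    by (simp add: p_def sum_nonneg t0)
  ultimately have "p \<in> affine_simplex (vmap \<phi> ` A)"
    by (auto simp: affine_simplex_def)
  then show "realization_map \<phi> x \<in> topspace (disjoint_simplices K')"
    using assms(2) x
    by (auto simp: realization_map_def simplicial_map_def topspace_disjoint_simplices p_def)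
  have supp: "{w. p w \<noteq> 0} = vmap \<phi> ` B"
  proof -
    have "p w = 0 \<longleftrightarrow> (\<forall>v. v \<in> A \<and> vmap \<phi> v = w \<longrightarrow> t v = 0)" for w
      unfolding p_def using fin t0 by (subst sum_nonneg_eq_0_iff) auto
    then show ?thesis
      using B by (auto simp: B_def)
  qed
  have "(\<lambda>w. \<Sum>v | v \<in> B \<and> vmap \<phi> v = w. t v) = p"
    unfolding p_def using B fin by (intro ext sum.mono_neutral_left) (auto simp: B_def)
  then show "realization_map \<phi> (glue K x) = glue K' (realization_map \<phi> x)"
    using assms(2) x B supp
    by (auto simp: realization_map_def glue_def simplicial_map_def B_def p_def)
qed

lemma topspace_realization_mono:
  assumes "submulticomplex L K"
  shows "topspace (realization L) \<subseteq> topspace (realization K)"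
proof
  fix y
  assume "y \<in> topspace (realization L)"
  then obtain A \<sigma> t where y: "y = glue L ((A, \<sigma>), t)" "\<sigma> \<in> simplices L A" "t \<in> affine_simplex A"
    by (auto simp: topspace_realization topspace_disjoint_simplices)
  interpret L: multicomplex L
    using assms by (simp add: submulticomplex_def)
  have "glue L ((A, \<sigma>), t) = glue K ((A, \<sigma>), t)"
    using assms y affine_simplex_support[OF y(3)] L.vertex_set[OF y(2)]
    by (auto simp: glue_def submulticomplex_def)
  moreover have "((A, \<sigma>), t) \<in> topspace (disjoint_simplices K)"
    using assms y by (auto simp: topspace_disjoint_simplices submulticomplex_def)
  ultimately show "y \<in> topspace (realization K)"
    by (auto simp: topspace_realization y(1))
qed

section \<open>Standard simplices\<close>

text \<open>An abstract simplicial complex, given by its nonempty faces, as a multicomplex.\<close>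

definition mc_of_complex :: "'v set set \<Rightarrow> ('v, 'v set) multicomplex" where
  "mc_of_complex F =
     \<lparr>vertices = \<Union>F, simplices = (\<lambda>A. if A \<in> F then {A} else {}), bd = (\<lambda>A B \<sigma>. B)\<rparr>"

definition std_simplex :: "nat \<Rightarrow> (nat, nat set) multicomplex" where
  "std_simplex n = mc_of_complex {A. A \<noteq> {} \<and> A \<subseteq> {..n}}"

definition std_boundary :: "nat \<Rightarrow> (nat, nat set) multicomplex" where
  "std_boundary n = mc_of_complex {A. A \<noteq> {} \<and> A \<subset> {..n}}"

lemma multicomplex_mc_of_complex:
  assumes fin: "\<And>A. A \<in> F \<Longrightarrow> finite A \<and> A \<noteq> {}"
    and sub: "\<And>A B. \<lbrakk>A \<in> F; B \<subseteq> A; B \<noteq> {}\<rbrakk> \<Longrightarrow> B \<in> F"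
  shows "multicomplex (mc_of_complex F)"
proof
  fix v
  assume "v \<in> vertices (mc_of_complex F)"
  then obtain A where "A \<in> F" "v \<in> A"
    by (auto simp: mc_of_complex_def)
  then have "{v} \<in> F"
    using sub[of A "{v}"] by simp
  then show "\<exists>\<sigma>. simplices (mc_of_complex F) {v} = {\<sigma>}"
    by (simp add: mc_of_complex_def)
next
  fix A and \<sigma> :: "'a set"
  assume "\<sigma> \<in> simplices (mc_of_complex F) A"
  then have A: "A \<in> F" "\<sigma> = A"
    by (simp_all add: mc_of_complex_def split: if_splits)
  show "finite A \<and> A \<noteq> {} \<and> A \<subseteq> vertices (mc_of_complex F)"
    using A fin[of A] by (auto simp: mc_of_complex_def)
  show "bd (mc_of_complex F) A A \<sigma> = \<sigma>"
    using A by (simp add: mc_of_complex_def)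
  show "bd (mc_of_complex F) A B \<sigma> \<in> simplices (mc_of_complex F) B" if "B \<subseteq> A" "B \<noteq> {}" for B
    using sub[OF A(1) that] by (simp add: mc_of_complex_def)
qed (simp add: mc_of_complex_def)

lemma multicomplex_std_simplex: "multicomplex (std_simplex n)"
  unfolding std_simplex_def
proof (rule multicomplex_mc_of_complex)
  fix A :: "nat set"
  assume "A \<in> {A. A \<noteq> {} \<and> A \<subseteq> {..n}}"
  then show "finite A \<and> A \<noteq> {}"
    using finite_subset[of A "{..n}"] by simp
qed blast

lemma submulticomplex_std_boundary: "submulticomplex (std_boundary n) (std_simplex n)"
proof -
  have "multicomplex (std_boundary n)"
    unfolding std_boundary_def
  proof (rule multicomplex_mc_of_complex)
    fix A :: "nat set"
    assume A: "A \<in> {A. A \<noteq> {} \<and> A \<subset> {..n}}"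
    then show "finite A \<and> A \<noteq> {}"
      using finite_subset[of A "{..n}"] psubset_imp_subset by auto
    fix B
    assume "B \<subseteq> A" "B \<noteq> {}"
    then show "B \<in> {A. A \<noteq> {} \<and> A \<subset> {..n}}"
      using A subset_psubset_trans[of B A "{..n}"] by simp
  qed
  moreover have "vertices (std_boundary n) \<subseteq> vertices (std_simplex n)"
    by (auto simp: std_boundary_def std_simplex_def mc_of_complex_def simp del: Union_iff
        intro!: Union_mono)
  moreover have "simplices (std_boundary n) A \<subseteq> simplices (std_simplex n) A" for A
    by (simp add: std_boundary_def std_simplex_def mc_of_complex_def psubset_imp_subset)
  moreover have "bd (std_boundary n) = bd (std_simplex n)"
    by (simp add: std_boundary_def std_simplex_def mc_of_complex_def)
  ultimately show ?thesis
    by (simp add: submulticomplex_def multicomplex_std_simplex)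
qed

section \<open>Complete and minimal multicomplexes\<close>

definition homotopic_rel ::
    "'a set \<Rightarrow> 'a topology \<Rightarrow> 'b topology \<Rightarrow> ('a \<Rightarrow> 'b) \<Rightarrow> ('a \<Rightarrow> 'b) \<Rightarrow> bool" where
  "homotopic_rel S X Y f g \<longleftrightarrow> homotopic_with (\<lambda>h. \<forall>x\<in>S. h x = f x) X Y f g"

definition boundary_embedded ::
    "nat \<Rightarrow> ('v, 's) multicomplex \<Rightarrow> ((nat, nat set) mpoint \<Rightarrow> ('v, 's) mpoint) \<Rightarrow> bool" where
  "boundary_embedded n K f \<longleftrightarrow>
     (\<exists>\<phi>. simplicial_embedding (std_boundary n) K \<phi> \<and>
        (\<forall>x\<in>topspace (realization (std_boundary n)). f x = realization_map \<phi> x))"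

definition complete_mc :: "('v, 's) multicomplex \<Rightarrow> bool" where
  "complete_mc K \<longleftrightarrow>
     (\<forall>n\<ge>1. \<forall>f. continuous_map (realization (std_simplex n)) (realization K) f \<and>
        boundary_embedded n K f \<longrightarrow>
        (\<exists>\<psi>. simplicial_embedding (std_simplex n) K \<psi> \<and>
           homotopic_rel (topspace (realization (std_boundary n)))
             (realization (std_simplex n)) (realization K) f (realization_map \<psi>)))"

definition minimal_mc :: "('v, 's) multicomplex \<Rightarrow> bool" where
  "minimal_mc K \<longleftrightarrow>
     (\<forall>n\<ge>1. \<forall>f. continuous_map (realization (std_simplex n)) (realization K) f \<and>
        boundary_embedded n K f \<longrightarrow>
        (\<forall>\<psi> \<psi>'. simplicial_embedding (std_simplex n) K \<psi> \<and>
           homotopic_rel (topspace (realization (std_boundary n)))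
             (realization (std_simplex n)) (realization K) f (realization_map \<psi>) \<and>
           simplicial_embedding (std_simplex n) K \<psi>' \<and>
           homotopic_rel (topspace (realization (std_boundary n)))
             (realization (std_simplex n)) (realization K) f (realization_map \<psi>') \<longrightarrow>
           smap_eq_on (std_simplex n) \<psi> \<psi>'))"

section \<open>Deformation retractions and homotopy equivalences\<close>

text \<open>Here \<open>topspace Y \<subseteq> topspace X\<close>; the first conjunct makes \<open>Y\<close> carry the subspace
  topology of \<open>X\<close>.\<close>

definition strong_deformation_retraction ::
    "'a topology \<Rightarrow> 'a topology \<Rightarrow> ('a \<Rightarrow> 'a) \<Rightarrow> bool" where
  "strong_deformation_retraction X Y \<rho> \<longleftrightarrow>
     retraction_maps X Y \<rho> (\<lambda>x. x) \<and> homotopic_rel (topspace Y) X X (\<lambda>x. x) \<rho>"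

definition homotopy_equivalence :: "'a topology \<Rightarrow> 'b topology \<Rightarrow> ('a \<Rightarrow> 'b) \<Rightarrow> bool" where
  "homotopy_equivalence X Y f \<longleftrightarrow>
     continuous_map X Y f \<and>
     (\<exists>g. continuous_map Y X g \<and>
        homotopic_with (\<lambda>_. True) X X (g \<circ> f) id \<and> homotopic_with (\<lambda>_. True) Y Y (f \<circ> g) id)"

section \<open>Complete minimal retracts\<close>

definition minimal_retract :: "('v, 's) multicomplex \<Rightarrow> ('v, 's) multicomplex \<Rightarrow> bool" where
  "minimal_retract K L \<longleftrightarrow>
     submulticomplex L K \<and>
     complete_mc L \<and> minimal_mc L \<and>
     vertices L = vertices K \<and>
     (\<exists>r. simplicial_retraction K L r \<and>
        strong_deformation_retraction (realization K) (realization L) (realization_map r)) \<and>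
     homotopy_equivalence (realization L) (realization K) (\<lambda>x. x)"

end

theory Submission
  imports Defs
begin

text \<open>
  Call two simplices with the same vertex set and the same boundary equivalent if their characteristic
  maps are homotopic relative to the boundary. The submulticomplex \<open>L\<close> consists of one chosen
  representative of each class, as long as all faces are chosen representatives, too. By induction on
  the dimension, every simplex \<open>\<sigma>\<close> of \<open>K\<close> is deformed into one of \<open>L\<close>: extend the homotopy from the
  boundary, apply completeness to its final map, pass to the representative, and absorb the last
  homotopy, which is constant on the boundary, into the first by extending once more over
  \<open>[0,1] \<times> \<sigma>\<close>. For uniqueness, the retraction onto \<open>L'\<close> is bijective on the simplices of \<open>L\<close>, because
  transporting maps of a simplex along a homotopy of their boundary values is a bijection on homotopy
  classes relative to the boundary.
\<close>

section \<open>Homotopy extension for radial spaces\<close>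

text \<open>The obstacle is compatibility on faces: homotopies on the simplices glue to one on the
  realization only if each restricts exactly, at every time, to those already chosen on the faces.
  Appending a further homotopy would change the timing on the boundary and break this, hence the
  second extension, over the cylinder. Homotopy extension is therefore proved for an abstract ball
  with a gauge and a scaling: the affine simplex is such a ball, and so is the cylinder over any
  such ball, so that one argument serves both. Continuity on the realization is tested on single
  simplices, because the product of the gluing map with the identity of the interval is again a
  quotient map; this covers infinite and infinite-dimensional \<open>K\<close>. In the uniqueness
  proof nothing is known about how \<open>L\<close> and \<open>L'\<close> were chosen; only their
  retractions and deformations are available. Bijectivity is therefore proved by induction over
  faces, lifting a simplex of \<open>L'\<close> over its already lifted boundary.\<close>

abbreviation unit_interval :: "real topology" where
  "unit_interval \<equiv> top_of_set {0..1}"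

lemma continuous_map_comp:
  assumes "continuous_map Y Z g" "continuous_map X Y f"
  shows "continuous_map X Z (\<lambda>x. g (f x))"
  using continuous_map_compose[OF assms(2,1)] by (simp add: o_def)

lemma continuous_map_fst_real:
  "continuous_map (prod_topology (top_of_set S) X) euclideanreal fst"
  using continuous_map_fst continuous_map_in_subtopology by blast

lemma continuous_map_reverse:
  assumes "continuous_map (prod_topology unit_interval X) Z h"
  shows "continuous_map (prod_topology unit_interval X) Z (\<lambda>z. h (1 - fst z, snd z))"
  by (rule continuous_map_comp[OF assms])
    (auto intro!: continuous_map_pairedI continuous_map_into_subtopology continuous_map_diff
      continuous_map_fst_real continuous_map_snd simp: continuous_map_canonical_const)

lemma continuous_map_slice:
  assumes "continuous_map (prod_topology unit_interval X) Z h" "u \<in> {0..1}"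
  shows "continuous_map X Z (\<lambda>x. h (u, x))"
  by (rule continuous_map_comp[OF assms(1)]) (use assms(2) in \<open>auto intro!: continuous_map_pairedI\<close>)

text \<open>\<open>g\<close> plays the role of a norm and \<open>s l x\<close> that of \<open>l \<cdot> x\<close>, so that \<open>X\<close> looks like a unit
  ball with boundary sphere \<open>g = 1\<close>.\<close>

definition radial :: "'a topology \<Rightarrow> ('a \<Rightarrow> real) \<Rightarrow> (real \<Rightarrow> 'a \<Rightarrow> 'a) \<Rightarrow> bool" where
  "radial X g s \<longleftrightarrow>
     continuous_map X euclideanreal g \<and>
     (\<forall>x\<in>topspace X. 0 \<le> g x \<and> g x \<le> 1 \<and> s 1 x = x) \<and>
     (\<forall>x\<in>topspace X. \<forall>l\<ge>1. l * g x \<le> 1 \<longrightarrow> g (s l x) = l * g x) \<and>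
     continuous_map (subtopology (prod_topology euclideanreal X) {z. 1 \<le> fst z \<and> fst z * g (snd z) \<le> 1})
       X (\<lambda>z. s (fst z) (snd z))"

lemma continuous_map_radial:
  assumes "radial X g s" "continuous_map Y euclideanreal p" "continuous_map Y X q"
    and "\<And>y. y \<in> topspace Y \<Longrightarrow> 1 \<le> p y \<and> p y * g (q y) \<le> 1"
  shows "continuous_map Y X (\<lambda>y. s (p y) (q y))"
proof -
  have "continuous_map Y
      (subtopology (prod_topology euclideanreal X) {z. 1 \<le> fst z \<and> fst z * g (snd z) \<le> 1})
      (\<lambda>y. (p y, q y))"
    using assms by (auto intro!: continuous_map_into_subtopology continuous_map_pairedI)
  then show ?thesis
    using assms(1) continuous_map_comp[of _ X "\<lambda>z. s (fst z) (snd z)" Y "\<lambda>y. (p y, q y)"]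
    unfolding radial_def by auto
qed

text \<open>The cylinder \<open>[0,1] \<times> X\<close> is projected radially from the point at height 2 over the centre.\<close>

lemma radial_homotopy_extension:
  assumes rad: "radial X g s" and f: "continuous_map X Z f"
    and k: "continuous_map (prod_topology unit_interval (subtopology X {x. g x = 1})) Z k"
    and k0: "\<And>x. \<lbrakk>x \<in> topspace X; g x = 1\<rbrakk> \<Longrightarrow> k (0, x) = f x"
  shows "\<exists>H. continuous_map (prod_topology unit_interval X) Z H \<and> (\<forall>x\<in>topspace X. H (0, x) = f x) \<and>
    (\<forall>x\<in>{x \<in> topspace X. g x = 1}. \<forall>t\<in>{0..1}. H (t, x) = k (t, x))"
proof -
  let ?P = "prod_topology unit_interval X"
  have g: "continuous_map X euclideanreal g" and s1: "\<And>x. x \<in> topspace X \<Longrightarrow> s 1 x = x"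
    and g01: "\<And>x. x \<in> topspace X \<Longrightarrow> 0 \<le> g x \<and> g x \<le> 1"
    and gs: "\<And>x l. \<lbrakk>x \<in> topspace X; 1 \<le> l; l * g x \<le> 1\<rbrakk> \<Longrightarrow> g (s l x) = l * g x"
    using rad by (auto simp: radial_def)
  \<comment> \<open>The ray from the point at height 2 over the centre through \<open>(t, x)\<close>
    reaches the bottom at scale \<open>2 / (2 - t)\<close> and the wall at scale
    \<open>1 / g x\<close>, there at height \<open>2 - (2 - t) / g x\<close>. The test in
    \<open>H\<close> asks which is reached first; on the common edge both values agree by
    \<open>k0\<close>.\<close>
  define H1 where "H1 = (\<lambda>z. f (s (2 / (2 - fst z)) (snd z)))"
  define H2 where "H2 = (\<lambda>z. k (2 - (2 - fst z) / g (snd z), s (1 / g (snd z)) (snd z)))"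
  define H where "H = (\<lambda>z. if 2 * g (snd z) \<le> 2 - fst z then H1 z else H2 z)"
  have gsnd: "continuous_map ?P euclideanreal (\<lambda>z. g (snd z))"
    by (rule continuous_map_comp[OF g continuous_map_snd])
  have two: "continuous_map ?P euclideanreal (\<lambda>z. 2 - fst z)"
    by (intro continuous_map_diff continuous_map_fst_real) simp
  have "continuous_map ?P Z H"
    unfolding H_def
  proof (rule continuous_map_cases_le)
    show "continuous_map ?P euclideanreal (\<lambda>z. 2 * g (snd z))"
      by (intro continuous_map_real_mult_left gsnd)
    show "continuous_map ?P euclideanreal (\<lambda>z. 2 - fst z)"
      by (rule two)
    show "continuous_map (subtopology ?P {x \<in> topspace ?P. 2 * g (snd x) \<le> 2 - fst x}) Z H1"
      unfolding H1_def
      by (rule continuous_map_comp[OF f], rule continuous_map_radial[OF rad])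
        (auto intro!: continuous_map_real_divide continuous_map_from_subtopology two continuous_map_snd
          simp: field_simps)
    show "continuous_map (subtopology ?P {x \<in> topspace ?P. 2 - fst x \<le> 2 * g (snd x)}) Z H2"
      unfolding H2_def
    proof (rule continuous_map_comp[OF k], rule continuous_map_pairedI)
      have pos: "0 < g x" if "2 - t \<le> 2 * g x" "t \<le> 1" for t x
        using that by linarith
      show "continuous_map (subtopology ?P {x \<in> topspace ?P. 2 - fst x \<le> 2 * g (snd x)})
          unit_interval (\<lambda>x. 2 - (2 - fst x) / g (snd x))"
      proof (rule continuous_map_into_subtopology)
        show "continuous_map (subtopology ?P {x \<in> topspace ?P. 2 - fst x \<le> 2 * g (snd x)})
          euclideanreal (\<lambda>x. 2 - (2 - fst x) / g (snd x))"
        proof (intro continuous_map_diff[OF continuous_map_canonical_const] continuous_map_real_divide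
            continuous_map_from_subtopology[OF continuous_map_fst_real]
            continuous_map_from_subtopology[OF gsnd])
          fix z assume "z \<in> topspace (subtopology ?P {x \<in> topspace ?P. 2 - fst x \<le> 2 * g (snd x)})"
          then show "g (snd z) \<noteq> 0" using pos[of "fst z" "snd z"] by auto
        qed
        show "(\<lambda>x. 2 - (2 - fst x) / g (snd x))
          \<in> topspace (subtopology ?P {x \<in> topspace ?P. 2 - fst x \<le> 2 * g (snd x)}) \<rightarrow> {0..1}"
        proof
          fix z assume z: "z \<in> topspace (subtopology ?P {x \<in> topspace ?P. 2 - fst x \<le> 2 * g (snd x)})"
          then have "0 < g (snd z)" "g (snd z) \<le> 1"
            using pos[of "fst z" "snd z"] g01[of "snd z"] by auto
          then show "2 - (2 - fst z) / g (snd z) \<in> {0..1}"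
            using z by (auto simp: field_simps)
        qed
      qed
      show "continuous_map (subtopology ?P {x \<in> topspace ?P. 2 - fst x \<le> 2 * g (snd x)})
          (subtopology X {x. g x = 1}) (\<lambda>x. s (1 / g (snd x)) (snd x))"
      proof (rule continuous_map_into_subtopology, rule continuous_map_radial[OF rad])
        show "(\<lambda>x. s (1 / g (snd x)) (snd x))
          \<in> topspace (subtopology ?P {x \<in> topspace ?P. 2 - fst x \<le> 2 * g (snd x)}) \<rightarrow> {x. g x = 1}"
        proof
          fix z assume "z \<in> topspace (subtopology ?P {x \<in> topspace ?P. 2 - fst x \<le> 2 * g (snd x)})"
          then have "snd z \<in> topspace X" "0 < g (snd z)" using pos[of "fst z" "snd z"] by auto
          then show "s (1 / g (snd z)) (snd z) \<in> {x. g x = 1}"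
            using gs[of "snd z" "1 / g (snd z)"] g01[of "snd z"] by auto
        qed
        show "continuous_map (subtopology ?P {x \<in> topspace ?P. 2 - fst x \<le> 2 * g (snd x)})
          euclideanreal (\<lambda>x. 1 / g (snd x))"
        proof (intro continuous_map_real_divide continuous_map_canonical_const
            continuous_map_from_subtopology[OF gsnd])
          fix z assume "z \<in> topspace (subtopology ?P {x \<in> topspace ?P. 2 - fst x \<le> 2 * g (snd x)})"
          then show "g (snd z) \<noteq> 0" using pos[of "fst z" "snd z"] by auto
        qed
        show "continuous_map (subtopology ?P {x \<in> topspace ?P. 2 - fst x \<le> 2 * g (snd x)}) X snd"
          by (intro continuous_map_from_subtopology continuous_map_snd)
        fix z assume "z \<in> topspace (subtopology ?P {x \<in> topspace ?P. 2 - fst x \<le> 2 * g (snd x)})"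
        then have "0 < g (snd z)" "g (snd z) \<le> 1"
          using pos[of "fst z" "snd z"] g01[of "snd z"] by auto
        then show "1 \<le> 1 / g (snd z) \<and> 1 / g (snd z) * g (snd z) \<le> 1" by simp
      qed
    qed
    show "H1 z = H2 z" if "z \<in> topspace ?P" "2 * g (snd z) = 2 - fst z" for z
    proof -
      have z: "snd z \<in> topspace X" "0 < g (snd z)" "fst z = 2 - 2 * g (snd z)" using that by auto
      have e: "2 / (2 - fst z) = 1 / g (snd z)" "2 - (2 - fst z) / g (snd z) = 0"
        using z by (auto simp: field_simps)
      have "s (1 / g (snd z)) (snd z) \<in> topspace X"
      proof -
        \<comment> \<open>On a one-point space, continuity just says that the value lies in
          \<open>X\<close>.\<close>
        have "continuous_map (discrete_topology {z}) X (\<lambda>z. s (1 / g (snd z)) (snd z))"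
          by (rule continuous_map_radial[OF rad]) (use z g01 in auto)
        then show ?thesis by (auto simp: continuous_map_def)
      qed
      then show ?thesis
        unfolding H1_def H2_def e using gs[of "snd z" "1 / g (snd z)"] g01[of "snd z"] z
        by (subst k0) auto
    qed
  qed
  moreover have "H (0, x) = f x" if "x \<in> topspace X" for x
    using that g01 s1 by (simp add: H_def H1_def)
  moreover have "H (t, x) = k (t, x)" if "x \<in> topspace X" "g x = 1" "t \<in> {0..1}" for x t
    using that s1 k0 by (cases "t = 0") (auto simp: H_def H1_def H2_def)
  ultimately show ?thesis
    by blast
qed

text \<open>This is the maximum norm on a product of balls, with \<open>[0,1]\<close> as the ball of
  radius 1/2 about 1/2. The unit sphere is the whole boundary of the cylinder: both ends and the
  wall over \<open>g = 1\<close>. Homotopy extension thus becomes available one dimension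
  higher.\<close>

lemma radial_cylinder:
  assumes rad: "radial X g s"
  shows "radial (prod_topology unit_interval X) (\<lambda>z. max \<bar>2 * fst z - 1\<bar> (g (snd z)))
    (\<lambda>l z. (1/2 + l * (fst z - 1/2), s l (snd z)))"
  unfolding radial_def
proof (intro conjI ballI allI impI)
  have g: "continuous_map X euclideanreal g" and s1: "\<And>x. x \<in> topspace X \<Longrightarrow> s 1 x = x"
    and g01: "\<And>x. x \<in> topspace X \<Longrightarrow> 0 \<le> g x \<and> g x \<le> 1"
    and gs: "\<And>x l. \<lbrakk>x \<in> topspace X; 1 \<le> l; l * g x \<le> 1\<rbrakk> \<Longrightarrow> g (s l x) = l * g x"
    using rad by (auto simp: radial_def)
  let ?P = "prod_topology unit_interval X"
  show "continuous_map ?P euclideanreal (\<lambda>z. max \<bar>2 * fst z - 1\<bar> (g (snd z)))"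
    by (intro continuous_map_real_max continuous_map_real_abs continuous_map_diff
        continuous_map_real_mult_left continuous_map_fst_real continuous_map_comp[OF g continuous_map_snd]) simp
  fix z assume "z \<in> topspace ?P"
  then have z: "0 \<le> fst z" "fst z \<le> 1" "snd z \<in> topspace X" by auto
  show "0 \<le> max \<bar>2 * fst z - 1\<bar> (g (snd z))" "max \<bar>2 * fst z - 1\<bar> (g (snd z)) \<le> 1"
    using z g01[OF z(3)] by auto
  show "(1/2 + 1 * (fst z - 1/2), s 1 (snd z)) = z"
    using z s1 by (simp add: prod_eq_iff)
  fix l :: real assume l: "1 \<le> l" "l * max \<bar>2 * fst z - 1\<bar> (g (snd z)) \<le> 1"
  have "l * g (snd z) \<le> l * max \<bar>2 * fst z - 1\<bar> (g (snd z))"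
    using l by (intro mult_left_mono) auto
  then have "g (s l (snd z)) = l * g (snd z)"
    using gs[OF z(3) l(1)] l(2) by linarith
  moreover have "2 * (1/2 + l * (fst z - 1/2)) - 1 = l * (2 * fst z - 1)"
    by (simp add: algebra_simps)
  then have "\<bar>2 * (1/2 + l * (fst z - 1/2)) - 1\<bar> = l * \<bar>2 * fst z - 1\<bar>"
    using l by (simp only: abs_mult)
  ultimately show "max \<bar>2 * fst (1/2 + l * (fst z - 1/2), s l (snd z)) - 1\<bar>
       (g (snd (1/2 + l * (fst z - 1/2), s l (snd z)))) = l * max \<bar>2 * fst z - 1\<bar> (g (snd z))"
    using l by (simp add: max_mult_distrib_left)
next
  let ?P = "prod_topology unit_interval X"
  let ?S = "{z. 1 \<le> fst z \<and> fst z * max \<bar>2 * fst (snd z) - 1\<bar> (g (snd (snd z))) \<le> 1}"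
  let ?T = "subtopology (prod_topology euclideanreal ?P) ?S"
  have 1: "continuous_map ?T euclideanreal fst"
    by (intro continuous_map_from_subtopology continuous_map_fst)
  have 2: "continuous_map ?T ?P snd"
    by (intro continuous_map_from_subtopology continuous_map_snd)
  have 3: "fst z * \<bar>2 * fst (snd z) - 1\<bar> \<le> 1 \<and> fst z * g (snd (snd z)) \<le> 1 \<and> 1 \<le> fst z"
    if "z \<in> topspace ?T" for z
  proof -
    have *: "1 \<le> fst z" "fst z * max \<bar>2 * fst (snd z) - 1\<bar> (g (snd (snd z))) \<le> 1" using that by auto
    have "fst z * \<bar>2 * fst (snd z) - 1\<bar> \<le> fst z * max \<bar>2 * fst (snd z) - 1\<bar> (g (snd (snd z)))"
      "fst z * g (snd (snd z)) \<le> fst z * max \<bar>2 * fst (snd z) - 1\<bar> (g (snd (snd z)))"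
      using * by (auto intro!: mult_left_mono)
    with * show ?thesis by linarith
  qed
  have 4: "1/2 + fst z * (fst (snd z) - 1/2) \<in> {0..1}" if "z \<in> topspace ?T" for z
  proof -
    have "\<bar>fst z * (2 * fst (snd z) - 1)\<bar> \<le> 1"
      using 3[OF that] by (simp add: abs_mult)
    then show ?thesis by (auto simp: algebra_simps abs_le_iff)
  qed
  have 5: "continuous_map ?T euclideanreal (\<lambda>z. fst (snd z))"
    by (rule continuous_map_comp[OF continuous_map_fst_real 2])
  have "continuous_map ?T unit_interval (\<lambda>z. 1/2 + fst z * (fst (snd z) - 1/2))"
    using 4 by (intro continuous_map_into_subtopology continuous_map_add continuous_map_real_mult
        continuous_map_diff 1 5) auto
  moreover have "continuous_map ?T X (\<lambda>z. s (fst z) (snd (snd z)))"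
    using 3 by (intro continuous_map_radial[OF rad] 1 continuous_map_comp[OF continuous_map_snd 2]) auto
  ultimately show "continuous_map ?T ?P
     (\<lambda>z. (1/2 + fst z * (fst (snd z) - 1/2), s (fst z) (snd (snd z))))"
    by (rule continuous_map_pairedI)
qed

text \<open>\<open>kb\<close> is the homotopy of the boundary of \<open>[0,1] \<times> X\<close>, except on the end \<open>{1} \<times> X\<close>, where it is
  \<open>k1\<close>; \<open>W\<close> is the final map of the extended homotopy.\<close>

lemma radial_prism:
  assumes rad: "radial X g s" and G: "continuous_map (prod_topology unit_interval X) Z G"
    and kb: "continuous_map (prod_topology unit_interval (prod_topology unit_interval X)) Z kb"
    and k1: "continuous_map (prod_topology unit_interval X) Z k1"
    and kb0: "\<And>x. x \<in> topspace X \<Longrightarrow> kb (0, 0, x) = G (0, x)"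
    and kbB: "\<And>x u. \<lbrakk>x \<in> topspace X; g x = 1; u \<in> {0..1}\<rbrakk> \<Longrightarrow> kb (0, u, x) = G (u, x)"
    and k10: "\<And>x. x \<in> topspace X \<Longrightarrow> k1 (0, x) = G (1, x)"
    and k1B: "\<And>x t. \<lbrakk>x \<in> topspace X; g x = 1; t \<in> {0..1}\<rbrakk> \<Longrightarrow> k1 (t, x) = kb (t, 1, x)"
  shows "\<exists>W. continuous_map (prod_topology unit_interval X) Z W \<and>
    (\<forall>x\<in>topspace X. W (0, x) = kb (1, 0, x)) \<and> (\<forall>x\<in>topspace X. W (1, x) = k1 (1, x)) \<and>
    (\<forall>x\<in>{x \<in> topspace X. g x = 1}. \<forall>u\<in>{0..1}. W (u, x) = kb (1, u, x))"
proof -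
  let ?P = "prod_topology unit_interval X"
  let ?g = "\<lambda>z. max \<bar>2 * fst z - 1\<bar> (g (snd z))"
  let ?B = "prod_topology unit_interval (subtopology ?P {z. ?g z = 1})"
  have g: "continuous_map X euclideanreal g" and g01: "\<And>x. x \<in> topspace X \<Longrightarrow> 0 \<le> g x \<and> g x \<le> 1"
    using rad by (auto simp: radial_def)
  have bd: "u = 0 \<or> u = 1 \<or> g x = 1"
    if "max \<bar>2 * u - 1\<bar> (g x) = 1" for u :: real and x
    using that by (auto simp: max_def abs_if split: if_splits)
  \<comment> \<open>On the boundary of the cylinder the test holds exactly when the height
    \<open>u = fst (snd z)\<close> is 1: at \<open>u = 0\<close>, and on the wall with
    \<open>u < 1\<close>, the minimum is 0 and the left side is positive. As an inequality between
    continuous functions it fits \<open>continuous_map_cases_le\<close>; equality occurs only on the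
    rim where \<open>u = 1\<close> and \<open>g x = 1\<close>, and there \<open>k1B\<close>
    applies.\<close>
  define k where "k = (\<lambda>z. if 1 - fst (snd z) \<le> min (fst (snd z)) (1 - g (snd (snd z)))
    then k1 (fst z, snd (snd z)) else kb z)"
  have B: "continuous_map ?B ?P snd" 
    using continuous_map_snd by (rule continuous_map_into_fulltopology)
  have sub: "continuous_map ?B (prod_topology unit_interval ?P) (\<lambda>z. z)"
    using continuous_map_pairedI[OF continuous_map_fst B] by simp
  have fs: "continuous_map ?B euclideanreal (\<lambda>z. fst (snd z))"
    by (rule continuous_map_comp[OF continuous_map_fst_real B])
  have ss: "continuous_map ?B X (\<lambda>z. snd (snd z))"
    by (rule continuous_map_comp[OF continuous_map_snd B])
  have k_in: "k (t, u, x) = (if u = 1 then k1 (t, x) else kb (t, u, x))"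
    if "x \<in> topspace X" "u \<in> {0..1}" "max \<bar>2 * u - 1\<bar> (g x) = 1" for t u x
    using bd[OF that(3)] that g01[OF that(1)] by (auto simp: k_def)
  have "continuous_map ?B Z k"
    unfolding k_def
  proof (rule continuous_map_cases_le)
    show "continuous_map ?B euclideanreal (\<lambda>z. 1 - fst (snd z))"
      by (intro continuous_map_diff fs) simp
    show "continuous_map ?B euclideanreal (\<lambda>z. min (fst (snd z)) (1 - g (snd (snd z))))"
      by (intro continuous_map_real_min fs continuous_map_diff continuous_map_comp[OF g ss]) simp
    show "continuous_map (subtopology ?B U) Z (\<lambda>z. k1 (fst z, snd (snd z)))" for U
      by (intro continuous_map_from_subtopology continuous_map_comp[OF k1] continuous_map_pairedI ss
          continuous_map_fst)
    show "continuous_map (subtopology ?B U) Z kb" for U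
      using continuous_map_comp[OF kb sub] by (intro continuous_map_from_subtopology) simp
    fix z assume "z \<in> topspace ?B" "1 - fst (snd z) = min (fst (snd z)) (1 - g (snd (snd z)))"
    then show "k1 (fst z, snd (snd z)) = kb z"
      using bd[of "fst (snd z)" "snd (snd z)"] g01[of "snd (snd z)"] k1B[of "snd (snd z)" "fst z"]
      by (cases z) (auto simp: min_def split: if_splits)
  qed
  moreover have "k (0, z) = G z" if "z \<in> topspace ?P" "?g z = 1" for z
    using that bd[of "fst z" "snd z"] k_in[of "snd z" "fst z" 0] kb0 kbB k10 by (cases z) auto
  ultimately obtain H where H: "continuous_map (prod_topology unit_interval ?P) Z H"
    and HB: "\<And>z t. \<lbrakk>z \<in> topspace ?P; ?g z = 1; t \<in> {0..1}\<rbrakk> \<Longrightarrow> H (t, z) = k (t, z)"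
    using radial_homotopy_extension[OF radial_cylinder[OF rad] G, of k] by blast
  show ?thesis
  proof (intro exI conjI ballI)
    show "continuous_map ?P Z (\<lambda>z. H (1, z))"
      by (rule continuous_map_slice[OF H]) simp
    have m: "max \<bar>2 * u - 1\<bar> (g x) = 1" if "x \<in> topspace X" "u = 0 \<or> u = 1 \<or> (g x = 1 \<and> u \<in> {0..1})"
      for u :: real and x
      using that g01[of x] by (auto simp: max_def abs_if)
    fix x assume x: "x \<in> topspace X"
    show "H (1, 0, x) = kb (1, 0, x)" "H (1, 1, x) = k1 (1, x)"
      using HB[of "(0, x)" 1] HB[of "(1, x)" 1] x m[OF x, of 0] m[OF x, of 1]
        k_in[OF x, of 0 1] k_in[OF x, of 1 1] by auto
  next
    fix x u assume "x \<in> {x \<in> topspace X. g x = 1}" "u \<in> {0..1::real}"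
    then show "H (1, u, x) = kb (1, u, x)"
      using HB[of "(u, x)" 1] k_in[of x u 1] k1B[of x 1] by (auto simp: max_def abs_if)
  qed
qed

section \<open>Relative homotopies\<close>

lemma homotopic_relI:
  assumes "continuous_map (prod_topology unit_interval X) Y h" "S \<subseteq> topspace X"
    and "\<And>x. x \<in> topspace X \<Longrightarrow> h (0, x) = f x" "\<And>x. x \<in> topspace X \<Longrightarrow> h (1, x) = g x"
    and "\<And>t x. \<lbrakk>t \<in> {0..1}; x \<in> S\<rbrakk> \<Longrightarrow> h (t, x) = f x"
  shows "homotopic_rel S X Y f g"
proof -
  have "homotopic_rel S X Y f g \<longleftrightarrow>
    (\<exists>h. continuous_map (prod_topology unit_interval X) Y h \<and> (\<forall>x\<in>topspace X. h (0, x) = f x) \<and>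
      (\<forall>x\<in>topspace X. h (1, x) = g x) \<and> (\<forall>t\<in>{0..1}. \<forall>x\<in>S. h (t, x) = f x))"
    \<comment> \<open>The rule \<open>homotopic_with\<close> asks for a predicate that only looks at
      points of \<open>X\<close>; here \<open>S \<subseteq> topspace X\<close> enters.\<close>
    unfolding homotopic_rel_def by (rule homotopic_with) (metis assms(2) subsetD)
  then show ?thesis using assms by blast
qed

text \<open>The definition of \<open>homotopic_with\<close> fixes both end maps at every argument,
  even outside the space; the unrestricted quantifiers spare membership conditions later.\<close>

lemma homotopic_relD:
  assumes "homotopic_rel S X Y f g"
  shows "\<exists>h. continuous_map (prod_topology unit_interval X) Y h \<and> (\<forall>x. h (0, x) = f x) \<and>
    (\<forall>x. h (1, x) = g x) \<and> (\<forall>t\<in>{0..1}. \<forall>x\<in>S. h (t, x) = f x)"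
  using assms unfolding homotopic_rel_def homotopic_with_def by blast

lemma homotopic_rel_eq_on:
  assumes "homotopic_rel S X Y f g" "x \<in> S"
  shows "g x = f x"
proof -
  obtain h where "h (1, x) = g x" "\<forall>t\<in>{0..1::real}. \<forall>x\<in>S. h (t, x) = f x"
    using homotopic_relD[OF assms(1)] by blast
  then show ?thesis using assms(2) by force
qed

lemma homotopic_rel_refl: "continuous_map X Y f \<Longrightarrow> homotopic_rel S X Y f f"
  by (simp add: homotopic_rel_def)

text \<open>\<open>homotopic_rel\<close> expresses stationarity through the values of its first map.
  To reverse or chain homotopies, these values must be named by another map that agrees with it on
  \<open>S\<close>.\<close>

lemma homotopic_rel_change:
  assumes "\<And>x. x \<in> S \<Longrightarrow> f x = g x"
  shows "homotopic_with (\<lambda>h. \<forall>x\<in>S. h x = f x) X Y = homotopic_with (\<lambda>h. \<forall>x\<in>S. h x = g x) X Y"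
proof -
  have "(\<lambda>h. \<forall>x\<in>S. h x = f x) = (\<lambda>h. \<forall>x\<in>S. h x = g x)"
    using assms by auto
  then show ?thesis by (rule arg_cong)
qed

lemma homotopic_rel_sym:
  assumes "homotopic_rel S X Y f g"
  shows "homotopic_rel S X Y g f"
proof -
  have "homotopic_with (\<lambda>h. \<forall>x\<in>S. h x = f x) X Y = homotopic_with (\<lambda>h. \<forall>x\<in>S. h x = g x) X Y"
    by (rule homotopic_rel_change) (use homotopic_rel_eq_on[OF assms] in auto)
  then show ?thesis
    using homotopic_with_symD[OF assms[unfolded homotopic_rel_def]]
    unfolding homotopic_rel_def by (simp only:)
qed

lemma homotopic_rel_trans:
  assumes "homotopic_rel S X Y f g" "homotopic_rel S X Y g h"
  shows "homotopic_rel S X Y f h"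
proof -
  have "homotopic_with (\<lambda>h. \<forall>x\<in>S. h x = f x) X Y = homotopic_with (\<lambda>h. \<forall>x\<in>S. h x = g x) X Y"
    by (rule homotopic_rel_change) (use homotopic_rel_eq_on[OF assms(1)] in auto)
  then show ?thesis
    using homotopic_with_trans[OF assms(1)[unfolded homotopic_rel_def]] assms(2)
    unfolding homotopic_rel_def by (simp only:)
qed

lemma homotopic_rel_cong:
  assumes "homotopic_rel S X Y f g" "S \<subseteq> topspace X"
    and "\<And>x. x \<in> topspace X \<Longrightarrow> f x = f' x" "\<And>x. x \<in> topspace X \<Longrightarrow> g x = g' x"
  shows "homotopic_rel S X Y f' g'"
proof -
  obtain h where "continuous_map (prod_topology unit_interval X) Y h"
    and "\<forall>x. h (0, x) = f x" "\<forall>x. h (1, x) = g x" "\<forall>t\<in>{0..1}. \<forall>x\<in>S. h (t, x) = f x"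
    using homotopic_relD[OF assms(1)] by blast
  then show ?thesis
    using assms(2-) by (intro homotopic_relI[of X Y h]) auto
qed

lemma homotopic_rel_compose_left:
  assumes "homotopic_rel S X Y f g" "continuous_map Y Z k"
  shows "homotopic_rel S X Z (\<lambda>x. k (f x)) (\<lambda>x. k (g x))"
  using assms homotopic_with_compose_continuous_map_left[OF assms(1)[unfolded homotopic_rel_def] assms(2),
      of "\<lambda>h. \<forall>x\<in>S. h x = k (f x)"]
  unfolding homotopic_rel_def o_def by auto

lemma homotopic_rel_compose_right:
  assumes "homotopic_rel S X Y f g" "continuous_map W X k" "\<And>w. w \<in> R \<Longrightarrow> k w \<in> S"
  shows "homotopic_rel R W Y (\<lambda>x. f (k x)) (\<lambda>x. g (k x))"
  using assms(3) homotopic_with_compose_continuous_map_right[OF assms(1)[unfolded homotopic_rel_def] assms(2),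
      of "\<lambda>h. \<forall>x\<in>R. h x = f (k x)"]
  unfolding homotopic_rel_def o_def by auto

text \<open>Take a prism with time \<open>t\<close> as height and a second parameter
  \<open>u\<close>. The homotopy between the starting maps fills the bottom, \<open>F0\<close> and
  \<open>F1\<close> fill the ends \<open>u = 0\<close> and \<open>u = 1\<close>, and on the wall
  they agree. Extending to the top \<open>t = 1\<close> yields the homotopy between the final
  maps.\<close>

lemma radial_transport_unique:
  assumes rad: "radial X g s"
    and F0: "continuous_map (prod_topology unit_interval X) Z F0"
    and F1: "continuous_map (prod_topology unit_interval X) Z F1"
    and B: "\<And>x t. \<lbrakk>x \<in> topspace X; g x = 1; t \<in> {0..1}\<rbrakk> \<Longrightarrow> F1 (t, x) = F0 (t, x)"
    and start: "homotopic_rel {x \<in> topspace X. g x = 1} X Z (\<lambda>x. F0 (0, x)) (\<lambda>x. F1 (0, x))"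
  shows "homotopic_rel {x \<in> topspace X. g x = 1} X Z (\<lambda>x. F0 (1, x)) (\<lambda>x. F1 (1, x))"
proof -
  obtain h where h: "continuous_map (prod_topology unit_interval X) Z h"
    "\<forall>x. h (0, x) = F0 (0, x)" "\<forall>x. h (1, x) = F1 (0, x)"
    "\<forall>t\<in>{0..1}. \<forall>x\<in>{x \<in> topspace X. g x = 1}. h (t, x) = F0 (0, x)"
    using homotopic_relD[OF start] by blast
  define kb where "kb = (\<lambda>z :: real \<times> real \<times> 'a. F0 (fst z, snd (snd z)))"
  have kb: "continuous_map (prod_topology unit_interval (prod_topology unit_interval X)) Z kb"
    unfolding kb_def by (intro continuous_map_comp[OF F0] continuous_map_pairedI continuous_map_fst
        continuous_map_comp[OF continuous_map_snd continuous_map_snd])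
  have [simp]: "kb (t, u, x) = F0 (t, x)" for t u x
    by (simp add: kb_def)
  have "\<exists>W. continuous_map (prod_topology unit_interval X) Z W \<and>
      (\<forall>x\<in>topspace X. W (0, x) = kb (1, 0, x)) \<and> (\<forall>x\<in>topspace X. W (1, x) = F1 (1, x)) \<and>
      (\<forall>x\<in>{x \<in> topspace X. g x = 1}. \<forall>u\<in>{0..1}. W (u, x) = kb (1, u, x))"
    by (rule radial_prism[OF rad h(1) kb F1]) (use h(2-4) B in auto)
  then obtain W where W: "continuous_map (prod_topology unit_interval X) Z W"
    "\<forall>x\<in>topspace X. W (0, x) = F0 (1, x)" "\<forall>x\<in>topspace X. W (1, x) = F1 (1, x)"
    "\<forall>x\<in>{x \<in> topspace X. g x = 1}. \<forall>u\<in>{0..1}. W (u, x) = F0 (1, x)"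
    by auto
  then show ?thesis
    by (intro homotopic_relI[of X Z W]) auto
qed

text \<open>Appending the given homotopy to \<open>G\<close> would change the timing on the sphere.
  Instead the whole cylinder of \<open>G\<close> is deformed: the end \<open>u = 1\<close> moves
  along the given homotopy, while the other end and the wall stay still. The last stage of this
  deformation is \<open>W\<close>.\<close>

lemma radial_transport_adjust:
  assumes rad: "radial X g s"
    and G: "continuous_map (prod_topology unit_interval X) Z G"
    and final: "homotopic_rel {x \<in> topspace X. g x = 1} X Z (\<lambda>x. G (1, x)) f"
  shows "\<exists>W. continuous_map (prod_topology unit_interval X) Z W \<and>
    (\<forall>x\<in>topspace X. W (0, x) = G (0, x)) \<and> (\<forall>x\<in>topspace X. W (1, x) = f x) \<and>
    (\<forall>x\<in>{x \<in> topspace X. g x = 1}. \<forall>u\<in>{0..1}. W (u, x) = G (u, x))"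
proof -
  obtain h where h: "continuous_map (prod_topology unit_interval X) Z h"
    "\<forall>x. h (0, x) = G (1, x)" "\<forall>x. h (1, x) = f x"
    "\<forall>t\<in>{0..1}. \<forall>x\<in>{x \<in> topspace X. g x = 1}. h (t, x) = G (1, x)"
    using homotopic_relD[OF final] by blast
  define kb where "kb = (\<lambda>z :: real \<times> real \<times> 'a. G (snd z))"
  have kb: "continuous_map (prod_topology unit_interval (prod_topology unit_interval X)) Z kb"
    unfolding kb_def by (intro continuous_map_comp[OF G] continuous_map_snd)
  have [simp]: "kb (t, u, x) = G (u, x)" for t u x
    by (simp add: kb_def)
  have "\<exists>W. continuous_map (prod_topology unit_interval X) Z W \<and>
      (\<forall>x\<in>topspace X. W (0, x) = kb (1, 0, x)) \<and> (\<forall>x\<in>topspace X. W (1, x) = h (1, x)) \<and>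
      (\<forall>x\<in>{x \<in> topspace X. g x = 1}. \<forall>u\<in>{0..1}. W (u, x) = kb (1, u, x))"
    by (rule radial_prism[OF rad G kb h(1)]) (use h(2-4) in auto)
  then show ?thesis
    using h(3) by simp
qed

section \<open>The affine simplex\<close>

abbreviation simplex_top :: "'v set \<Rightarrow> ('v \<Rightarrow> real) topology" where
  "simplex_top A \<equiv> top_of_set (affine_simplex A)"

definition simplex_boundary :: "'v set \<Rightarrow> ('v \<Rightarrow> real) set" where
  "simplex_boundary A = {t \<in> affine_simplex A. \<exists>v\<in>A. t v = 0}"

lemma simplex_boundary_subset: "simplex_boundary A \<subseteq> affine_simplex A"
  by (auto simp: simplex_boundary_def)

lemma continuous_map_Max:
  assumes "finite A" "A \<noteq> {}" "\<And>v. v \<in> A \<Longrightarrow> continuous_map X euclideanreal (f v)"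
  shows "continuous_map X euclideanreal (\<lambda>x. Max ((\<lambda>v. f v x) ` A))"
  using assms by (induction A rule: finite_ne_induct) (auto intro: continuous_map_real_max)

lemma continuous_map_into_functions:
  fixes f :: "'a \<Rightarrow> 'v \<Rightarrow> real"
  shows "continuous_map X euclidean f \<longleftrightarrow> (\<forall>v. continuous_map X euclideanreal (\<lambda>x. f x v))"
  by (simp add: continuous_map_componentwise_UNIV flip: euclidean_product_topology)

lemma continuous_map_coordinate:
  "continuous_map (top_of_set S) euclideanreal (\<lambda>t :: 'v \<Rightarrow> real. t v)"
  using continuous_on_subset[OF continuous_on_product_coordinates] by auto

text \<open>The gauge is \<open>1 - N * min t\<close> for \<open>N = card A\<close>; scaling fixes the barycentre.\<close>

lemma radial_simplex:
  assumes A: "finite A" "A \<noteq> {}"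
  shows "\<exists>g s. radial (simplex_top A) g s \<and> {t \<in> affine_simplex A. g t = 1} = simplex_boundary A"
proof -
  define N where "N = real (card A)"
  define g where "g = (\<lambda>t. Max ((\<lambda>v. 1 - N * t v) ` A))"
  define s where "s = (\<lambda>l t v. if v \<in> A then 1/N + l * (t v - 1/N) else (0::real))"
  have N: "0 < N" using A by (simp add: N_def card_gt_0_iff)
  have le: "g t \<le> c \<longleftrightarrow> (\<forall>v\<in>A. 1 - N * t v \<le> c)" for t c
    unfolding g_def using A by (subst Max_le_iff) auto
  have att: "\<exists>v\<in>A. g t = 1 - N * t v" for t
  proof -
    have "g t \<in> (\<lambda>v. 1 - N * t v) ` A"
      unfolding g_def by (rule Max_in) (use A in auto)
    then show ?thesis by blast
  qed
  \<comment> \<open>Scaling about the barycentre multiplies each \<open>1 - N * t v\<close> by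
    \<open>l\<close>, and multiplication by \<open>l\<close> is monotone, so it commutes with
    \<open>Max\<close>.\<close>
  have gs: "g (s l t) = l * g t" if "1 \<le> l" for l t
  proof -
    have "mono ((*) l)" using that by (auto intro!: monoI mult_left_mono)
    then have "l * g t = Max ((*) l ` (\<lambda>v. 1 - N * t v) ` A)"
      unfolding g_def by (rule mono_Max_commute) (use A in auto)
    also have "(*) l ` (\<lambda>v. 1 - N * t v) ` A = (\<lambda>v. 1 - N * s l t v) ` A"
      unfolding image_image using N by (intro image_cong) (auto simp: s_def field_simps)
    finally show ?thesis by (simp add: g_def)
  qed
  \<comment> \<open>If every coordinate exceeded \<open>1/N\<close>, their sum would exceed
    1.\<close>
  have gpos: "0 \<le> g t" if "t \<in> affine_simplex A" for t
  proof (rule ccontr)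
    assume "\<not> 0 \<le> g t"
    then have "\<not> (\<exists>v\<in>A. 0 \<le> 1 - N * t v)" using le[of t "g t"] by force
    then have "(\<Sum>v\<in>A. 1/N) < (\<Sum>v\<in>A. t v)"
      using A N by (intro sum_strict_mono) (auto simp: field_simps not_le)
    then show False using that N by (simp add: affine_simplex_def N_def)
  qed
  have gle: "g t \<le> 1" if "t \<in> affine_simplex A" for t
    using that N by (auto simp: le affine_simplex_def)
  \<comment> \<open>A gauge of at most 1 means that all coordinates over \<open>A\<close> are
    nonnegative, so \<open>l * g t \<le> 1\<close> is exactly what keeps the scaled point in the
    simplex.\<close>
  have s_in: "s l t \<in> affine_simplex A" if t: "t \<in> affine_simplex A" and l: "1 \<le> l" "l * g t \<le> 1" for l t
  proof -
    have "0 \<le> s l t v" for v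
    proof (cases "v \<in> A")
      case True
      have "1 - N * s l t v \<le> 1"
        using le[of "s l t" 1] gs[OF l(1), of t] l(2) True by auto
      then show ?thesis using N by (simp add: zero_le_mult_iff)
    qed (simp add: s_def)
    moreover have "(\<Sum>v\<in>A. s l t v) = 1"
      using t A by (simp add: s_def sum.distrib sum_subtractf affine_simplex_def N_def
          flip: sum_distrib_left)
    ultimately show ?thesis by (simp add: affine_simplex_def s_def)
  qed
  have "radial (simplex_top A) g s"
    unfolding radial_def
  proof (intro conjI ballI allI impI)
    show "continuous_map (simplex_top A) euclideanreal g"
      unfolding g_def by (intro continuous_map_Max A continuous_map_diff continuous_map_real_mult_left
          continuous_map_coordinate) simp
    fix t assume t: "t \<in> topspace (simplex_top A)"
    show "0 \<le> g t" "g t \<le> 1" using gpos gle t by auto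
    show "s 1 t = t" using t by (auto simp: s_def affine_simplex_def)
    show "g (s l t) = l * g t" if "1 \<le> l" for l using gs[OF that] .
  next
    let ?T = "subtopology (prod_topology euclideanreal (simplex_top A)) {z. 1 \<le> fst z \<and> fst z * g (snd z) \<le> 1}"
    have 1: "continuous_map ?T euclideanreal fst"
      by (intro continuous_map_from_subtopology continuous_map_fst)
    have 2: "continuous_map ?T euclideanreal (\<lambda>z. snd z v)" for v
      by (intro continuous_map_from_subtopology continuous_map_snd
          continuous_map_comp[OF continuous_map_coordinate[of "affine_simplex A" v]])
    have "continuous_map ?T euclideanreal (\<lambda>z. s (fst z) (snd z) v)" for v
      by (cases "v \<in> A") (auto simp: s_def intro!: continuous_map_add continuous_map_real_mult
          continuous_map_diff 1 2)
    then show "continuous_map ?T (simplex_top A) (\<lambda>z. s (fst z) (snd z))"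
      using s_in by (intro continuous_map_into_subtopology) (auto simp: continuous_map_into_functions)
  qed
  moreover have "{t \<in> affine_simplex A. g t = 1} = simplex_boundary A"
  proof -
    have "g t = 1 \<longleftrightarrow> (\<exists>v\<in>A. t v = 0)" if "t \<in> affine_simplex A" for t
    proof
      assume "g t = 1"
      then show "\<exists>v\<in>A. t v = 0" using att[of t] N by auto
    next
      assume "\<exists>v\<in>A. t v = 0"
      then obtain v where "v \<in> A" "t v = 0" by blast
      then have "1 \<le> g t" using le[of t "g t"] by auto
      then show "g t = 1" using gle[OF that] by simp
    qed
    then show ?thesis by (auto simp: simplex_boundary_def)
  qed
  ultimately show ?thesis by blast
qed

lemma simplex_homotopy_extension:
  assumes "finite A" "A \<noteq> {}" "continuous_map (simplex_top A) Z f"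
    and "continuous_map (prod_topology unit_interval (top_of_set (simplex_boundary A))) Z k"
    and "\<And>x. x \<in> simplex_boundary A \<Longrightarrow> k (0, x) = f x"
  shows "\<exists>H. continuous_map (prod_topology unit_interval (simplex_top A)) Z H \<and>
    (\<forall>x\<in>affine_simplex A. H (0, x) = f x) \<and>
    (\<forall>x\<in>simplex_boundary A. \<forall>t\<in>{0..1}. H (t, x) = k (t, x))"
proof -
  obtain g s where rad: "radial (simplex_top A) g s"
    and B: "{t \<in> affine_simplex A. g t = 1} = simplex_boundary A"
    using radial_simplex[OF assms(1,2)] by blast
  have "subtopology (simplex_top A) {x. g x = 1} = top_of_set (simplex_boundary A)"
    using B by (simp add: subtopology_subtopology Int_def)
  then show ?thesis
    using radial_homotopy_extension[OF rad assms(3), of k] assms(4,5) B by auto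
qed

lemma simplex_transport_unique:
  assumes "finite A" "A \<noteq> {}"
    and "continuous_map (prod_topology unit_interval (simplex_top A)) Z F0"
    and "continuous_map (prod_topology unit_interval (simplex_top A)) Z F1"
    and "\<And>x t. \<lbrakk>x \<in> simplex_boundary A; t \<in> {0..1}\<rbrakk> \<Longrightarrow> F1 (t, x) = F0 (t, x)"
    and "homotopic_rel (simplex_boundary A) (simplex_top A) Z (\<lambda>x. F0 (0, x)) (\<lambda>x. F1 (0, x))"
  shows "homotopic_rel (simplex_boundary A) (simplex_top A) Z (\<lambda>x. F0 (1, x)) (\<lambda>x. F1 (1, x))"
proof -
  obtain g s where rad: "radial (simplex_top A) g s"
    and B: "{t \<in> affine_simplex A. g t = 1} = simplex_boundary A"
    using radial_simplex[OF assms(1,2)] by blast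
  then show ?thesis
    using radial_transport_unique[OF rad assms(3,4)] assms(5,6) by auto
qed

lemma simplex_transport_adjust:
  assumes "finite A" "A \<noteq> {}"
    and "continuous_map (prod_topology unit_interval (simplex_top A)) Z G"
    and "homotopic_rel (simplex_boundary A) (simplex_top A) Z (\<lambda>x. G (1, x)) f"
  shows "\<exists>W. continuous_map (prod_topology unit_interval (simplex_top A)) Z W \<and>
    (\<forall>x\<in>affine_simplex A. W (0, x) = G (0, x)) \<and> (\<forall>x\<in>affine_simplex A. W (1, x) = f x) \<and>
    (\<forall>x\<in>simplex_boundary A. \<forall>u\<in>{0..1}. W (u, x) = G (u, x))"
proof -
  obtain g s where rad: "radial (simplex_top A) g s"
    and B: "{t \<in> affine_simplex A. g t = 1} = simplex_boundary A"
    using radial_simplex[OF assms(1,2)] by blast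
  show ?thesis
    using radial_transport_adjust[OF rad assms(3), of f] assms(4) B by simp
qed

section \<open>Characteristic maps of the realization\<close>

lemma openin_sum_topology_component:
  assumes "i \<in> I" "openin (X i) U"
  shows "openin (sum_topology X I) ({i} \<times> U)"
proof -
  have "openin (sum_topology X I) ((\<lambda>x. (i, x)) ` U)"
    using open_map_component_injection[OF assms(1), of X] assms(2) unfolding open_map_def by blast
  moreover have "(\<lambda>x. (i, x)) ` U = {i} \<times> U" by auto
  ultimately show ?thesis by simp
qed

lemma continuous_map_snd_component:
  assumes "i \<in> I"
  shows "continuous_map (subtopology (sum_topology X I) ({i} \<times> topspace (X i))) (X i) snd"
  unfolding continuous_map_def
proof (intro conjI allI impI)
  show "snd \<in> topspace (subtopology (sum_topology X I) ({i} \<times> topspace (X i))) \<rightarrow> topspace (X i)"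
    by auto
  fix U assume U: "openin (X i) U"
  have "{x \<in> topspace (subtopology (sum_topology X I) ({i} \<times> topspace (X i))). snd x \<in> U}
      = ({i} \<times> U) \<inter> ({i} \<times> topspace (X i))"
    using openin_subset[OF U] assms by auto
  moreover have "openin (sum_topology X I) ({i} \<times> U)"
    using U by (rule openin_sum_topology_component[OF assms])
  ultimately show "openin (subtopology (sum_topology X I) ({i} \<times> topspace (X i)))
     {x \<in> topspace (subtopology (sum_topology X I) ({i} \<times> topspace (X i))). snd x \<in> U}"
    unfolding openin_subtopology by blast
qed

text \<open>The slabs over the single summands are open and cover the product, so continuity may be
  checked on each of them.\<close>

lemma continuous_map_prod_sum_topology:
  assumes "\<And>i. i \<in> I \<Longrightarrow> continuous_map (prod_topology T (X i)) Z (\<lambda>z. h (fst z, (i, snd z)))"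
  shows "continuous_map (prod_topology T (sum_topology X I)) Z h"
proof (rule pasting_lemma[where I = I and T = "\<lambda>i. topspace T \<times> ({i} \<times> topspace (X i))" and f = "\<lambda>i. h"])
  fix i assume i: "i \<in> I"
  let ?S = "subtopology (sum_topology X I) ({i} \<times> topspace (X i))"
  have "openin (sum_topology X I) ({i} \<times> topspace (X i))"
    by (rule openin_sum_topology_component[OF i]) simp
  then show "openin (prod_topology T (sum_topology X I)) (topspace T \<times> ({i} \<times> topspace (X i)))"
    by (simp add: openin_prod_Times_iff)
  have "continuous_map (prod_topology T ?S) (prod_topology T (X i)) (\<lambda>z. (fst z, snd (snd z)))"
    by (intro continuous_map_pairedI continuous_map_fst
        continuous_map_comp[OF continuous_map_snd_component[OF i] continuous_map_snd])
  from continuous_map_comp[OF assms[OF i] this]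
  have "continuous_map (prod_topology T ?S) Z h"
    by (rule continuous_map_eq) auto
  then show "continuous_map (subtopology (prod_topology T (sum_topology X I))
      (topspace T \<times> ({i} \<times> topspace (X i)))) Z h"
    by (simp add: subtopology_Times)
qed auto

lemma disjoint_simplices_eq:
  "disjoint_simplices K = sum_topology (\<lambda>i. simplex_top (fst i)) {(A, \<sigma>). \<sigma> \<in> simplices K A}"
  by (simp add: disjoint_simplices_def euclidean_product_topology case_prod_beta')

definition char_map :: "('v, 's) multicomplex \<Rightarrow> 'v set \<Rightarrow> 's \<Rightarrow> ('v \<Rightarrow> real) \<Rightarrow> ('v, 's) mpoint" where
  "char_map K A \<sigma> t = glue K ((A, \<sigma>), t)"

lemma char_map_eq: "char_map K A \<sigma> t = (({v. t v \<noteq> 0}, bd K A {v. t v \<noteq> 0} \<sigma>), t)"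
  by (simp add: char_map_def glue_def)

lemma continuous_map_char_map:
  assumes "\<sigma> \<in> simplices K A"
  shows "continuous_map (simplex_top A) (realization K) (char_map K A \<sigma>)"
proof -
  have "continuous_map (simplex_top A) (disjoint_simplices K) (\<lambda>t. ((A, \<sigma>), t))"
    unfolding disjoint_simplices_eq
    using continuous_map_component_injection[of "(A, \<sigma>)" "{(A, \<sigma>). \<sigma> \<in> simplices K A}"
        "\<lambda>i. simplex_top (fst i)"] assms by simp
  from continuous_map_comp[OF quotient_imp_continuous_map[OF quotient_map_glue] this]
  show ?thesis
    by (simp add: char_map_def[abs_def])
qed

text \<open>Products with an identity map do not preserve quotient maps in general, but they do when
  the factor is locally compact Hausdorff, as the interval is. Hence a homotopy on the realization
  may be checked one simplex at a time.\<close>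

lemma continuous_map_prod_realization:
  assumes "\<And>A \<sigma>. \<sigma> \<in> simplices K A \<Longrightarrow>
      continuous_map (prod_topology unit_interval (simplex_top A)) Z
        (\<lambda>z. h (fst z, char_map K A \<sigma> (snd z)))"
  shows "continuous_map (prod_topology unit_interval (realization K)) Z h"
proof -
  have "quotient_map (prod_topology unit_interval (disjoint_simplices K))
      (prod_topology unit_interval (realization K)) (\<lambda>(x, y). (x, glue K y))"
  proof (rule quotient_map_prod_right)
    show "locally_compact_space unit_interval"
      by (intro compact_imp_locally_compact_space compact_space_subtopology) simp
  qed (simp_all add: Hausdorff_space_subtopology quotient_map_glue)
  moreover have "continuous_map (prod_topology unit_interval (disjoint_simplices K)) Z
      (h \<circ> (\<lambda>(x, y). (x, glue K y)))"
    unfolding disjoint_simplices_eq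
  proof (rule continuous_map_prod_sum_topology)
    fix i :: "'a set \<times> 'b" assume "i \<in> {(A, \<sigma>). \<sigma> \<in> simplices K A}"
    then show "continuous_map (prod_topology unit_interval (simplex_top (fst i))) Z
        (\<lambda>z. (h \<circ> (\<lambda>(x, y). (x, glue K y))) (fst z, (i, snd z)))"
      using assms[of "snd i" "fst i"] by (auto simp: char_map_def)
  qed
  ultimately show ?thesis
    by (rule continuous_compose_quotient_map)
qed

lemma continuous_map_realization:
  assumes "\<And>A \<sigma>. \<sigma> \<in> simplices K A \<Longrightarrow> continuous_map (simplex_top A) Z (\<lambda>t. h (char_map K A \<sigma> t))"
  shows "continuous_map (realization K) Z h"
proof -
  \<comment> \<open>The map is read as a homotopy that ignores time.\<close>
  have "continuous_map (prod_topology unit_interval (realization K)) Z (\<lambda>z. h (snd z))"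
    by (rule continuous_map_prod_realization)
      (simp only: snd_conv continuous_map_comp[OF assms continuous_map_snd])
  from continuous_map_slice[OF this, of 0] show ?thesis by simp
qed

section \<open>Points, faces and boundaries of simplices\<close>

lemma realization_cases:
  assumes "x \<in> topspace (realization K)"
  obtains A \<sigma> t where "\<sigma> \<in> simplices K A" "t \<in> affine_simplex A" "x = char_map K A \<sigma> t"
  using assms by (auto simp: topspace_realization topspace_disjoint_simplices char_map_def)

lemma char_map_in_realization:
  "\<lbrakk>\<sigma> \<in> simplices K A; t \<in> affine_simplex A\<rbrakk> \<Longrightarrow> char_map K A \<sigma> t \<in> topspace (realization K)"
  by (auto simp: topspace_realization topspace_disjoint_simplices char_map_def)

lemma affine_simplex_mono:
  assumes "t \<in> affine_simplex B" "B \<subseteq> A" "finite A"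
  shows "t \<in> affine_simplex A"
proof -
  have "(\<Sum>v\<in>A. t v) = (\<Sum>v\<in>B. t v)"
    using assms by (intro sum.mono_neutral_right) (auto simp: affine_simplex_def)
  then show ?thesis using assms by (auto simp: affine_simplex_def)
qed

text \<open>A point with a vanishing coordinate lies in the face spanned by its support.\<close>

lemma simplex_boundary_iff:
  assumes "finite A"
  shows "t \<in> simplex_boundary A \<longleftrightarrow> (\<exists>B. B \<subset> A \<and> B \<noteq> {} \<and> t \<in> affine_simplex B)"
proof
  assume t: "t \<in> simplex_boundary A"
  then have "t \<in> affine_simplex A" by (simp add: simplex_boundary_def)
  note supp = affine_simplex_support[OF this assms]
  show "\<exists>B. B \<subset> A \<and> B \<noteq> {} \<and> t \<in> affine_simplex B"
    using supp t by (intro exI[of _ "{v. t v \<noteq> 0}"]) (auto simp: simplex_boundary_def)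
next
  assume "\<exists>B. B \<subset> A \<and> B \<noteq> {} \<and> t \<in> affine_simplex B"
  then obtain B where B: "B \<subset> A" "t \<in> affine_simplex B" by blast
  then obtain v where "v \<in> A" "t v = 0" by (auto simp: affine_simplex_def)
  then show "t \<in> simplex_boundary A"
    using affine_simplex_mono[OF B(2), of A] B(1) assms by (auto simp: simplex_boundary_def)
qed

text \<open>The barycentre serves as an interior point, at which a simplex can be read off from its
  characteristic map; it also witnesses that the affine simplex is nonempty.\<close>

lemma barycenter_exists:
  assumes "finite A" "A \<noteq> {}"
  shows "\<exists>t\<in>affine_simplex A. {v. t v \<noteq> 0} = A"
  by (rule bexI[of _ "\<lambda>v. if v \<in> A then 1 / real (card A) else 0"])
    (use assms in \<open>auto simp: affine_simplex_def\<close>)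

lemma closed_affine_simplex: "closed (affine_simplex A :: ('v \<Rightarrow> real) set)"
proof -
  have c: "continuous_on UNIV (\<lambda>t :: 'v \<Rightarrow> real. t v)" for v by simp
  have "closed {t :: 'v \<Rightarrow> real. v \<notin> A \<longrightarrow> t v = 0}" for v
    by (cases "v \<in> A") (auto intro!: closed_Collect_eq c continuous_on_const)
  then show ?thesis
    unfolding affine_simplex_def
    by (intro closed_Collect_conj closed_Collect_all closed_Collect_le closed_Collect_eq
        continuous_on_const continuous_on_sum c)
qed

text \<open>The boundary is a finite union of closed faces, and agreement on overlaps is trivial
  because a single function \<open>k\<close> is used on all of them.\<close>

lemma continuous_map_prod_boundary:
  assumes A: "finite A"
    and k: "\<And>B. \<lbrakk>B \<subset> A; B \<noteq> {}\<rbrakk> \<Longrightarrow> continuous_map (prod_topology unit_interval (simplex_top B)) Z k"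
  shows "continuous_map (prod_topology unit_interval (top_of_set (simplex_boundary A))) Z k"
proof (rule pasting_lemma_closed[where I = "{B. B \<subset> A \<and> B \<noteq> {}}" and f = "\<lambda>B. k"
      and T = "\<lambda>B. {0..1} \<times> affine_simplex B"])
  show "finite {B. B \<subset> A \<and> B \<noteq> {}}"
    by (rule finite_subset[of _ "Pow A"]) (use A in auto)
  fix B assume B: "B \<in> {B. B \<subset> A \<and> B \<noteq> {}}"
  then have sub: "{0..1::real} \<times> affine_simplex B \<subseteq> {0..1} \<times> simplex_boundary A"
    using simplex_boundary_iff[OF A] by auto
  then show "closedin (prod_topology unit_interval (top_of_set (simplex_boundary A)))
      ({0..1} \<times> affine_simplex B)"
    by (simp add: closed_subset closed_Times closed_affine_simplex)
  show "continuous_map (subtopology (prod_topology unit_interval (top_of_set (simplex_boundary A)))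
      ({0..1} \<times> affine_simplex B)) Z k"
    using k[of B] B sub by (simp add: subtopology_subtopology Int_absorb1)
next
  fix z assume "z \<in> topspace (prod_topology unit_interval (top_of_set (simplex_boundary A)))"
  then show "\<exists>B. B \<in> {B. B \<subset> A \<and> B \<noteq> {}} \<and> z \<in> {0..1} \<times> affine_simplex B \<and> k z = k z"
    using simplex_boundary_iff[OF A] by (cases z) auto
qed auto

context multicomplex
begin

lemma char_map_face:
  assumes "\<sigma> \<in> simplices K A" "B \<subseteq> A" "B \<noteq> {}" "t \<in> affine_simplex B"
  shows "char_map K B (bd K A B \<sigma>) t = char_map K A \<sigma> t"
proof -
  have "finite B" using vertex_set[OF assms(1)] assms(2) finite_subset by blast
  from affine_simplex_support[OF assms(4) this] show ?thesis
    using bd_bd[OF assms(1,2)] by (simp add: char_map_eq)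
qed

text \<open>A point of the realization carries the simplex in whose interior it lies, so the values
  at the barycentre of \<open>B\<close> display the two faces over \<open>B\<close>.\<close>

lemma bd_eqI:
  assumes "finite B" "B \<noteq> {}" "\<And>t. t \<in> affine_simplex B \<Longrightarrow> char_map K A \<sigma> t = char_map K A' \<sigma>' t"
  shows "bd K A B \<sigma> = bd K A' B \<sigma>'"
proof -
  obtain t where "t \<in> affine_simplex B" "{v. t v \<noteq> 0} = B"
    using barycenter_exists[OF assms(1,2)] by blast
  then show ?thesis using assms(3)[of t] by (simp add: char_map_eq)
qed

text \<open>The homotopy is stationary on the boundary, so both characteristic maps agree there.
  This recovers the equality of boundaries, which \<open>simplex_homotopic\<close> does not state
  explicitly.\<close>

lemma faces_eq_of_homotopic_rel:
  assumes "homotopic_rel (simplex_boundary A) (simplex_top A) Z (char_map K A \<sigma>) (char_map K A \<tau>)"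
    and "finite A" "B \<subset> A" "B \<noteq> {}"
  shows "bd K A B \<tau> = bd K A B \<sigma>"
proof (rule bd_eqI)
  show "finite B" using assms finite_subset by blast
  fix t assume "t \<in> affine_simplex B"
  then show "char_map K A \<tau> t = char_map K A \<sigma> t"
    using homotopic_rel_eq_on[OF assms(1)] simplex_boundary_iff[OF assms(2)] assms(3,4) by blast
qed (use assms in auto)

lemma char_map_eq_on_boundary:
  assumes "\<sigma> \<in> simplices K A" "\<tau> \<in> simplices K A" "t \<in> simplex_boundary A"
    and "\<And>B. \<lbrakk>B \<subset> A; B \<noteq> {}\<rbrakk> \<Longrightarrow> bd K A B \<sigma> = bd K A B \<tau>"
  shows "char_map K A \<sigma> t = char_map K A \<tau> t"
proof -
  obtain B where "B \<subset> A" "B \<noteq> {}" "t \<in> affine_simplex B"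
    using assms(3) simplex_boundary_iff[of A t] vertex_set[OF assms(1)] by auto
  then show ?thesis
    using char_map_face[OF assms(1), of B t] char_map_face[OF assms(2), of B t] assms(4)[of B] by auto
qed

text \<open>Completeness and minimality only speak about \<open>n \<ge> 1\<close>. In dimension 0
  uniqueness comes from the definition of a multicomplex; this starts the inductions over
  faces.\<close>

lemma singleton_simplex_unique:
  assumes "\<sigma> \<in> simplices K A" "\<tau> \<in> simplices K A" "card A < 2"
  shows "\<sigma> = \<tau>"
proof -
  have "finite A" "A \<noteq> {}" "A \<subseteq> vertices K" using vertex_set[OF assms(1)] by auto
  moreover from this have "card A = 1"
    using assms(3) card_gt_0_iff[of A] by linarith
  ultimately obtain v where "A = {v}" "v \<in> vertices K"
    by (auto simp: card_1_singleton_iff)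
  then show ?thesis using vertex_simplex[of v] assms by auto
qed

end

lemma char_map_submulticomplex:
  assumes "submulticomplex L K" "\<sigma> \<in> simplices L A" "t \<in> affine_simplex A"
  shows "char_map L A \<sigma> t = char_map K A \<sigma> t"
proof -
  interpret L: multicomplex L using assms(1) by (simp add: submulticomplex_def)
  from affine_simplex_support[OF assms(3)] L.vertex_set[OF assms(2)] show ?thesis
    using assms by (auto simp: char_map_eq submulticomplex_def)
qed

lemma continuous_map_inclusion:
  assumes "submulticomplex L K"
  shows "continuous_map (realization L) (realization K) (\<lambda>x. x)"
proof (rule continuous_map_realization)
  fix A \<sigma> assume s: "\<sigma> \<in> simplices L A"
  then have "\<sigma> \<in> simplices K A" using assms by (auto simp: submulticomplex_def)
  from continuous_map_char_map[OF this]
  show "continuous_map (simplex_top A) (realization K) (char_map L A \<sigma>)"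
    by (rule continuous_map_eq) (simp add: char_map_submulticomplex[OF assms s])
qed

lemma realization_map_char_map:
  assumes "multicomplex K" "simplicial_map K K' \<phi>" "\<sigma> \<in> simplices K A" "t \<in> affine_simplex A"
  shows "realization_map \<phi> (char_map K A \<sigma> t) = char_map K' (vmap \<phi> ` A) (simap \<phi> A \<sigma>)
    (\<lambda>w. \<Sum>v | v \<in> A \<and> vmap \<phi> v = w. t v)"
  using realization_map_glue(2)[OF assms(1,2), of "((A, \<sigma>), t)"] assms(3,4)
  by (simp add: char_map_def realization_map_def topspace_disjoint_simplices)

lemma realization_map_char_map_id:
  assumes "multicomplex K" "simplicial_map K K' \<phi>" "\<sigma> \<in> simplices K A" "t \<in> affine_simplex A"
    and "\<And>v. v \<in> vertices K \<Longrightarrow> vmap \<phi> v = v"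
  shows "realization_map \<phi> (char_map K A \<sigma> t) = char_map K' A (simap \<phi> A \<sigma>) t"
    and "simap \<phi> A \<sigma> \<in> simplices K' A"
proof -
  interpret multicomplex K by fact
  have A: "A \<subseteq> vertices K" using vertex_set[OF assms(3)] by auto
  then have im: "vmap \<phi> ` A = A" using assms(5) by force
  have "{v \<in> A. vmap \<phi> v = w} = (if w \<in> A then {w} else {})" for w
    using A assms(5) by (auto simp: subset_iff)
  then have "(\<lambda>w. \<Sum>v | v \<in> A \<and> vmap \<phi> v = w. t v) = t"
    using assms(4) by (auto simp: affine_simplex_def fun_eq_iff)
  then show "realization_map \<phi> (char_map K A \<sigma> t) = char_map K' A (simap \<phi> A \<sigma>) t"
    using realization_map_char_map[OF assms(1-4)] im by simp
  show "simap \<phi> A \<sigma> \<in> simplices K' A"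
  proof -
    have "simap \<phi> A \<sigma> \<in> simplices K' (vmap \<phi> ` A)"
      using assms(2,3) unfolding simplicial_map_def by blast
    then show ?thesis using im by simp
  qed
qed

lemma continuous_map_realization_map:
  assumes "multicomplex K" "simplicial_map K K' \<phi>" "\<And>v. v \<in> vertices K \<Longrightarrow> vmap \<phi> v = v"
  shows "continuous_map (realization K) (realization K') (realization_map \<phi>)"
proof (rule continuous_map_realization)
  fix A \<sigma> assume s: "\<sigma> \<in> simplices K A"
  note id = realization_map_char_map_id[OF assms(1,2) s _ assms(3)]
  have "A \<noteq> {}" "finite A" using multicomplex.vertex_set[OF assms(1) s] by auto
  then obtain t where "t \<in> affine_simplex A" using barycenter_exists by blast
  from continuous_map_char_map[OF id(2)[OF this]]
  show "continuous_map (simplex_top A) (realization K') (\<lambda>t. realization_map \<phi> (char_map K A \<sigma> t))"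
    by (rule continuous_map_eq) (use id(1) in auto)
qed

section \<open>Standard simplices and simplices with an arbitrary vertex set\<close>

lemma std_simplex_simps:
  "vertices (std_simplex n) = {..n}"
  "simplices (std_simplex n) B = (if B \<noteq> {} \<and> B \<subseteq> {..n} then {B} else {})"
  "bd (std_simplex n) = (\<lambda>A B \<sigma>. B)"
  by (auto simp: std_simplex_def mc_of_complex_def)

lemma std_boundary_simps:
  "simplices (std_boundary n) B = (if B \<noteq> {} \<and> B \<subset> {..n} then {B} else {})"
  "bd (std_boundary n) = (\<lambda>A B \<sigma>. B)"
  by (auto simp: std_boundary_def mc_of_complex_def)

lemma vertices_std_boundary_subset: "vertices (std_boundary n) \<subseteq> {..n}"
  by (auto simp: std_boundary_def mc_of_complex_def)

lemma topspace_std_simplex: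
  "topspace (realization (std_simplex n)) =
    (\<lambda>t. (({v. t v \<noteq> 0}, {v. t v \<noteq> 0}), t)) ` affine_simplex {..n}" (is "?L = ?R")
proof
  show "?L \<subseteq> ?R"
  proof
    fix x assume "x \<in> ?L"
    then obtain B \<sigma> t where "\<sigma> \<in> simplices (std_simplex n) B" "t \<in> affine_simplex B"
      "x = char_map (std_simplex n) B \<sigma> t"
      by (rule realization_cases)
    then show "x \<in> ?R"
      using affine_simplex_mono[of t B "{..n}"]
      by (auto simp: char_map_eq std_simplex_simps split: if_splits)
  qed
  show "?R \<subseteq> ?L"
    using char_map_in_realization[of "{..n}" "std_simplex n" "{..n}"]
    by (auto simp: char_map_eq std_simplex_simps)
qed

lemma topspace_std_boundary:
  "topspace (realization (std_boundary n)) =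
    (\<lambda>t. (({v. t v \<noteq> 0}, {v. t v \<noteq> 0}), t)) ` simplex_boundary {..n}" (is "?L = ?R")
proof
  show "?L \<subseteq> ?R"
  proof
    fix x assume "x \<in> ?L"
    then obtain B \<sigma> t where "\<sigma> \<in> simplices (std_boundary n) B" "t \<in> affine_simplex B"
      "x = char_map (std_boundary n) B \<sigma> t"
      by (rule realization_cases)
    then show "x \<in> ?R"
      using simplex_boundary_iff[of "{..n}" t]
      by (auto simp: char_map_eq std_boundary_simps split: if_splits)
  qed
  show "?R \<subseteq> ?L"
  proof
    fix x assume "x \<in> ?R"
    then obtain t where t: "x = (({v. t v \<noteq> 0}, {v. t v \<noteq> 0}), t)" "t \<in> simplex_boundary {..n}"
      by blast
    moreover from t(2) obtain B where "B \<subset> {..n}" "B \<noteq> {}" "t \<in> affine_simplex B"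
      unfolding simplex_boundary_iff[OF finite_atMost] by blast
    ultimately have "x = (({v. t v \<noteq> 0}, {v. t v \<noteq> 0}), t)" "B \<subset> {..n}" "B \<noteq> {}" "t \<in> affine_simplex B"
      by auto
    then show "x \<in> ?L"
      using char_map_in_realization[of B "std_boundary n" B t]
      by (simp add: char_map_eq std_boundary_simps)
  qed
qed

lemma topspace_std_boundary_subset:
  "topspace (realization (std_boundary n)) \<subseteq> topspace (realization (std_simplex n))"
  by (rule topspace_realization_mono[OF submulticomplex_std_boundary])

section \<open>The affine homeomorphism given by a labelling of the vertices\<close>

definition simplex_push :: "(nat \<Rightarrow> 'v) \<Rightarrow> nat \<Rightarrow> (nat \<Rightarrow> real) \<Rightarrow> 'v \<Rightarrow> real" where
  "simplex_push e n t = (\<lambda>w. \<Sum>i | i \<in> {..n} \<and> e i = w. t i)"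

definition simplex_pull :: "(nat \<Rightarrow> 'v) \<Rightarrow> nat \<Rightarrow> ('v \<Rightarrow> real) \<Rightarrow> nat \<Rightarrow> real" where
  "simplex_pull e n u = (\<lambda>i. if i \<in> {..n} then u (e i) else 0)"

text \<open>Each vertex set carries only one simplex of the standard simplex, so a point of its
  realization is determined by its coordinates \<open>snd x\<close>.\<close>

definition to_simplex :: "(nat \<Rightarrow> 'v) \<Rightarrow> nat \<Rightarrow> (nat, nat set) mpoint \<Rightarrow> 'v \<Rightarrow> real" where
  "to_simplex e n x = simplex_push e n (snd x)"

definition from_simplex :: "(nat \<Rightarrow> 'v) \<Rightarrow> nat \<Rightarrow> ('v \<Rightarrow> real) \<Rightarrow> (nat, nat set) mpoint" where
  "from_simplex e n u = char_map (std_simplex n) {..n} {..n} (simplex_pull e n u)"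

context
  fixes e :: "nat \<Rightarrow> 'v" and n :: nat
  assumes inj: "inj_on e {..n}"
begin

lemma simplex_push_apply: "i \<in> {..n} \<Longrightarrow> simplex_push e n t (e i) = t i"
proof -
  assume i: "i \<in> {..n}"
  then have "{j. j \<in> {..n} \<and> e j = e i} = {i}"
    using inj_onD[OF inj] by blast
  then show ?thesis by (simp add: simplex_push_def)
qed

lemma simplex_push_affine:
  assumes "t \<in> affine_simplex B" "B \<subseteq> {..n}"
  shows "simplex_push e n t \<in> affine_simplex (e ` B)"
proof -
  have "0 \<le> simplex_push e n t w" for w
    using assms(1) by (auto simp: simplex_push_def affine_simplex_def intro: sum_nonneg)
  moreover have "simplex_push e n t w = 0" if "w \<notin> e ` B" for w
    unfolding simplex_push_def using that assms(1)
    by (intro sum.neutral) (auto simp: affine_simplex_def)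
  moreover have "(\<Sum>w\<in>e ` B. simplex_push e n t w) = (\<Sum>i\<in>B. simplex_push e n t (e i))"
    by (rule sum.reindex_cong[OF inj_on_subset[OF inj assms(2)]]) auto
  moreover have "(\<Sum>i\<in>B. simplex_push e n t (e i)) = (\<Sum>i\<in>B. t i)"
    by (rule sum.cong) (use assms(2) simplex_push_apply in auto)
  ultimately show ?thesis
    using assms(1) by (simp add: affine_simplex_def)
qed

lemma simplex_push_boundary:
  assumes "t \<in> simplex_boundary {..n}"
  shows "simplex_push e n t \<in> simplex_boundary (e ` {..n})"
proof -
  obtain i where "i \<in> {..n}" "t i = 0" using assms by (auto simp: simplex_boundary_def)
  then show ?thesis
    using simplex_push_apply[of i t] simplex_push_affine[of t "{..n}"] assms
    unfolding simplex_boundary_def by auto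
qed

lemma simplex_pull_affine:
  assumes "u \<in> affine_simplex (e ` {..n})"
  shows "simplex_pull e n u \<in> affine_simplex {..n}"
proof -
  have "(\<Sum>i\<in>{..n}. u (e i)) = (\<Sum>w\<in>e ` {..n}. u w)"
    by (rule sum.reindex_cong[OF inj, symmetric]) auto
  then show ?thesis using assms by (auto simp: affine_simplex_def simplex_pull_def)
qed

lemma simplex_pull_boundary:
  assumes "u \<in> simplex_boundary (e ` {..n})"
  shows "simplex_pull e n u \<in> simplex_boundary {..n}"
proof -
  obtain i where "i \<in> {..n}" "u (e i) = 0" using assms by (auto simp: simplex_boundary_def)
  then have "simplex_pull e n u i = 0" by (simp add: simplex_pull_def)
  then show ?thesis
    using simplex_pull_affine[of u] assms \<open>i \<in> {..n}\<close> unfolding simplex_boundary_def by blast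
qed

lemma simplex_push_pull:
  assumes "u \<in> affine_simplex (e ` {..n})"
  shows "simplex_push e n (simplex_pull e n u) = u"
proof
  fix w
  show "simplex_push e n (simplex_pull e n u) w = u w"
  proof (cases "w \<in> e ` {..n}")
    case True
    then obtain i where "i \<in> {..n}" "w = e i" by blast
    then show ?thesis
      using simplex_push_apply[of i "simplex_pull e n u"] by (simp add: simplex_pull_def)
  next
    case False
    moreover have "simplex_push e n (simplex_pull e n u) w = 0"
      using simplex_push_affine[OF simplex_pull_affine[OF assms]] False by (auto simp: affine_simplex_def)
    ultimately show ?thesis using assms by (auto simp: affine_simplex_def)
  qed
qed

lemma continuous_map_to_simplex:
  "continuous_map (realization (std_simplex n)) (simplex_top (e ` {..n})) (to_simplex e n)"
proof (rule continuous_map_realization)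
  fix B \<sigma> assume "\<sigma> \<in> simplices (std_simplex n) B"
  then have B: "B \<subseteq> {..n}" by (auto simp: std_simplex_simps split: if_splits)
  have "continuous_map (simplex_top B) euclideanreal (\<lambda>t. simplex_push e n t w)" for w
    unfolding simplex_push_def by (intro continuous_map_sum continuous_map_coordinate) simp
  then have "continuous_map (simplex_top B) euclidean (simplex_push e n)"
    by (subst continuous_map_into_functions) simp
  then have "continuous_map (simplex_top B) (simplex_top (e ` {..n})) (simplex_push e n)"
    using affine_simplex_mono[OF simplex_push_affine[OF _ B] image_mono[OF B]]
    by (intro continuous_map_into_subtopology) auto
  then show "continuous_map (simplex_top B) (simplex_top (e ` {..n}))
      (\<lambda>t. to_simplex e n (char_map (std_simplex n) B \<sigma> t))"
    by (simp only: to_simplex_def char_map_eq snd_conv)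
qed

lemma continuous_map_from_simplex:
  "continuous_map (simplex_top (e ` {..n})) (realization (std_simplex n)) (from_simplex e n)"
proof -
  have "continuous_map (simplex_top (e ` {..n})) euclideanreal (\<lambda>u. simplex_pull e n u i)" for i
    by (cases "i \<in> {..n}") (simp_all only: simplex_pull_def if_True if_False continuous_map_coordinate
        continuous_map_canonical_const)
  then have "continuous_map (simplex_top (e ` {..n})) euclidean (simplex_pull e n)"
    by (subst continuous_map_into_functions) simp
  then have "continuous_map (simplex_top (e ` {..n})) (simplex_top {..n}) (simplex_pull e n)"
    using simplex_pull_affine by (intro continuous_map_into_subtopology) auto
  moreover have "{..n} \<in> simplices (std_simplex n) {..n}"
    by (simp add: std_simplex_simps)
  ultimately show ?thesis
    unfolding from_simplex_def by (intro continuous_map_comp[OF continuous_map_char_map])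
qed

lemma to_from_simplex:
  "u \<in> affine_simplex (e ` {..n}) \<Longrightarrow> to_simplex e n (from_simplex e n u) = u"
  by (simp add: to_simplex_def from_simplex_def char_map_eq simplex_push_pull)

lemma to_simplex_boundary:
  "x \<in> topspace (realization (std_boundary n)) \<Longrightarrow> to_simplex e n x \<in> simplex_boundary (e ` {..n})"
  by (auto simp: topspace_std_boundary to_simplex_def simplex_push_boundary)

lemma from_simplex_boundary:
  "u \<in> simplex_boundary (e ` {..n}) \<Longrightarrow> from_simplex e n u \<in> topspace (realization (std_boundary n))"
  using simplex_pull_boundary[of u]
  by (simp add: topspace_std_boundary from_simplex_def char_map_eq std_simplex_simps)

lemma homotopic_rel_to_simplex:
  assumes "homotopic_rel (simplex_boundary (e ` {..n})) (simplex_top (e ` {..n})) Z f g"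
  shows "homotopic_rel (topspace (realization (std_boundary n))) (realization (std_simplex n)) Z
    (\<lambda>x. f (to_simplex e n x)) (\<lambda>x. g (to_simplex e n x))"
  by (rule homotopic_rel_compose_right[OF assms continuous_map_to_simplex to_simplex_boundary])

lemma homotopic_rel_from_simplex:
  assumes "homotopic_rel (topspace (realization (std_boundary n))) (realization (std_simplex n)) Z f g"
    and "\<And>u. u \<in> affine_simplex (e ` {..n}) \<Longrightarrow> f (from_simplex e n u) = f' u"
    and "\<And>u. u \<in> affine_simplex (e ` {..n}) \<Longrightarrow> g (from_simplex e n u) = g' u"
  shows "homotopic_rel (simplex_boundary (e ` {..n})) (simplex_top (e ` {..n})) Z f' g'"
  by (rule homotopic_rel_cong[OF homotopic_rel_compose_right[OF assms(1) continuous_map_from_simplex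
          from_simplex_boundary]])
    (use assms(2,3) simplex_boundary_subset in auto)

end

section \<open>Simplicial maps out of standard simplices\<close>

lemma simplicial_map_std_simplexD:
  assumes "simplicial_map (std_simplex n) K \<psi>" "B \<subseteq> {..n}" "B \<noteq> {}"
  shows "simap \<psi> B B \<in> simplices K (vmap \<psi> ` B)"
    and "\<lbrakk>C \<subseteq> B; C \<noteq> {}\<rbrakk> \<Longrightarrow> bd K (vmap \<psi> ` B) (vmap \<psi> ` C) (simap \<psi> B B) = simap \<psi> C C"
proof -
  have B: "B \<in> simplices (std_simplex n) B" using assms(2,3) by (simp add: std_simplex_simps)
  then show "simap \<psi> B B \<in> simplices K (vmap \<psi> ` B)"
    using assms(1) unfolding simplicial_map_def by blast
  assume "C \<subseteq> B" "C \<noteq> {}"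
  then have "bd K (vmap \<psi> ` B) (vmap \<psi> ` C) (simap \<psi> B B) = simap \<psi> C (bd (std_simplex n) B C B)"
    using assms(1) B unfolding simplicial_map_def by blast
  then show "bd K (vmap \<psi> ` B) (vmap \<psi> ` C) (simap \<psi> B B) = simap \<psi> C C"
    by (simp add: std_simplex_simps)
qed

text \<open>All points of the standard simplex lie in its top simplex, so the characteristic map of
  the image of the top simplex describes the whole realized map.\<close>

lemma realization_map_std_simplex:
  assumes "simplicial_map (std_simplex n) K \<psi>" "x \<in> topspace (realization (std_simplex n))"
  shows "realization_map \<psi> x =
    char_map K (vmap \<psi> ` {..n}) (simap \<psi> {..n} {..n}) (to_simplex (vmap \<psi>) n x)"
proof -
  obtain t where t: "t \<in> affine_simplex {..n}" "x = char_map (std_simplex n) {..n} {..n} t"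
    using assms(2) by (auto simp: topspace_std_simplex char_map_eq std_simplex_simps)
  have "{..n} \<in> simplices (std_simplex n) {..n}" by (simp add: std_simplex_simps)
  from realization_map_char_map[OF multicomplex_std_simplex assms(1) this t(1)] show ?thesis
    unfolding to_simplex_def simplex_push_def by (simp add: t(2) char_map_eq)
qed

text \<open>The vertices of \<open>\<Delta>\<^sup>n\<close> lie in its boundary when \<open>n \<ge> 1\<close>.\<close>

lemma vmap_eq_of_realization_map_eq:
  assumes "1 \<le> n" "i \<in> {..n}"
    and "\<And>x. x \<in> topspace (realization (std_boundary n)) \<Longrightarrow> realization_map \<phi> x = realization_map \<psi> x"
  shows "vmap \<phi> i = vmap \<psi> i"
proof -
  define t :: "nat \<Rightarrow> real" where "t = (\<lambda>j. if j = i then 1 else 0)"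
  have supp: "{v. t v \<noteq> 0} = {i}" by (auto simp: t_def)
  have "t \<in> affine_simplex {i}" by (auto simp: affine_simplex_def t_def)
  moreover have "{i} \<subset> {..n}"
  proof -
    have "card {i} \<noteq> card {..n}" using assms(1) by simp
    then show ?thesis using assms(2) by (metis empty_subsetI insert_subset psubset_eq)
  qed
  ultimately have "t \<in> simplex_boundary {..n}"
    using simplex_boundary_iff[of "{..n}" t] by auto
  then have "(({i}, {i}), t) \<in> topspace (realization (std_boundary n))"
    by (simp add: topspace_std_boundary image_iff supp)
  from assms(3)[OF this] show ?thesis
    by (simp add: realization_map_def)
qed

text \<open>Turns a family of simplices indexed by vertex sets into a simplicial map. The simplex
  argument is ignored, since in a standard simplex it is determined by its vertex set.\<close>

definition labelled_map :: "(nat \<Rightarrow> 'v) \<Rightarrow> ('v set \<Rightarrow> 's) \<Rightarrow> (nat, nat set, 'v, 's) smap" where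
  "labelled_map e \<rho> = \<lparr>vmap = e, simap = (\<lambda>B _. \<rho> (e ` B))\<rparr>"

text \<open>Injectivity on simplices is automatic because each vertex set carries at most one
  simplex of the boundary; only the labelling has to be injective.\<close>

lemma simplicial_embedding_labelled_boundary:
  assumes "multicomplex K" "inj_on e {..n}"
    and "\<And>B. \<lbrakk>B \<subset> e ` {..n}; B \<noteq> {}\<rbrakk> \<Longrightarrow> \<rho> B \<in> simplices K B"
    and "\<And>B C. \<lbrakk>B \<subset> e ` {..n}; C \<subseteq> B; C \<noteq> {}\<rbrakk> \<Longrightarrow> bd K B C (\<rho> B) = \<rho> C"
    and "e ` {..n} \<subseteq> vertices K"
  shows "simplicial_embedding (std_boundary n) K (labelled_map e \<rho>)"
proof -
  have ps: "e ` B \<subset> e ` {..n}" if "B \<subset> {..n}" for B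
    by (rule image_strict_mono[OF assms(2) that])
  have "inj_on e (vertices (std_boundary n))"
    using inj_on_subset[OF assms(2) vertices_std_boundary_subset] .
  moreover have "e ` vertices (std_boundary n) \<subseteq> vertices K"
    using vertices_std_boundary_subset[of n] assms(5) by auto
  moreover have "\<rho> (e ` B) \<in> simplices K (e ` B)" if "B \<subset> {..n}" "B \<noteq> {}" for B
    using assms(3)[OF ps[OF that(1)]] that(2) by simp
  moreover have "bd K (e ` B) (e ` C) (\<rho> (e ` B)) = \<rho> (e ` C)"
    if "B \<subset> {..n}" "C \<subseteq> B" "C \<noteq> {}" for B C
    using assms(4)[OF ps[OF that(1)] image_mono[OF that(2)]] that(3) by simp
  ultimately show ?thesis
    unfolding simplicial_embedding_def simplicial_map_def labelled_map_def
    by (simp add: std_boundary_simps)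
qed

lemma simplicial_embedding_labelled_simplex:
  assumes "multicomplex K" "inj_on e {..n}" "\<sigma> \<in> simplices K (e ` {..n})"
  shows "simplicial_embedding (std_simplex n) K (labelled_map e (\<lambda>B. bd K (e ` {..n}) B \<sigma>))"
proof -
  interpret multicomplex K by fact
  show ?thesis
    using assms(2) vertex_set[OF assms(3)] bd_closed[OF assms(3)] bd_bd[OF assms(3)]
    by (auto simp: simplicial_embedding_def simplicial_map_def labelled_map_def std_simplex_simps
        image_mono)
qed

lemma boundary_embedded_of_simplicial_embedding:
  assumes "simplicial_embedding (std_simplex n) K \<psi>"
  shows "boundary_embedded n K (realization_map \<psi>)"
proof -
  have sm: "simplicial_map (std_simplex n) K \<psi>" and inj: "inj_on (vmap \<psi>) {..n}"
    and v: "vmap \<psi> ` {..n} \<subseteq> vertices K"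
    using assms by (auto simp: simplicial_embedding_def simplicial_map_def std_simplex_simps)
  have "simplicial_map (std_boundary n) K \<psi>"
    unfolding simplicial_map_def
  proof (intro conjI allI ballI impI)
    show "vmap \<psi> ` vertices (std_boundary n) \<subseteq> vertices K"
      using v vertices_std_boundary_subset[of n] by blast
    fix A \<sigma> assume "\<sigma> \<in> simplices (std_boundary n) A"
    then have A: "\<sigma> = A" "A \<noteq> {}" "A \<subseteq> {..n}"
      by (auto simp: std_boundary_simps split: if_splits)
    then show "simap \<psi> A \<sigma> \<in> simplices K (vmap \<psi> ` A)"
      using simplicial_map_std_simplexD(1)[OF sm] by blast
    fix B assume "B \<subseteq> A \<and> B \<noteq> {}"
    then show "bd K (vmap \<psi> ` A) (vmap \<psi> ` B) (simap \<psi> A \<sigma>) = simap \<psi> B (bd (std_boundary n) A B \<sigma>)"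
      using simplicial_map_std_simplexD(2)[OF sm A(3,2)] A(1) by (simp add: std_boundary_simps)
  qed
  then have "simplicial_embedding (std_boundary n) K \<psi>"
    using inj_on_subset[OF inj vertices_std_boundary_subset]
    by (auto simp: simplicial_embedding_def std_boundary_simps)
  then show ?thesis unfolding boundary_embedded_def by blast
qed

section \<open>Completeness and minimality in terms of single simplices\<close>

lemma finite_labelling:
  assumes "finite A" "2 \<le> card A"
  obtains e n where "inj_on e {..n::nat}" "A = e ` {..n}" "1 \<le> n"
proof -
  obtain e where e: "bij_betw e {0..<card A} A"
    using ex_bij_betw_nat_finite[OF assms(1)] by blast
  have "{0..<card A} = {..card A - 1}" using assms(2) by auto
  then show thesis
    using e assms(2) by (intro that[of e "card A - 1"]) (auto simp: bij_betw_def)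
qed

text \<open>A labelling carries completeness over to an arbitrary vertex set; the compatible family
  \<open>\<rho>\<close> encodes the embedded boundary. That \<open>\<tau>\<close> has the prescribed
  faces follows by evaluating the homotopy on the boundary, where it is stationary.\<close>

lemma complete_mc_simplex:
  assumes K: "multicomplex K" "complete_mc K" and A: "finite A" "2 \<le> card A" "A \<subseteq> vertices K"
    and f: "continuous_map (simplex_top A) (realization K) f"
    and \<rho>: "\<And>B. \<lbrakk>B \<subset> A; B \<noteq> {}\<rbrakk> \<Longrightarrow> \<rho> B \<in> simplices K B"
    and bd: "\<And>B C. \<lbrakk>B \<subset> A; C \<subseteq> B; C \<noteq> {}\<rbrakk> \<Longrightarrow> bd K B C (\<rho> B) = \<rho> C"
    and f_bd: "\<And>B t. \<lbrakk>B \<subset> A; B \<noteq> {}; t \<in> affine_simplex B\<rbrakk> \<Longrightarrow> f t = char_map K B (\<rho> B) t"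
  shows "\<exists>\<tau>\<in>simplices K A. (\<forall>B. B \<subset> A \<and> B \<noteq> {} \<longrightarrow> bd K A B \<tau> = \<rho> B) \<and>
    homotopic_rel (simplex_boundary A) (simplex_top A) (realization K) f (char_map K A \<tau>)"
proof -
  interpret multicomplex K by fact
  obtain e n where e: "inj_on e {..n::nat}" and Ae: "A = e ` {..n}" and n: "1 \<le> n"
    using finite_labelling[OF A(1,2)] by blast
  define F where "F = (\<lambda>x. f (to_simplex e n x))"
  define \<phi> where "\<phi> = labelled_map e \<rho>"
  have F: "continuous_map (realization (std_simplex n)) (realization K) F"
    unfolding F_def by (rule continuous_map_comp[OF f[unfolded Ae] continuous_map_to_simplex[OF e]])
  have \<phi>: "simplicial_embedding (std_boundary n) K \<phi>"
    unfolding \<phi>_def using \<rho> bd A(3) Ae by (intro simplicial_embedding_labelled_boundary K e) auto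
  have F\<phi>: "F x = realization_map \<phi> x" if x: "x \<in> topspace (realization (std_boundary n))" for x
  proof -
    obtain t where t: "t \<in> simplex_boundary {..n}" "x = (({v. t v \<noteq> 0}, {v. t v \<noteq> 0}), t)"
      using x by (auto simp: topspace_std_boundary)
    then obtain B where B: "B \<subset> {..n}" "B \<noteq> {}" "t \<in> affine_simplex B"
      using simplex_boundary_iff[of "{..n}" t] by auto
    have eB: "e ` B \<subset> A" unfolding Ae by (rule image_strict_mono[OF e B(1)])
    have mB: "multicomplex (std_boundary n)" "simplicial_map (std_boundary n) K \<phi>"
      using submulticomplex_std_boundary \<phi> by (auto simp: submulticomplex_def simplicial_embedding_def)
    have BB: "B \<in> simplices (std_boundary n) B" using B by (simp add: std_boundary_simps)
    have xB: "x = char_map (std_boundary n) B B t"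
      using t by (simp add: char_map_eq std_boundary_simps)
    have push: "(\<lambda>w. \<Sum>v | v \<in> B \<and> e v = w. t v) = simplex_push e n t"
      unfolding simplex_push_def using B
      by (intro ext sum.mono_neutral_left) (auto simp: affine_simplex_def)
    have "realization_map \<phi> x = char_map K (e ` B) (\<rho> (e ` B)) (simplex_push e n t)"
      using realization_map_char_map[OF mB BB B(3)] push by (simp add: xB \<phi>_def labelled_map_def)
    moreover have "F x = f (simplex_push e n t)" by (simp add: F_def to_simplex_def t(2))
    ultimately show ?thesis
      using f_bd[OF eB _ simplex_push_affine[OF e B(3)]] B by auto
  qed
  then have "boundary_embedded n K F"
    using \<phi> unfolding boundary_embedded_def by blast
  then obtain \<psi> where \<psi>: "simplicial_embedding (std_simplex n) K \<psi>"
    and hom: "homotopic_rel (topspace (realization (std_boundary n))) (realization (std_simplex n))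
      (realization K) F (realization_map \<psi>)"
    using K(2) n F unfolding complete_mc_def by blast
  have sm: "simplicial_map (std_simplex n) K \<psi>" using \<psi> by (simp add: simplicial_embedding_def)
  have "realization_map \<phi> x = realization_map \<psi> x" if "x \<in> topspace (realization (std_boundary n))" for x
    using homotopic_rel_eq_on[OF hom that] F\<phi>[OF that] by simp
  \<comment> \<open>The labelling of \<open>\<psi>\<close> is forced, because the homotopy does not
    move the vertices.\<close>
  then have ve: "vmap \<psi> i = e i" if "i \<in> {..n}" for i
    using vmap_eq_of_realization_map_eq[OF n that, of \<phi> \<psi>] by (simp add: \<phi>_def labelled_map_def)
  then have im: "vmap \<psi> ` {..n} = A" unfolding Ae by (intro image_cong) auto
  define \<tau> where "\<tau> = simap \<psi> {..n} {..n}"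
  have \<tau>: "\<tau> \<in> simplices K A"
    using simplicial_map_std_simplexD(1)[OF sm, of "{..n}"] im by (auto simp: \<tau>_def)
  have "simplex_push (vmap \<psi>) n t = simplex_push e n t" for t
    unfolding simplex_push_def using ve by (intro ext sum.cong) auto
  then have to_eq: "to_simplex (vmap \<psi>) n = to_simplex e n"
    by (simp add: to_simplex_def fun_eq_iff)
  have "homotopic_rel (simplex_boundary A) (simplex_top A) (realization K) f (char_map K A \<tau>)"
    unfolding Ae
  proof (rule homotopic_rel_from_simplex[OF e hom])
    fix u assume u: "u \<in> affine_simplex (e ` {..n})"
    show "F (from_simplex e n u) = f u" using to_from_simplex[OF e u] by (simp add: F_def)
    have "from_simplex e n u \<in> topspace (realization (std_simplex n))"
      using continuous_map_from_simplex[OF e] u by (auto simp: continuous_map_def)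
    from realization_map_std_simplex[OF sm this]
    show "realization_map \<psi> (from_simplex e n u) = char_map K (e ` {..n}) \<tau> u"
      using to_from_simplex[OF e u] by (simp add: to_eq im Ae[symmetric] \<tau>_def)
  qed
  moreover have "bd K A B \<tau> = \<rho> B" if B: "B \<subset> A" "B \<noteq> {}" for B
  proof -
    have "bd K A B \<tau> = bd K B B (\<rho> B)"
    proof (rule bd_eqI)
      show "finite B" using B A(1) finite_subset by blast
      fix t assume t: "t \<in> affine_simplex B"
      then have "t \<in> simplex_boundary A" using B simplex_boundary_iff[OF A(1)] by blast
      from homotopic_rel_eq_on[OF calculation this] show "char_map K A \<tau> t = char_map K B (\<rho> B) t"
        using f_bd[OF B t] by simp
    qed (use B in auto)
    then show ?thesis using bd_self[OF \<rho>[OF B]] by simp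
  qed
  ultimately show ?thesis using \<tau> by blast
qed

lemma continuous_map_realization_map_std_simplex:
  assumes "simplicial_embedding (std_simplex n) K \<psi>"
  shows "continuous_map (realization (std_simplex n)) (realization K) (realization_map \<psi>)"
proof -
  have sm: "simplicial_map (std_simplex n) K \<psi>" and inj: "inj_on (vmap \<psi>) {..n}"
    using assms by (auto simp: simplicial_embedding_def std_simplex_simps)
  then have "simap \<psi> {..n} {..n} \<in> simplices K (vmap \<psi> ` {..n})"
    using simplicial_map_std_simplexD(1)[OF sm, of "{..n}"] by auto
  from continuous_map_comp[OF continuous_map_char_map[OF this] continuous_map_to_simplex[OF inj]]
  show ?thesis
    by (rule continuous_map_eq) (simp add: realization_map_std_simplex[OF sm])
qed

text \<open>The definition is used with the realized embedding of \<open>\<sigma>\<close> as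
  \<open>f\<close>: it is homotopic to itself by the constant homotopy and to the embedding of
  \<open>\<tau>\<close> by \<open>hom\<close>.\<close>

lemma minimal_mc_simplex:
  assumes K: "multicomplex K" "minimal_mc K"
    and \<sigma>: "\<sigma> \<in> simplices K A" and \<tau>: "\<tau> \<in> simplices K A"
    and hom: "homotopic_rel (simplex_boundary A) (simplex_top A) (realization K)
      (char_map K A \<sigma>) (char_map K A \<tau>)"
  shows "\<sigma> = \<tau>"
proof (cases "card A < 2")
  case True
  then show ?thesis using multicomplex.singleton_simplex_unique[OF K(1) \<sigma> \<tau>] by blast
next
  case False
  interpret multicomplex K by fact
  obtain e n where e: "inj_on e {..n::nat}" and Ae: "A = e ` {..n}" and n: "1 \<le> n"
    using finite_labelling[of A] vertex_set[OF \<sigma>] False by (metis not_less)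
  define \<psi> where "\<psi> = (\<lambda>\<sigma>. labelled_map e (\<lambda>B. bd K (e ` {..n}) B \<sigma>))"
  have emb: "simplicial_embedding (std_simplex n) K (\<psi> \<upsilon>)" if "\<upsilon> \<in> simplices K A" for \<upsilon>
    unfolding \<psi>_def using simplicial_embedding_labelled_simplex[OF K(1) e] that Ae by blast
  have real: "realization_map (\<psi> \<upsilon>) x = char_map K A \<upsilon> (to_simplex e n x)"
    if "\<upsilon> \<in> simplices K A" "x \<in> topspace (realization (std_simplex n))" for \<upsilon> x
    using realization_map_std_simplex[of n K "\<psi> \<upsilon>" x] emb[OF that(1)] that bd_self[OF that(1)]
    by (simp add: simplicial_embedding_def \<psi>_def labelled_map_def Ae[symmetric])
  let ?B = "topspace (realization (std_boundary n))"
  let ?S = "realization (std_simplex n)"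
  have "homotopic_rel ?B ?S (realization K) (realization_map (\<psi> \<sigma>)) (realization_map (\<psi> \<tau>))"
    by (rule homotopic_rel_cong[OF homotopic_rel_to_simplex[OF e hom[unfolded Ae]]
          topspace_std_boundary_subset])
      (use real[OF \<sigma>] real[OF \<tau>] Ae in auto)
  moreover have cont: "continuous_map ?S (realization K) (realization_map (\<psi> \<sigma>))"
    by (rule continuous_map_realization_map_std_simplex[OF emb[OF \<sigma>]])
  ultimately have "smap_eq_on (std_simplex n) (\<psi> \<sigma>) (\<psi> \<tau>)"
    using K(2) n emb[OF \<sigma>] emb[OF \<tau>] homotopic_rel_refl[OF cont]
      boundary_embedded_of_simplicial_embedding[OF emb[OF \<sigma>]]
    unfolding minimal_mc_def by blast
  then have "simap (\<psi> \<sigma>) {..n} {..n} = simap (\<psi> \<tau>) {..n} {..n}"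
    by (simp add: smap_eq_on_def std_simplex_simps)
  then show ?thesis
    using bd_self[OF \<sigma>] bd_self[OF \<tau>] by (simp add: \<psi>_def labelled_map_def Ae[symmetric])
qed

text \<open>Homotopic embeddings agree on the boundary and hence on the vertices. Their top
  simplices therefore share a vertex set and can be compared by \<open>min\<close>, and a top
  simplex determines all its faces.\<close>

lemma minimal_mcI:
  assumes K: "multicomplex K"
    and min: "\<And>A \<sigma> \<tau>. \<lbrakk>\<sigma> \<in> simplices K A; \<tau> \<in> simplices K A;
      homotopic_rel (simplex_boundary A) (simplex_top A) (realization K) (char_map K A \<sigma>) (char_map K A \<tau>)\<rbrakk>
      \<Longrightarrow> \<sigma> = \<tau>"
  shows "minimal_mc K"
  unfolding minimal_mc_def
proof (intro allI impI; elim conjE)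
  interpret multicomplex K by fact
  fix n f and \<psi> \<psi>' :: "(nat, nat set, 'a, 'b) smap"
  let ?B = "topspace (realization (std_boundary n))"
  let ?S = "realization (std_simplex n)"
  assume n: "1 \<le> n" and emb: "simplicial_embedding (std_simplex n) K \<psi>"
      "simplicial_embedding (std_simplex n) K \<psi>'"
    and hom: "homotopic_rel ?B ?S (realization K) f (realization_map \<psi>)"
      "homotopic_rel ?B ?S (realization K) f (realization_map \<psi>')"
  have sm: "simplicial_map (std_simplex n) K \<psi>" "simplicial_map (std_simplex n) K \<psi>'"
    and inj: "inj_on (vmap \<psi>) {..n}"
    using emb by (auto simp: simplicial_embedding_def std_simplex_simps)
  have h: "homotopic_rel ?B ?S (realization K) (realization_map \<psi>) (realization_map \<psi>')"
    by (rule homotopic_rel_trans[OF homotopic_rel_sym[OF hom(1)] hom(2)])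
  have v: "vmap \<psi>' i = vmap \<psi> i" if "i \<in> {..n}" for i
    by (rule vmap_eq_of_realization_map_eq[OF n that]) (rule homotopic_rel_eq_on[OF h])
  then have im: "vmap \<psi>' ` B = vmap \<psi> ` B" if "B \<subseteq> {..n}" for B
    using that by (intro image_cong) auto
  define A where "A = vmap \<psi> ` {..n}"
  have s: "simap \<psi> {..n} {..n} \<in> simplices K A" "simap \<psi>' {..n} {..n} \<in> simplices K A"
    using simplicial_map_std_simplexD(1)[OF sm(1), of "{..n}"] im[of "{..n}"]
      simplicial_map_std_simplexD(1)[OF sm(2), of "{..n}"] by (auto simp: A_def)
  have "simplex_push (vmap \<psi>') n t = simplex_push (vmap \<psi>) n t" for t
    unfolding simplex_push_def using v by (intro ext sum.cong) auto
  then have to_eq: "to_simplex (vmap \<psi>') n = to_simplex (vmap \<psi>) n"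
    by (simp add: to_simplex_def fun_eq_iff)
  have "homotopic_rel (simplex_boundary A) (simplex_top A) (realization K)
      (char_map K A (simap \<psi> {..n} {..n})) (char_map K A (simap \<psi>' {..n} {..n}))"
    unfolding A_def
  proof (rule homotopic_rel_from_simplex[OF inj h])
    fix u assume u: "u \<in> affine_simplex (vmap \<psi> ` {..n})"
    have x: "from_simplex (vmap \<psi>) n u \<in> topspace ?S"
      using continuous_map_from_simplex[OF inj] u by (auto simp: continuous_map_def)
    show "realization_map \<psi> (from_simplex (vmap \<psi>) n u) =
        char_map K (vmap \<psi> ` {..n}) (simap \<psi> {..n} {..n}) u"
      using realization_map_std_simplex[OF sm(1) x] to_from_simplex[OF inj u] by simp
    show "realization_map \<psi>' (from_simplex (vmap \<psi>) n u) =
        char_map K (vmap \<psi> ` {..n}) (simap \<psi>' {..n} {..n}) u"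
      using realization_map_std_simplex[OF sm(2) x] to_from_simplex[OF inj u] im[of "{..n}"]
      by (simp add: to_eq)
  qed
  then have top: "simap \<psi> {..n} {..n} = simap \<psi>' {..n} {..n}"
    using min[OF s] by blast
  have "simap \<psi> B B = simap \<psi>' B B" if "B \<subseteq> {..n}" "B \<noteq> {}" for B
    using simplicial_map_std_simplexD(2)[OF sm(1), of "{..n}" B] that
      simplicial_map_std_simplexD(2)[OF sm(2), of "{..n}" B] im[of "{..n}"] im[of B] top by auto
  then show "smap_eq_on (std_simplex n) \<psi> \<psi>'"
    unfolding smap_eq_on_def using v by (auto simp: std_simplex_simps)
qed

section \<open>Deformation retractions onto submulticomplexes with the same vertices\<close>

text \<open>Since all vertices lie in \<open>L\<close>, the retraction fixes them. It thus sends
  simplices over \<open>A\<close> to simplices over the same \<open>A\<close>, and no simplex is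
  collapsed.\<close>

lemma retraction_vmap:
  assumes "simplicial_retraction K L r" "vertices L = vertices K" "v \<in> vertices K"
  shows "vmap r v = v"
  using assms by (simp add: simplicial_retraction_def smap_eq_on_def smap_id_def)

lemma realization_map_retraction:
  assumes r: "simplicial_retraction K L r" and V: "vertices L = vertices K"
    and \<sigma>: "\<sigma> \<in> simplices K A"
  shows "simap r A \<sigma> \<in> simplices L A"
    and "t \<in> affine_simplex A \<Longrightarrow> realization_map r (char_map K A \<sigma> t) = char_map K A (simap r A \<sigma>) t"
proof -
  have K: "multicomplex K" and sm: "simplicial_map K L r" and sub: "submulticomplex L K"
    using r by (auto simp: simplicial_retraction_def submulticomplex_def)
  note id = realization_map_char_map_id[OF K sm \<sigma> _ retraction_vmap[OF r V]]
  have "finite A" "A \<noteq> {}" using multicomplex.vertex_set[OF K \<sigma>] by auto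
  then obtain u where "u \<in> affine_simplex A" using barycenter_exists by blast
  from id(2)[OF this] show r\<sigma>: "simap r A \<sigma> \<in> simplices L A" by simp
  assume t: "t \<in> affine_simplex A"
  show "realization_map r (char_map K A \<sigma> t) = char_map K A (simap r A \<sigma>) t"
    using id(1)[OF t] char_map_submulticomplex[OF sub r\<sigma> t] by simp
qed

lemma continuous_map_retraction:
  assumes "simplicial_retraction K L r" "vertices L = vertices K"
  shows "continuous_map (realization K) (realization L) (realization_map r)"
  using assms(1) continuous_map_realization_map[OF _ _ retraction_vmap[OF assms]]
  by (simp add: simplicial_retraction_def submulticomplex_def)

lemma realization_map_retraction_id:
  assumes r: "simplicial_retraction K L r" and V: "vertices L = vertices K"
    and x: "x \<in> topspace (realization L)"
  shows "realization_map r x = x"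
proof -
  have sub: "submulticomplex L K" and id: "smap_eq_on L r smap_id"
    using r by (auto simp: simplicial_retraction_def)
  obtain A \<sigma> t where \<sigma>: "\<sigma> \<in> simplices L A" and t: "t \<in> affine_simplex A" and xe: "x = char_map L A \<sigma> t"
    using x by (rule realization_cases)
  have "x = char_map K A \<sigma> t" using char_map_submulticomplex[OF sub \<sigma> t] xe by simp
  moreover have "\<sigma> \<in> simplices K A" using sub \<sigma> by (auto simp: submulticomplex_def)
  moreover have "simap r A \<sigma> = \<sigma>" using id \<sigma> by (simp add: smap_eq_on_def smap_id_def)
  ultimately show ?thesis using realization_map_retraction(2)[OF r V _ t] by simp
qed

lemma simplicial_mapD:
  assumes "simplicial_map K K' \<phi>"
  shows "vmap \<phi> ` vertices K \<subseteq> vertices K'"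
    and "\<sigma> \<in> simplices K A \<Longrightarrow> simap \<phi> A \<sigma> \<in> simplices K' (vmap \<phi> ` A)"
    and "\<lbrakk>\<sigma> \<in> simplices K A; B \<subseteq> A; B \<noteq> {}\<rbrakk> \<Longrightarrow>
      bd K' (vmap \<phi> ` A) (vmap \<phi> ` B) (simap \<phi> A \<sigma>) = simap \<phi> B (bd K A B \<sigma>)"
  using assms by (simp_all add: simplicial_map_def)

lemma submulticomplexD:
  assumes "submulticomplex L K"
  shows "multicomplex L" "multicomplex K" "vertices L \<subseteq> vertices K"
    and "\<sigma> \<in> simplices L A \<Longrightarrow> \<sigma> \<in> simplices K A"
    and "\<lbrakk>\<sigma> \<in> simplices L A; B \<subseteq> A; B \<noteq> {}\<rbrakk> \<Longrightarrow> bd L A B \<sigma> = bd K A B \<sigma>"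
  using assms by (auto simp: submulticomplex_def)

lemma simplicial_map_into_supercomplex:
  assumes sub: "submulticomplex L K" and sm: "simplicial_map J L \<phi>"
  shows "simplicial_map J K \<phi>"
  unfolding simplicial_map_def
proof (intro conjI allI ballI impI)
  show "vmap \<phi> ` vertices J \<subseteq> vertices K"
    using simplicial_mapD(1)[OF sm] submulticomplexD(3)[OF sub] by (rule subset_trans)
  fix A \<sigma> assume \<sigma>: "\<sigma> \<in> simplices J A"
  note L = simplicial_mapD(2)[OF sm \<sigma>]
  show "simap \<phi> A \<sigma> \<in> simplices K (vmap \<phi> ` A)"
    by (rule submulticomplexD(4)[OF sub L])
  fix B assume B: "B \<subseteq> A \<and> B \<noteq> {}"
  then have "bd L (vmap \<phi> ` A) (vmap \<phi> ` B) (simap \<phi> A \<sigma>) = bd K (vmap \<phi> ` A) (vmap \<phi> ` B) (simap \<phi> A \<sigma>)"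
    by (intro submulticomplexD(5)[OF sub L]) auto
  then show "bd K (vmap \<phi> ` A) (vmap \<phi> ` B) (simap \<phi> A \<sigma>) = simap \<phi> B (bd J A B \<sigma>)"
    using simplicial_mapD(3)[OF sm \<sigma>] B by simp
qed

lemma boundary_embedded_mono:
  assumes sub: "submulticomplex L K" and f: "boundary_embedded n L f"
  shows "boundary_embedded n K f"
proof -
  obtain \<phi> where \<phi>: "simplicial_embedding (std_boundary n) L \<phi>"
    and eq: "\<forall>x\<in>topspace (realization (std_boundary n)). f x = realization_map \<phi> x"
    using f unfolding boundary_embedded_def by blast
  have sm: "simplicial_map (std_boundary n) L \<phi>" using \<phi> by (simp add: simplicial_embedding_def)
  have "simplicial_map (std_boundary n) K \<phi>"
    by (rule simplicial_map_into_supercomplex[OF sub sm])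
  then have "simplicial_embedding (std_boundary n) K \<phi>"
    using \<phi> by (simp add: simplicial_embedding_def)
  then show ?thesis using eq unfolding boundary_embedded_def by blast
qed

text \<open>Completeness of \<open>K\<close> gives a homotopy in \<open>K\<close> from
  \<open>f\<close> to an embedding. Composing with the retraction brings it into \<open>L\<close>,
  fixes \<open>f\<close>, and replaces the top simplex by its image over the same vertex set; the
  same injective labelling makes the result an embedding.\<close>

lemma complete_mc_retract:
  assumes K: "complete_mc K" and r: "simplicial_retraction K L r" and V: "vertices L = vertices K"
  shows "complete_mc L"
  unfolding complete_mc_def
proof (intro allI impI; elim conjE)
  have sub: "submulticomplex L K" and L: "multicomplex L" and K': "multicomplex K"
    using r by (auto simp: simplicial_retraction_def submulticomplex_def)
  fix n f
  let ?B = "topspace (realization (std_boundary n))"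
  let ?S = "realization (std_simplex n)"
  assume n: "1 \<le> n" and f: "continuous_map ?S (realization L) f" and bf: "boundary_embedded n L f"
  obtain \<psi> where \<psi>: "simplicial_embedding (std_simplex n) K \<psi>"
    and hom: "homotopic_rel ?B ?S (realization K) f (realization_map \<psi>)"
    using K n continuous_map_comp[OF continuous_map_inclusion[OF sub] f] boundary_embedded_mono[OF sub bf]
    unfolding complete_mc_def by blast
  have sm: "simplicial_map (std_simplex n) K \<psi>" and inj: "inj_on (vmap \<psi>) {..n}"
    using \<psi> by (auto simp: simplicial_embedding_def std_simplex_simps)
  define e A where "e = vmap \<psi>" and "A = vmap \<psi> ` {..n}"
  define \<sigma> where "\<sigma> = simap \<psi> {..n} {..n}"
  have \<sigma>: "\<sigma> \<in> simplices K A"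
    using simplicial_map_std_simplexD(1)[OF sm, of "{..n}"] by (auto simp: \<sigma>_def A_def)
  define \<tau> where "\<tau> = simap r A \<sigma>"
  have \<tau>: "\<tau> \<in> simplices L A" unfolding \<tau>_def by (rule realization_map_retraction(1)[OF r V \<sigma>])
  define \<theta> where "\<theta> = labelled_map e (\<lambda>B. bd L A B \<tau>)"
  have \<theta>: "simplicial_embedding (std_simplex n) L \<theta>"
    unfolding \<theta>_def A_def e_def
    by (rule simplicial_embedding_labelled_simplex[OF L inj]) (use \<tau> in \<open>simp add: A_def\<close>)
  have "homotopic_rel ?B ?S (realization L) f (realization_map \<theta>)"
  proof (rule homotopic_rel_cong[OF homotopic_rel_compose_left[OF hom continuous_map_retraction[OF r V]]
        topspace_std_boundary_subset])
    fix x assume x: "x \<in> topspace ?S"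
    then have "f x \<in> topspace (realization L)" using f by (auto simp: continuous_map_def)
    then show "realization_map r (f x) = f x" by (rule realization_map_retraction_id[OF r V])
    have t: "to_simplex e n x \<in> affine_simplex A"
      using continuous_map_to_simplex[OF inj] x by (auto simp: continuous_map_def e_def A_def)
    have "realization_map r (realization_map \<psi> x) = char_map K A \<tau> (to_simplex e n x)"
      using realization_map_std_simplex[OF sm x] realization_map_retraction(2)[OF r V \<sigma> t]
      by (simp add: A_def \<sigma>_def \<tau>_def e_def)
    also have "\<dots> = char_map L A \<tau> (to_simplex e n x)"
      using char_map_submulticomplex[OF sub \<tau> t] by simp
    also have "\<dots> = realization_map \<theta> x"
      using realization_map_std_simplex[of n L \<theta> x] \<theta> x multicomplex.bd_self[OF L \<tau>]
      by (simp add: simplicial_embedding_def \<theta>_def labelled_map_def e_def A_def)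
    finally show "realization_map r (realization_map \<psi> x) = realization_map \<theta> x" .
  qed
  then show "\<exists>\<theta>. simplicial_embedding (std_simplex n) L \<theta> \<and>
      homotopic_rel ?B ?S (realization L) f (realization_map \<theta>)"
    using \<theta> by blast
qed

lemma homotopy_equivalence_inclusion:
  assumes "strong_deformation_retraction X Y \<rho>"
  shows "homotopy_equivalence Y X (\<lambda>x. x)"
proof -
  have ret: "continuous_map X Y \<rho>" "continuous_map Y X (\<lambda>x. x)" "\<And>x. x \<in> topspace Y \<Longrightarrow> \<rho> x = x"
    and hom: "homotopic_rel (topspace Y) X X (\<lambda>x. x) \<rho>"
    using assms by (auto simp: strong_deformation_retraction_def retraction_maps_def)
  have "homotopic_with (\<lambda>_. True) X X \<rho> (\<lambda>x. x)"
    using homotopic_with_symD[OF hom[unfolded homotopic_rel_def]] by (rule homotopic_with_mono) simp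
  moreover have "homotopic_with (\<lambda>_. True) Y Y (\<rho> \<circ> (\<lambda>x. x)) id"
    by (rule homotopic_with_id2) (use ret in auto)
  ultimately show ?thesis
    using ret(1,2) unfolding homotopy_equivalence_def by (auto simp: o_def id_def)
qed

section \<open>The minimal submulticomplex\<close>

definition simplex_homotopic :: "('v, 's) multicomplex \<Rightarrow> 'v set \<Rightarrow> 's \<Rightarrow> 's \<Rightarrow> bool" where
  "simplex_homotopic K A \<sigma> \<tau> \<longleftrightarrow> \<sigma> \<in> simplices K A \<and> \<tau> \<in> simplices K A \<and>
     homotopic_rel (simplex_boundary A) (simplex_top A) (realization K) (char_map K A \<sigma>) (char_map K A \<tau>)"

lemma simplex_homotopic_refl: "\<sigma> \<in> simplices K A \<Longrightarrow> simplex_homotopic K A \<sigma> \<sigma>"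
  by (simp add: simplex_homotopic_def homotopic_rel_refl continuous_map_char_map)

lemma simplex_homotopic_sym: "simplex_homotopic K A \<sigma> \<tau> \<Longrightarrow> simplex_homotopic K A \<tau> \<sigma>"
  unfolding simplex_homotopic_def using homotopic_rel_sym by blast

lemma simplex_homotopic_trans:
  "\<lbrakk>simplex_homotopic K A \<sigma> \<tau>; simplex_homotopic K A \<tau> \<upsilon>\<rbrakk> \<Longrightarrow> simplex_homotopic K A \<sigma> \<upsilon>"
  unfolding simplex_homotopic_def using homotopic_rel_trans by blast

definition class_rep :: "('v, 's) multicomplex \<Rightarrow> 'v set \<Rightarrow> 's \<Rightarrow> 's" where
  "class_rep K A \<sigma> = (SOME \<tau>. simplex_homotopic K A \<sigma> \<tau>)"

lemma simplex_homotopic_class_rep: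
  "\<sigma> \<in> simplices K A \<Longrightarrow> simplex_homotopic K A \<sigma> (class_rep K A \<sigma>)"
  unfolding class_rep_def by (rule someI) (rule simplex_homotopic_refl)

text \<open>Equivalent simplices define the same predicate, and the choice operator depends on the
  predicate alone.\<close>

lemma class_rep_eq:
  assumes "simplex_homotopic K A \<sigma> \<tau>"
  shows "class_rep K A \<sigma> = class_rep K A \<tau>"
proof -
  have "simplex_homotopic K A \<sigma> = simplex_homotopic K A \<tau>"
  proof (intro ext iffI)
    fix \<upsilon>
    show "simplex_homotopic K A \<tau> \<upsilon>" if "simplex_homotopic K A \<sigma> \<upsilon>"
      by (rule simplex_homotopic_trans[OF simplex_homotopic_sym[OF assms] that])
    show "simplex_homotopic K A \<sigma> \<upsilon>" if "simplex_homotopic K A \<tau> \<upsilon>"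
      by (rule simplex_homotopic_trans[OF assms that])
  qed
  then show ?thesis by (simp add: class_rep_def)
qed

text \<open>Asking all faces to be chosen representatives replaces a recursion over skeleta.\<close>

definition minimal_sub :: "('v, 's) multicomplex \<Rightarrow> ('v, 's) multicomplex" where
  "minimal_sub K = \<lparr>vertices = vertices K,
     simplices = (\<lambda>A. {\<sigma> \<in> simplices K A. \<forall>B. B \<subseteq> A \<and> B \<noteq> {} \<longrightarrow>
       class_rep K B (bd K A B \<sigma>) = bd K A B \<sigma>}),
     bd = bd K\<rparr>"

lemma minimal_sub_simps [simp]:
  "vertices (minimal_sub K) = vertices K" "bd (minimal_sub K) = bd K"
  by (simp_all add: minimal_sub_def)

lemma minimal_sub_simplices:
  "\<sigma> \<in> simplices (minimal_sub K) A \<longleftrightarrow> \<sigma> \<in> simplices K A \<and>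
    (\<forall>B. B \<subseteq> A \<and> B \<noteq> {} \<longrightarrow> class_rep K B (bd K A B \<sigma>) = bd K A B \<sigma>)"
  by (simp add: minimal_sub_def)

context multicomplex
begin

lemma minimal_sub_face:
  assumes "\<sigma> \<in> simplices (minimal_sub K) A" "B \<subseteq> A" "B \<noteq> {}"
  shows "bd K A B \<sigma> \<in> simplices (minimal_sub K) B"
proof -
  have \<sigma>: "\<sigma> \<in> simplices K A" using assms(1) by (simp add: minimal_sub_simplices)
  show ?thesis
    unfolding minimal_sub_simplices
  proof (intro conjI allI impI)
    show "bd K A B \<sigma> \<in> simplices K B" by (rule bd_closed[OF \<sigma> assms(2,3)])
    fix C assume C: "C \<subseteq> B \<and> C \<noteq> {}"
    then have "bd K B C (bd K A B \<sigma>) = bd K A C \<sigma>" using bd_bd[OF \<sigma> assms(2)] by blast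
    then show "class_rep K C (bd K B C (bd K A B \<sigma>)) = bd K B C (bd K A B \<sigma>)"
      using assms(1,2) C by (auto simp: minimal_sub_simplices)
  qed
qed

lemma class_rep_minimal_sub: "\<sigma> \<in> simplices (minimal_sub K) A \<Longrightarrow> class_rep K A \<sigma> = \<sigma>"
  using vertex_set[of \<sigma> A] bd_self[of \<sigma> A] by (auto simp: minimal_sub_simplices)

text \<open>Passing to the representative leaves the proper faces unchanged, so the condition on
  them is inherited; the condition on \<open>A\<close> itself holds because the representative has
  itself as representative.\<close>

lemma class_rep_in_minimal_sub:
  assumes \<sigma>: "\<sigma> \<in> simplices K A"
    and faces: "\<And>B. \<lbrakk>B \<subset> A; B \<noteq> {}\<rbrakk> \<Longrightarrow> bd K A B \<sigma> \<in> simplices (minimal_sub K) B"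
  shows "class_rep K A \<sigma> \<in> simplices (minimal_sub K) A"
    and "\<lbrakk>B \<subset> A; B \<noteq> {}\<rbrakk> \<Longrightarrow> bd K A B (class_rep K A \<sigma>) = bd K A B \<sigma>"
proof -
  have A: "finite A" using vertex_set[OF \<sigma>] by blast
  have h: "simplex_homotopic K A \<sigma> (class_rep K A \<sigma>)" by (rule simplex_homotopic_class_rep[OF \<sigma>])
  then have rep: "class_rep K A \<sigma> \<in> simplices K A" by (simp add: simplex_homotopic_def)
  have bdeq: "bd K A B (class_rep K A \<sigma>) = bd K A B \<sigma>" if "B \<subset> A" "B \<noteq> {}" for B
  proof -
    have "homotopic_rel (simplex_boundary A) (simplex_top A) (realization K) (char_map K A \<sigma>)
        (char_map K A (class_rep K A \<sigma>))"
      using h by (simp add: simplex_homotopic_def)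
    from faces_eq_of_homotopic_rel[OF this A that] show ?thesis .
  qed
  then show "\<lbrakk>B \<subset> A; B \<noteq> {}\<rbrakk> \<Longrightarrow> bd K A B (class_rep K A \<sigma>) = bd K A B \<sigma>" .
  show "class_rep K A \<sigma> \<in> simplices (minimal_sub K) A"
    unfolding minimal_sub_simplices
  proof (intro conjI allI impI rep)
    fix B assume B: "B \<subseteq> A \<and> B \<noteq> {}"
    show "class_rep K B (bd K A B (class_rep K A \<sigma>)) = bd K A B (class_rep K A \<sigma>)"
    proof (cases "B = A")
      case True
      then show ?thesis using bd_self[OF rep] class_rep_eq[OF h] by simp
    next
      case False
      then have "B \<subset> A" "B \<noteq> {}" using B by auto
      then show ?thesis using bdeq class_rep_minimal_sub[OF faces] by simp
    qed
  qed
qed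

text \<open>There are no proper nonempty faces, and the representative can only be
  \<open>\<sigma>\<close> itself. This is why every vertex is retained.\<close>

lemma singleton_in_minimal_sub:
  assumes \<sigma>: "\<sigma> \<in> simplices K A" and "card A < 2"
  shows "\<sigma> \<in> simplices (minimal_sub K) A"
proof -
  have A: "finite A" using vertex_set[OF \<sigma>] by blast
  have "False" if "B \<subset> A" "B \<noteq> {}" for B
    using psubset_card_mono[OF A that(1)] that finite_subset[OF _ A, of B] assms(2) card_gt_0_iff[of B]
    by (auto simp: psubset_eq)
  then have "class_rep K A \<sigma> \<in> simplices (minimal_sub K) A"
    using class_rep_in_minimal_sub(1)[OF \<sigma>] by blast
  moreover from this have "class_rep K A \<sigma> = \<sigma>"
    using singleton_simplex_unique[OF _ \<sigma> assms(2)] by (simp add: minimal_sub_simplices)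
  ultimately show ?thesis by simp
qed

lemma submulticomplex_minimal_sub: "submulticomplex (minimal_sub K) K"
proof -
  have "multicomplex (minimal_sub K)"
  proof
    fix v assume "v \<in> vertices (minimal_sub K)"
    then obtain \<sigma> where \<sigma>: "simplices K {v} = {\<sigma>}" using vertex_simplex by auto
    then have "\<sigma> \<in> simplices (minimal_sub K) {v}" by (intro singleton_in_minimal_sub) auto
    then show "\<exists>\<sigma>. simplices (minimal_sub K) {v} = {\<sigma>}"
      using \<sigma> by (auto simp: minimal_sub_simplices)
  next
    fix \<sigma> A assume \<sigma>: "\<sigma> \<in> simplices (minimal_sub K) A"
    then have \<sigma>': "\<sigma> \<in> simplices K A" by (simp add: minimal_sub_simplices)
    show "finite A \<and> A \<noteq> {} \<and> A \<subseteq> vertices (minimal_sub K)" using vertex_set[OF \<sigma>'] by simp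
    show "bd (minimal_sub K) A A \<sigma> = \<sigma>" using bd_self[OF \<sigma>'] by simp
    fix B assume B: "B \<subseteq> A"
    show "bd (minimal_sub K) A B \<sigma> \<in> simplices (minimal_sub K) B" if "B \<noteq> {}"
      using minimal_sub_face[OF \<sigma> B that] by simp
    fix C assume "C \<subseteq> B" "C \<noteq> {}"
    then show "bd (minimal_sub K) B C (bd (minimal_sub K) A B \<sigma>) = bd (minimal_sub K) A C \<sigma>"
      using bd_bd[OF \<sigma>' B] by simp
  qed
  then show ?thesis
    using multicomplex_axioms by (auto simp: submulticomplex_def minimal_sub_simplices)
qed

text \<open>The inclusion turns a homotopy in the submulticomplex into one in \<open>K\<close>; both
  simplices are then the chosen representative of the same class.\<close>

lemma minimal_mc_minimal_sub: "minimal_mc (minimal_sub K)"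
proof (rule minimal_mcI)
  let ?L = "minimal_sub K"
  note sub = submulticomplex_minimal_sub
  show "multicomplex ?L" using sub by (simp add: submulticomplex_def)
  fix A \<sigma> \<tau> assume \<sigma>: "\<sigma> \<in> simplices ?L A" and \<tau>: "\<tau> \<in> simplices ?L A"
    and h: "homotopic_rel (simplex_boundary A) (simplex_top A) (realization ?L) (char_map ?L A \<sigma>) (char_map ?L A \<tau>)"
  have "homotopic_rel (simplex_boundary A) (simplex_top A) (realization K) (char_map K A \<sigma>) (char_map K A \<tau>)"
    by (rule homotopic_rel_cong[OF homotopic_rel_compose_left[OF h continuous_map_inclusion[OF sub]]])
      (use char_map_submulticomplex[OF sub \<sigma>] char_map_submulticomplex[OF sub \<tau>] in
        \<open>auto simp: simplex_boundary_def\<close>)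
  then have "simplex_homotopic K A \<sigma> \<tau>"
    using \<sigma> \<tau> by (simp add: simplex_homotopic_def minimal_sub_simplices)
  from class_rep_eq[OF this] show "\<sigma> = \<tau>"
    using class_rep_minimal_sub[OF \<sigma>] class_rep_minimal_sub[OF \<tau>] by simp
qed

end

text \<open>The condition on the image \<open>fst p\<close> of the simplex \<open>\<sigma>\<close> under the retraction and on the homotopy
  \<open>snd p\<close> on \<open>\<sigma>\<close>, when \<open>f\<close> gives these data on the proper faces of \<open>\<sigma>\<close>.\<close>

definition deformation_data ::
    "('v, 's) multicomplex \<Rightarrow> ('v set \<times> 's \<Rightarrow> 's \<times> (real \<times> ('v \<Rightarrow> real) \<Rightarrow> ('v, 's) mpoint)) \<Rightarrow>
      'v set \<Rightarrow> 's \<Rightarrow> 's \<times> (real \<times> ('v \<Rightarrow> real) \<Rightarrow> ('v, 's) mpoint) \<Rightarrow> bool" where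
  "deformation_data K f A \<sigma> p \<longleftrightarrow>
     fst p \<in> simplices (minimal_sub K) A \<and>
     continuous_map (prod_topology unit_interval (simplex_top A)) (realization K) (snd p) \<and>
     (\<forall>t\<in>affine_simplex A. snd p (0, t) = char_map K A \<sigma> t) \<and>
     (\<forall>t\<in>affine_simplex A. snd p (1, t) = char_map K A (fst p) t) \<and>
     (\<forall>B. B \<subset> A \<and> B \<noteq> {} \<longrightarrow> bd K A B (fst p) = fst (f (B, bd K A B \<sigma>)) \<and>
        (\<forall>s\<in>{0..1}. \<forall>t\<in>affine_simplex B. snd p (s, t) = snd (f (B, bd K A B \<sigma>)) (s, t))) \<and>
     (\<sigma> \<in> simplices (minimal_sub K) A \<longrightarrow>
        fst p = \<sigma> \<and> (\<forall>s\<in>{0..1}. \<forall>t\<in>affine_simplex A. snd p (s, t) = char_map K A \<sigma> t))"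

section \<open>The deformation, constructed simplex by simplex\<close>

context multicomplex
begin

lemma deformation_data_extend:
  assumes complete: "complete_mc K" and \<sigma>: "\<sigma> \<in> simplices K A"
    and f: "\<And>B. \<lbrakk>B \<subset> A; B \<noteq> {}\<rbrakk> \<Longrightarrow> deformation_data K f B (bd K A B \<sigma>) (f (B, bd K A B \<sigma>))"
  shows "\<exists>p. deformation_data K f A \<sigma> p"
proof (cases "\<sigma> \<in> simplices (minimal_sub K) A")
  case True
  \<comment> \<open>The constant homotopy fits the faces: they lie in the submulticomplex as well,
    where the last clause of \<open>deformation_data\<close> makes the homotopies constant.\<close>
  have "deformation_data K f A \<sigma> (\<sigma>, \<lambda>z. char_map K A \<sigma> (snd z))"
    unfolding deformation_data_def fst_conv snd_conv
  proof (intro conjI allI impI ballI True refl)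
    show "continuous_map (prod_topology unit_interval (simplex_top A)) (realization K)
        (\<lambda>z. char_map K A \<sigma> (snd z))"
      by (rule continuous_map_comp[OF continuous_map_char_map[OF \<sigma>] continuous_map_snd])
    fix B assume B: "B \<subset> A \<and> B \<noteq> {}"
    then have L: "bd K A B \<sigma> \<in> simplices (minimal_sub K) B"
      using minimal_sub_face[OF True] by blast
    show "bd K A B \<sigma> = fst (f (B, bd K A B \<sigma>))"
      using f[of B] B L unfolding deformation_data_def by simp
    fix s :: real and t assume st: "s \<in> {0..1}" "t \<in> affine_simplex B"
    have "snd (f (B, bd K A B \<sigma>)) (s, t) = char_map K B (bd K A B \<sigma>) t"
      using f[of B] B L st unfolding deformation_data_def by simp
    then show "char_map K A \<sigma> t = snd (f (B, bd K A B \<sigma>)) (s, t)"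
      using char_map_face[OF \<sigma>, of B t] B st(2) by auto
  qed
  then show ?thesis by blast
next
  case False
  have A: "finite A" "A \<noteq> {}" "A \<subseteq> vertices K" using vertex_set[OF \<sigma>] by auto
  \<comment> \<open>A simplex outside the submulticomplex has positive dimension, so completeness
    applies to it.\<close>
  have card: "2 \<le> card A" using singleton_in_minimal_sub[OF \<sigma>] False by (meson not_less)
  define h where "h = (\<lambda>B. snd (f (B, bd K A B \<sigma>)))"
  define \<rho> where "\<rho> = (\<lambda>B. fst (f (B, bd K A B \<sigma>)))"
  have \<rho>L: "\<rho> B \<in> simplices (minimal_sub K) B"
    and h_cont: "continuous_map (prod_topology unit_interval (simplex_top B)) (realization K) (h B)"
    and h0: "\<And>t. t \<in> affine_simplex B \<Longrightarrow> h B (0, t) = char_map K A \<sigma> t"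
    and h1: "\<And>t. t \<in> affine_simplex B \<Longrightarrow> h B (1, t) = char_map K B (\<rho> B) t"
    if B: "B \<subset> A" "B \<noteq> {}" for B
    using f[OF B] char_map_face[OF \<sigma>, of B] B unfolding deformation_data_def h_def \<rho>_def by auto
  have face: "bd K B C (\<rho> B) = \<rho> C"
    "\<And>s t. \<lbrakk>s \<in> {0..1}; t \<in> affine_simplex C\<rbrakk> \<Longrightarrow> h B (s, t) = h C (s, t)"
    if "B \<subset> A" "C \<subset> B" "C \<noteq> {}" for B C
  proof -
    have "B \<noteq> {}" using that by auto
    moreover have "bd K B C (bd K A B \<sigma>) = bd K A C \<sigma>" using bd_bd[OF \<sigma>, of B C] that by auto
    ultimately show "bd K B C (\<rho> B) = \<rho> C"
      "\<And>s t. \<lbrakk>s \<in> {0..1}; t \<in> affine_simplex C\<rbrakk> \<Longrightarrow> h B (s, t) = h C (s, t)"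
      using f[OF that(1)] that unfolding deformation_data_def h_def \<rho>_def by simp_all
  qed
  have \<rho>K: "\<rho> B \<in> simplices K B" if "B \<subset> A" "B \<noteq> {}" for B
    using \<rho>L[OF that] by (simp add: minimal_sub_simplices)
  have \<rho>_bd: "bd K B C (\<rho> B) = \<rho> C" if "B \<subset> A" "C \<subseteq> B" "C \<noteq> {}" for B C
  proof (cases "C = B")
    case True
    then show ?thesis using bd_self[OF \<rho>K] that by simp
  next
    case False
    then show ?thesis using face(1)[of B C] that by auto
  qed
  \<comment> \<open>At each boundary point the homotopy of the smallest face containing it is used;
    by compatibility every larger proper face gives the same value.\<close>
  define k where "k = (\<lambda>z. h {v. snd z v \<noteq> 0} z)"
  have k: "k (s, t) = h B (s, t)" if "B \<subset> A" "B \<noteq> {}" "t \<in> affine_simplex B" "s \<in> {0..1}" for B s t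
  proof -
    have "finite B" using that(1) A(1) finite_subset by blast
    note supp = affine_simplex_support[OF that(3) this]
    show ?thesis
    proof (cases "{v. t v \<noteq> 0} = B")
      case False
      then show ?thesis using face(2)[OF that(1), of "{v. t v \<noteq> 0}" s t] supp that(4) by (auto simp: k_def)
    qed (simp add: k_def)
  qed
  have k_cont: "continuous_map (prod_topology unit_interval (top_of_set (simplex_boundary A))) (realization K) k"
  proof (rule continuous_map_prod_boundary[OF A(1)])
    fix B assume B: "B \<subset> A" "B \<noteq> {}"
    show "continuous_map (prod_topology unit_interval (simplex_top B)) (realization K) k"
      by (rule continuous_map_eq[OF h_cont[OF B]]) (use k[OF B] in auto)
  qed
  have "k (0, t) = char_map K A \<sigma> t" if "t \<in> simplex_boundary A" for t
  proof -
    obtain B where "B \<subset> A" "B \<noteq> {}" "t \<in> affine_simplex B"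
      using \<open>t \<in> simplex_boundary A\<close> unfolding simplex_boundary_iff[OF A(1)] by blast
    then show ?thesis using k[of B t 0] h0[of B t] by simp
  qed
  from simplex_homotopy_extension[OF A(1,2) continuous_map_char_map[OF \<sigma>] k_cont this]
  obtain G where G: "continuous_map (prod_topology unit_interval (simplex_top A)) (realization K) G"
    and G0: "\<forall>t\<in>affine_simplex A. G (0, t) = char_map K A \<sigma> t"
    and GB: "\<forall>t\<in>simplex_boundary A. \<forall>s\<in>{0..1}. G (s, t) = k (s, t)"
    by blast
  have Gh: "G (s, t) = h B (s, t)" if "B \<subset> A" "B \<noteq> {}" "t \<in> affine_simplex B" "s \<in> {0..1}" for B s t
  proof -
    have "t \<in> simplex_boundary A" using that simplex_boundary_iff[OF A(1)] by blast
    then show ?thesis using GB k[OF that] that(4) by simp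
  qed
  have G1: "continuous_map (simplex_top A) (realization K) (\<lambda>t. G (1, t))"
    by (rule continuous_map_slice[OF G]) simp
  have "G (1, t) = char_map K B (\<rho> B) t" if "B \<subset> A" "B \<noteq> {}" "t \<in> affine_simplex B" for B t
    using Gh[OF that, of 1] h1[OF that] by simp
  from complete_mc_simplex[OF multicomplex_axioms complete A(1) card A(3) G1 \<rho>K \<rho>_bd this]
  obtain \<tau> where \<tau>: "\<tau> \<in> simplices K A" and \<tau>_bd: "\<forall>B. B \<subset> A \<and> B \<noteq> {} \<longrightarrow> bd K A B \<tau> = \<rho> B"
    and G\<tau>: "homotopic_rel (simplex_boundary A) (simplex_top A) (realization K) (\<lambda>t. G (1, t)) (char_map K A \<tau>)"
    by blast
  define \<upsilon> where "\<upsilon> = class_rep K A \<tau>"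
  have \<tau>L: "bd K A B \<tau> \<in> simplices (minimal_sub K) B" if "B \<subset> A" "B \<noteq> {}" for B
    using \<rho>L[OF that] \<tau>_bd that by simp
  have \<upsilon>L: "\<upsilon> \<in> simplices (minimal_sub K) A"
    unfolding \<upsilon>_def by (rule class_rep_in_minimal_sub(1)[OF \<tau> \<tau>L])
  have \<upsilon>_bd: "bd K A B \<upsilon> = \<rho> B" if "B \<subset> A" "B \<noteq> {}" for B
    using class_rep_in_minimal_sub(2)[OF \<tau> \<tau>L that] \<tau>_bd that by (simp add: \<upsilon>_def)
  have "homotopic_rel (simplex_boundary A) (simplex_top A) (realization K) (\<lambda>t. G (1, t)) (char_map K A \<upsilon>)"
    using homotopic_rel_trans[OF G\<tau>] simplex_homotopic_class_rep[OF \<tau>]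
    by (simp add: simplex_homotopic_def \<upsilon>_def)
  \<comment> \<open>On the boundary \<open>W\<close> equals \<open>G\<close> at every time, hence
    the homotopies of the faces, while its end is now a simplex of the submulticomplex.\<close>
  from simplex_transport_adjust[OF A(1,2) G this]
  obtain W where W: "continuous_map (prod_topology unit_interval (simplex_top A)) (realization K) W"
    "\<forall>t\<in>affine_simplex A. W (0, t) = G (0, t)" "\<forall>t\<in>affine_simplex A. W (1, t) = char_map K A \<upsilon> t"
    "\<forall>t\<in>simplex_boundary A. \<forall>s\<in>{0..1}. W (s, t) = G (s, t)"
    by blast
  have Wh: "W (s, t) = h B (s, t)" if "B \<subset> A" "B \<noteq> {}" "t \<in> affine_simplex B" "s \<in> {0..1}" for B s t
  proof -
    have "t \<in> simplex_boundary A" using that simplex_boundary_iff[OF A(1)] by blast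
    then show ?thesis using W(4) Gh[OF that] that(4) by simp
  qed
  have "deformation_data K f A \<sigma> (\<upsilon>, W)"
    unfolding deformation_data_def fst_conv snd_conv
    using \<upsilon>L W(1-3) G0 \<upsilon>_bd Wh False by (auto simp: h_def \<rho>_def)
  then show ?thesis by blast
qed

text \<open>Dependent choice along proper inclusion of finite vertex sets: the data on a simplex
  consult \<open>f\<close> only on its proper faces, and any choice there extends. No bound on the
  dimension is involved.\<close>

lemma deformation_data_exists:
  assumes "complete_mc K"
  shows "\<exists>f. \<forall>A. \<forall>\<sigma>\<in>simplices K A. deformation_data K f A \<sigma> (f (A, \<sigma>))"
proof -
  have "\<exists>f. \<forall>x. snd x \<in> simplices K (fst x) \<longrightarrow> deformation_data K f (fst x) (snd x) (f x)"
  proof (rule dependent_wf_choice)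
    show "wf (inv_image finite_psubset (fst :: 'v set \<times> 's \<Rightarrow> 'v set))"
      by (intro wf_inv_image wf_finite_psubset)
  next
    fix f g :: "'v set \<times> 's \<Rightarrow> 's \<times> (real \<times> ('v \<Rightarrow> real) \<Rightarrow> ('v, 's) mpoint)" and x p
    assume eq: "\<And>z. (z, x) \<in> inv_image finite_psubset fst \<Longrightarrow> f z = g z"
    show "(snd x \<in> simplices K (fst x) \<longrightarrow> deformation_data K f (fst x) (snd x) p) =
        (snd x \<in> simplices K (fst x) \<longrightarrow> deformation_data K g (fst x) (snd x) p)"
    proof (cases "snd x \<in> simplices K (fst x)")
      case True
      then have "finite (fst x)" using vertex_set by blast
      then have "f (B, bd K (fst x) B (snd x)) = g (B, bd K (fst x) B (snd x))" if "B \<subset> fst x" for B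
        using that by (intro eq) (simp add: finite_psubset_def)
      then show ?thesis unfolding deformation_data_def by (simp cong: conj_cong)
    qed simp
  next
    fix x and f :: "'v set \<times> 's \<Rightarrow> 's \<times> (real \<times> ('v \<Rightarrow> real) \<Rightarrow> ('v, 's) mpoint)"
    assume IH: "\<And>y. (y, x) \<in> inv_image finite_psubset fst \<Longrightarrow>
      snd y \<in> simplices K (fst y) \<longrightarrow> deformation_data K f (fst y) (snd y) (f y)"
    show "\<exists>p. snd x \<in> simplices K (fst x) \<longrightarrow> deformation_data K f (fst x) (snd x) p"
    proof (cases "snd x \<in> simplices K (fst x)")
      case True
      then have fin: "finite (fst x)" using vertex_set by blast
      have "deformation_data K f B (bd K (fst x) B (snd x)) (f (B, bd K (fst x) B (snd x)))"
        if "B \<subset> fst x" "B \<noteq> {}" for B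
        using IH[of "(B, bd K (fst x) B (snd x))"] that fin bd_closed[OF True, of B]
        by (auto simp: finite_psubset_def)
      then show ?thesis using deformation_data_extend[OF assms True] by blast
    qed simp
  qed
  then show ?thesis by auto
qed

lemma minimal_sub_deformation_retract:
  assumes "complete_mc K"
  shows "\<exists>r. simplicial_retraction K (minimal_sub K) r \<and>
    strong_deformation_retraction (realization K) (realization (minimal_sub K)) (realization_map r)"
proof -
  let ?L = "minimal_sub K"
  note sub = submulticomplex_minimal_sub
  obtain f where f: "\<And>A \<sigma>. \<sigma> \<in> simplices K A \<Longrightarrow> deformation_data K f A \<sigma> (f (A, \<sigma>))"
    using deformation_data_exists[OF assms] by blast
  define r :: "('v, 's, 'v, 's) smap" where "r = \<lparr>vmap = (\<lambda>v. v), simap = (\<lambda>A \<sigma>. fst (f (A, \<sigma>)))\<rparr>"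
  have "bd K A B (fst (f (A, \<sigma>))) = fst (f (B, bd K A B \<sigma>))"
    if \<sigma>: "\<sigma> \<in> simplices K A" and B: "B \<subseteq> A" "B \<noteq> {}" for A B \<sigma>
  proof (cases "B = A")
    case True
    have "fst (f (A, \<sigma>)) \<in> simplices K A"
      using f[OF \<sigma>] by (simp add: deformation_data_def minimal_sub_simplices)
    then show ?thesis using True bd_self \<sigma> by simp
  next
    case False
    then show ?thesis using f[OF \<sigma>] B unfolding deformation_data_def by blast
  qed
  moreover have "fst (f (A, \<sigma>)) \<in> simplices ?L A" if "\<sigma> \<in> simplices K A" for A \<sigma>
    using f[OF that] by (simp add: deformation_data_def)
  ultimately have "simplicial_map K ?L r"
    unfolding simplicial_map_def r_def by simp
  moreover have "smap_eq_on ?L r smap_id"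
    using f unfolding smap_eq_on_def r_def smap_id_def deformation_data_def
    by (simp add: minimal_sub_simplices)
  ultimately have r: "simplicial_retraction K ?L r"
    using sub by (simp add: simplicial_retraction_def)
  have V: "vertices ?L = vertices K" by simp
  \<comment> \<open>A point of the realization is labelled by the simplex in whose interior it lies,
    so the homotopy of that simplex is applied to its coordinates. Compatibility on faces then gives
    the value through any other simplex containing the point.\<close>
  define H where "H = (\<lambda>z. snd (f (fst (snd z))) (fst z, snd (snd z)))"
  have H: "H (s, char_map K A \<sigma> t) = snd (f (A, \<sigma>)) (s, t)"
    if \<sigma>: "\<sigma> \<in> simplices K A" and t: "t \<in> affine_simplex A" and s: "s \<in> {0..1}" for A \<sigma> s t
  proof -
    have "finite A" using vertex_set[OF \<sigma>] by blast
    note supp = affine_simplex_support[OF t this]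
    show ?thesis
    proof (cases "{v. t v \<noteq> 0} = A")
      case True
      then show ?thesis by (simp add: H_def char_map_eq bd_self[OF \<sigma>])
    next
      case False
      then have "{v. t v \<noteq> 0} \<subset> A" using supp by blast
      moreover have "\<forall>B. B \<subset> A \<and> B \<noteq> {} \<longrightarrow> bd K A B (fst (f (A, \<sigma>))) = fst (f (B, bd K A B \<sigma>)) \<and>
          (\<forall>s\<in>{0..1}. \<forall>t\<in>affine_simplex B. snd (f (A, \<sigma>)) (s, t) = snd (f (B, bd K A B \<sigma>)) (s, t))"
        using f[OF \<sigma>] unfolding deformation_data_def by blast
      ultimately have "snd (f (A, \<sigma>)) (s, t) = snd (f ({v. t v \<noteq> 0}, bd K A {v. t v \<noteq> 0} \<sigma>)) (s, t)"
        using supp(2,3) s by blast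
      then show ?thesis by (simp add: H_def char_map_eq)
    qed
  qed
  have "continuous_map (prod_topology unit_interval (realization K)) (realization K) H"
  proof (rule continuous_map_prod_realization)
    fix A \<sigma> assume \<sigma>: "\<sigma> \<in> simplices K A"
    have "continuous_map (prod_topology unit_interval (simplex_top A)) (realization K) (snd (f (A, \<sigma>)))"
      using f[OF \<sigma>] by (simp only: deformation_data_def)
    then show "continuous_map (prod_topology unit_interval (simplex_top A)) (realization K)
        (\<lambda>z. H (fst z, char_map K A \<sigma> (snd z)))"
      by (rule continuous_map_eq) (use H[OF \<sigma>] in auto)
  qed
  then have "homotopic_rel (topspace (realization ?L)) (realization K) (realization K) (\<lambda>x. x) (realization_map r)"
  proof (rule homotopic_relI[OF _ topspace_realization_mono[OF sub]])
    fix x assume "x \<in> topspace (realization K)"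
    then obtain A \<sigma> t where x: "\<sigma> \<in> simplices K A" "t \<in> affine_simplex A" "x = char_map K A \<sigma> t"
      by (rule realization_cases)
    show "H (0, x) = x"
      using H[OF x(1,2), of 0] f[OF x(1)] x(2,3) by (simp add: deformation_data_def)
    show "H (1, x) = realization_map r x"
      using H[OF x(1,2), of 1] f[OF x(1)] x(2,3) realization_map_retraction(2)[OF r V x(1,2)]
      by (simp add: deformation_data_def r_def)
  next
    fix s :: real and x assume s: "s \<in> {0..1}" and "x \<in> topspace (realization ?L)"
    then obtain A \<sigma> t where x: "\<sigma> \<in> simplices ?L A" "t \<in> affine_simplex A" "x = char_map ?L A \<sigma> t"
      by (meson realization_cases)
    have \<sigma>: "\<sigma> \<in> simplices K A" using x(1) by (simp add: minimal_sub_simplices)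
    have "x = char_map K A \<sigma> t" using x char_map_submulticomplex[OF sub x(1,2)] by simp
    then show "H (s, x) = x"
      using H[OF \<sigma> x(2) s] f[OF \<sigma>] x(1,2) s by (simp add: deformation_data_def)
  qed
  moreover have "retraction_maps (realization K) (realization ?L) (realization_map r) (\<lambda>x. x)"
    using continuous_map_retraction[OF r V] continuous_map_inclusion[OF sub]
      realization_map_retraction_id[OF r V] by (simp add: retraction_maps_def)
  ultimately show ?thesis using r unfolding strong_deformation_retraction_def by blast
qed

lemma minimal_retract_minimal_sub:
  assumes "complete_mc K"
  shows "minimal_retract K (minimal_sub K)"
proof -
  obtain r where r: "simplicial_retraction K (minimal_sub K) r"
    and def: "strong_deformation_retraction (realization K) (realization (minimal_sub K)) (realization_map r)"
    using minimal_sub_deformation_retract[OF assms] by blast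
  have "complete_mc (minimal_sub K)"
    by (rule complete_mc_retract[OF assms r]) simp
  then show ?thesis
    using r def submulticomplex_minimal_sub minimal_mc_minimal_sub homotopy_equivalence_inclusion[OF def]
    unfolding minimal_retract_def by auto
qed

end

section \<open>Uniqueness\<close>

lemma retraction_bd:
  assumes r: "simplicial_retraction K L r" and V: "vertices L = vertices K"
    and \<sigma>: "\<sigma> \<in> simplices K A" and B: "B \<subseteq> A" "B \<noteq> {}"
  shows "bd K A B (simap r A \<sigma>) = simap r B (bd K A B \<sigma>)"
proof -
  have sub: "submulticomplex L K" and sm: "simplicial_map K L r"
    using r by (auto simp: simplicial_retraction_def)
  have "A \<subseteq> vertices K" using multicomplex.vertex_set[OF submulticomplexD(2)[OF sub] \<sigma>] by blast
  then have im: "vmap r ` C = C" if "C \<subseteq> A" for C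
    using retraction_vmap[OF r V] that by force
  have "bd L A B (simap r A \<sigma>) = simap r B (bd K A B \<sigma>)"
    using simplicial_mapD(3)[OF sm \<sigma> B] im[of A] im[of B] B by simp
  moreover have "bd L A B (simap r A \<sigma>) = bd K A B (simap r A \<sigma>)"
    by (rule submulticomplexD(5)[OF sub realization_map_retraction(1)[OF r V \<sigma>] B])
  ultimately show ?thesis by simp
qed

text \<open>Minimality of \<open>L\<close> concerns homotopies in \<open>L\<close>. The retraction
  brings a homotopy in \<open>K\<close> there and fixes both simplices.\<close>

lemma minimal_mc_retract_simplex:
  assumes min: "minimal_mc L" and r: "simplicial_retraction K L r" and V: "vertices L = vertices K"
    and \<sigma>: "\<sigma> \<in> simplices L A" and \<tau>: "\<tau> \<in> simplices L A"
    and hom: "homotopic_rel (simplex_boundary A) (simplex_top A) (realization K)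
      (char_map K A \<sigma>) (char_map K A \<tau>)"
  shows "\<sigma> = \<tau>"
proof -
  have sub: "submulticomplex L K" using r by (simp add: simplicial_retraction_def)
  have fix_L: "realization_map r (char_map K A \<upsilon> t) = char_map L A \<upsilon> t"
    if "\<upsilon> \<in> simplices L A" "t \<in> affine_simplex A" for \<upsilon> t
    using realization_map_retraction_id[OF r V char_map_in_realization[OF that]]
      char_map_submulticomplex[OF sub that] by simp
  have "homotopic_rel (simplex_boundary A) (simplex_top A) (realization L) (char_map L A \<sigma>) (char_map L A \<tau>)"
    by (rule homotopic_rel_cong[OF homotopic_rel_compose_left[OF hom continuous_map_retraction[OF r V]]])
      (use fix_L[OF \<sigma>] fix_L[OF \<tau>] simplex_boundary_subset in auto)
  from minimal_mc_simplex[OF submulticomplexD(1)[OF sub] min \<sigma> \<tau> this] show ?thesis .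
qed

lemma minimal_retractD:
  assumes "minimal_retract K L"
  shows "submulticomplex L K" "minimal_mc L" "vertices L = vertices K"
    and "\<exists>r D. simplicial_retraction K L r \<and>
      continuous_map (prod_topology unit_interval (realization K)) (realization K) D \<and>
      (\<forall>x. D (0, x) = x) \<and> (\<forall>x. D (1, x) = realization_map r x) \<and>
      (\<forall>s\<in>{0..1}. \<forall>x\<in>topspace (realization L). D (s, x) = x)"
proof -
  show "submulticomplex L K" "minimal_mc L" "vertices L = vertices K"
    using assms by (auto simp: minimal_retract_def)
  obtain r where r: "simplicial_retraction K L r"
    and "strong_deformation_retraction (realization K) (realization L) (realization_map r)"
    using assms unfolding minimal_retract_def by blast
  then have "homotopic_rel (topspace (realization L)) (realization K) (realization K) (\<lambda>x. x) (realization_map r)"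
    by (simp add: strong_deformation_retraction_def)
  from homotopic_relD[OF this] r
  show "\<exists>r D. simplicial_retraction K L r \<and>
      continuous_map (prod_topology unit_interval (realization K)) (realization K) D \<and>
      (\<forall>x. D (0, x) = x) \<and> (\<forall>x. D (1, x) = realization_map r x) \<and>
      (\<forall>s\<in>{0..1}. \<forall>x\<in>topspace (realization L). D (s, x) = x)"
    by blast
qed

lemma continuous_map_track:
  assumes "continuous_map (prod_topology unit_interval (realization K)) (realization K) D"
    and "\<sigma> \<in> simplices K A"
  shows "continuous_map (prod_topology unit_interval (simplex_top A)) (realization K)
    (\<lambda>z. D (fst z, char_map K A \<sigma> (snd z)))"
  by (intro continuous_map_comp[OF assms(1)] continuous_map_pairedI continuous_map_fst
      continuous_map_comp[OF continuous_map_char_map[OF assms(2)] continuous_map_snd])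

section \<open>Bijectivity of the retraction onto \<open>L'\<close> on the simplices of
  \<open>L\<close>\<close>

context
  fixes K L L' :: "('v, 's) multicomplex" and r r' D D'
  assumes K: "multicomplex K" "complete_mc K"
    and sub: "submulticomplex L K" and sub': "submulticomplex L' K"
    and min: "minimal_mc L" and min': "minimal_mc L'"
    and V: "vertices L = vertices K" and V': "vertices L' = vertices K"
    and r: "simplicial_retraction K L r" and r': "simplicial_retraction K L' r'"
    and D: "continuous_map (prod_topology unit_interval (realization K)) (realization K) D"
      "\<forall>x. D (0, x) = x" "\<forall>x. D (1, x) = realization_map r x"
      "\<forall>s\<in>{0..1}. \<forall>x\<in>topspace (realization L). D (s, x) = x"
    and D': "continuous_map (prod_topology unit_interval (realization K)) (realization K) D'"
      "\<forall>x. D' (0, x) = x" "\<forall>x. D' (1, x) = realization_map r' x"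
begin

interpretation multicomplex K by (rule K(1))

text \<open>Both simplices are reached from their common image by running \<open>D'\<close>
  backwards. By induction they have the same faces, so the two backward homotopies agree on the
  boundary, and uniqueness of transport makes their ends homotopic.\<close>

lemma retraction_inj_step:
  assumes \<sigma>: "\<sigma> \<in> simplices L A" and \<tau>: "\<tau> \<in> simplices L A"
    and eq: "simap r' A \<sigma> = simap r' A \<tau>"
    and inj: "\<And>B. \<lbrakk>B \<subset> A; B \<noteq> {}\<rbrakk> \<Longrightarrow> inj_on (simap r' B) (simplices L B)"
  shows "\<sigma> = \<tau>"
proof (rule minimal_mc_retract_simplex[OF min r V \<sigma> \<tau>])
  have \<sigma>K: "\<sigma> \<in> simplices K A" and \<tau>K: "\<tau> \<in> simplices K A"
    using submulticomplexD(4)[OF sub] \<sigma> \<tau> by auto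
  have A: "finite A" "A \<noteq> {}" using vertex_set[OF \<sigma>K] by auto
  have faces: "bd K A B \<sigma> = bd K A B \<tau>" if B: "B \<subset> A" "B \<noteq> {}" for B
  proof (rule inj_onD[OF inj[OF B]])
    have "B \<subseteq> A" using B by blast
    then show "simap r' B (bd K A B \<sigma>) = simap r' B (bd K A B \<tau>)"
      using retraction_bd[OF r' V' \<sigma>K _ B(2)] retraction_bd[OF r' V' \<tau>K _ B(2)] eq by simp
    have "bd L A B \<upsilon> \<in> simplices L B" if "\<upsilon> \<in> simplices L A" for \<upsilon>
      using multicomplex.bd_closed[OF submulticomplexD(1)[OF sub] that \<open>B \<subseteq> A\<close> B(2)] .
    then show "bd K A B \<sigma> \<in> simplices L B" "bd K A B \<tau> \<in> simplices L B"
      using submulticomplexD(5)[OF sub \<sigma> \<open>B \<subseteq> A\<close> B(2)] submulticomplexD(5)[OF sub \<tau> \<open>B \<subseteq> A\<close> B(2)] \<sigma> \<tau>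
      by force+
  qed
  \<comment> \<open>Time is reversed: \<open>F\<close> starts at the image under \<open>r'\<close>
    and ends at the simplex itself.\<close>
  define F where "F = (\<lambda>\<upsilon> z. D' (1 - fst z, char_map K A \<upsilon> (snd z)))"
  have F: "continuous_map (prod_topology unit_interval (simplex_top A)) (realization K) (F \<upsilon>)"
    if "\<upsilon> \<in> simplices K A" for \<upsilon>
    using continuous_map_reverse[OF continuous_map_track[OF D'(1) that]] by (simp only: F_def fst_conv snd_conv)
  have "homotopic_rel (simplex_boundary A) (simplex_top A) (realization K)
      (\<lambda>x. F \<sigma> (1, x)) (\<lambda>x. F \<tau> (1, x))"
  proof (rule simplex_transport_unique[OF A F[OF \<sigma>K] F[OF \<tau>K]])
    fix x and t :: real assume "x \<in> simplex_boundary A"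
    then show "F \<tau> (t, x) = F \<sigma> (t, x)"
      using char_map_eq_on_boundary[OF \<sigma>K \<tau>K _ faces] by (simp add: F_def)
  next
    have "continuous_map (simplex_top A) (realization K) (\<lambda>x. F \<sigma> (0, x))"
      by (rule continuous_map_slice[OF F[OF \<sigma>K]]) simp
    then have "homotopic_rel (simplex_boundary A) (simplex_top A) (realization K)
        (\<lambda>x. F \<sigma> (0, x)) (\<lambda>x. F \<sigma> (0, x))"
      by (rule homotopic_rel_refl)
    then show "homotopic_rel (simplex_boundary A) (simplex_top A) (realization K)
        (\<lambda>x. F \<sigma> (0, x)) (\<lambda>x. F \<tau> (0, x))"
    proof (rule homotopic_rel_cong)
      fix x assume "x \<in> topspace (simplex_top A)"
      then have x: "x \<in> affine_simplex A" by simp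
      show "F \<sigma> (0, x) = F \<tau> (0, x)"
        using realization_map_retraction(2)[OF r' V' \<sigma>K x] realization_map_retraction(2)[OF r' V' \<tau>K x] eq
        by (simp add: F_def D'(3))
    qed (auto simp: simplex_boundary_def)
  qed
  then show "homotopic_rel (simplex_boundary A) (simplex_top A) (realization K)
      (char_map K A \<sigma>) (char_map K A \<tau>)"
    by (simp add: F_def D'(2))
qed

text \<open>The faces of \<open>\<tau>\<close> are lifted to \<open>L\<close> by induction. Carrying
  \<open>\<tau>\<close> backwards along the deformation of this lifted boundary, and using
  completeness, produces a candidate over it; transporting the candidate forwards recovers
  \<open>\<tau>\<close> up to homotopy, and minimality of \<open>L'\<close> turns this into
  equality.\<close>

lemma retraction_surj_step:
  assumes \<tau>: "\<tau> \<in> simplices L' A"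
    and bij: "\<And>B. \<lbrakk>B \<subset> A; B \<noteq> {}\<rbrakk> \<Longrightarrow> bij_betw (simap r' B) (simplices L B) (simplices L' B)"
  shows "\<exists>\<sigma>\<in>simplices L A. simap r' A \<sigma> = \<tau>"
proof (cases "card A < 2")
  case True
  have \<tau>K: "\<tau> \<in> simplices K A" using submulticomplexD(4)[OF sub' \<tau>] .
  have A: "finite A" "A \<noteq> {}" "A \<subseteq> vertices K" using vertex_set[OF \<tau>K] by auto
  then have "card A = 1" using True card_gt_0_iff[of A] by linarith
  then obtain v where v: "A = {v}" by (auto simp: card_1_singleton_iff)
  then obtain \<sigma> where \<sigma>: "\<sigma> \<in> simplices L A"
    using multicomplex.vertex_simplex[OF submulticomplexD(1)[OF sub], of v] A(3) V by auto
  have "simap r' A \<sigma> \<in> simplices L' A"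
    by (rule realization_map_retraction(1)[OF r' V' submulticomplexD(4)[OF sub \<sigma>]])
  from multicomplex.singleton_simplex_unique[OF submulticomplexD(1)[OF sub'] this \<tau> True]
  show ?thesis using \<sigma> by blast
next
  case False
  then have card: "2 \<le> card A" by simp
  have \<tau>K: "\<tau> \<in> simplices K A" using submulticomplexD(4)[OF sub' \<tau>] .
  have A: "finite A" "A \<noteq> {}" "A \<subseteq> vertices K" using vertex_set[OF \<tau>K] by auto
  define \<rho> where "\<rho> = (\<lambda>B. inv_into (simplices L B) (simap r' B) (bd K A B \<tau>))"
  have \<rho>L: "\<rho> B \<in> simplices L B" and r'\<rho>: "simap r' B (\<rho> B) = bd K A B \<tau>"
    if B: "B \<subset> A" "B \<noteq> {}" for B
  proof -
    have "B \<subseteq> A" using B by blast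
    then have "bd K A B \<tau> \<in> simplices L' B"
      using multicomplex.bd_closed[OF submulticomplexD(1)[OF sub'] \<tau> _ B(2)]
        submulticomplexD(5)[OF sub' \<tau> _ B(2)] by simp
    then have im: "bd K A B \<tau> \<in> simap r' B ` simplices L B"
      using bij[OF B] by (simp add: bij_betw_def)
    show "\<rho> B \<in> simplices L B" unfolding \<rho>_def by (rule inv_into_into[OF im])
    show "simap r' B (\<rho> B) = bd K A B \<tau>" unfolding \<rho>_def by (rule f_inv_into_f[OF im])
  qed
  have \<rho>K: "\<rho> B \<in> simplices K B" if "B \<subset> A" "B \<noteq> {}" for B
    by (rule submulticomplexD(4)[OF sub \<rho>L[OF that]])
  have \<rho>_bd: "bd K B C (\<rho> B) = \<rho> C" if B: "B \<subset> A" and C: "C \<subseteq> B" "C \<noteq> {}" for B C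
  proof (rule inj_onD)
    have B': "B \<noteq> {}" and C': "C \<subset> A" and BA: "B \<subseteq> A" using B C by auto
    show "inj_on (simap r' C) (simplices L C)" using bij[OF C' C(2)] by (simp add: bij_betw_def)
    show "\<rho> C \<in> simplices L C" by (rule \<rho>L[OF C' C(2)])
    show "bd K B C (\<rho> B) \<in> simplices L C"
      using multicomplex.bd_closed[OF submulticomplexD(1)[OF sub] \<rho>L[OF B B'] C]
        submulticomplexD(5)[OF sub \<rho>L[OF B B'] C] by simp
    show "simap r' C (bd K B C (\<rho> B)) = simap r' C (\<rho> C)"
      using retraction_bd[OF r' V' \<rho>K[OF B B'] C] r'\<rho>[OF B B'] r'\<rho>[OF C' C(2)] bd_bd[OF \<tau>K BA C]
      by simp
  qed
  \<comment> \<open>The boundary map assembled from the lifted faces; the support of a point selects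
    the face.\<close>
  define b where "b = (\<lambda>x. char_map K {v. x v \<noteq> 0} (\<rho> {v. x v \<noteq> 0}) x)"
  have b: "b x = char_map K B (\<rho> B) x" if B: "B \<subset> A" "B \<noteq> {}" and x: "x \<in> affine_simplex B" for B x
  proof -
    have "finite B" using B(1) A(1) finite_subset by blast
    note supp = affine_simplex_support[OF x this]
    show ?thesis
      using char_map_face[OF \<rho>K[OF B] supp] \<rho>_bd[OF B(1) supp(1,2)] by (simp add: b_def)
  qed
  \<comment> \<open>With time reversed, \<open>k\<close> starts at the boundary of
    \<open>\<tau>\<close>, the image of the lifted boundary under \<open>r'\<close>, and ends at the
    lifted boundary.\<close>
  define k where "k = (\<lambda>z. D' (1 - fst z, b (snd z)))"
  have k_cont: "continuous_map (prod_topology unit_interval (top_of_set (simplex_boundary A))) (realization K) k"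
  proof (rule continuous_map_prod_boundary[OF A(1)])
    fix B assume B: "B \<subset> A" "B \<noteq> {}"
    show "continuous_map (prod_topology unit_interval (simplex_top B)) (realization K) k"
      by (rule continuous_map_eq[OF continuous_map_reverse[OF continuous_map_track[OF D'(1) \<rho>K[OF B]]]])
        (use b[OF B] in \<open>auto simp: k_def\<close>)
  qed
  have "k (0, x) = char_map K A \<tau> x" if x_bd: "x \<in> simplex_boundary A" for x
  proof -
    obtain B where B: "B \<subset> A" "B \<noteq> {}" and x: "x \<in> affine_simplex B"
      using x_bd unfolding simplex_boundary_iff[OF A(1)] by blast
    have "k (0, x) = char_map K B (bd K A B \<tau>) x"
      using realization_map_retraction(2)[OF r' V' \<rho>K[OF B] x] b[OF B x] r'\<rho>[OF B]
      by (simp add: k_def D'(3))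
    then show ?thesis using char_map_face[OF \<tau>K _ B(2) x] B by auto
  qed
  from simplex_homotopy_extension[OF A(1,2) continuous_map_char_map[OF \<tau>K] k_cont this]
  obtain G where G: "continuous_map (prod_topology unit_interval (simplex_top A)) (realization K) G"
    and G0: "\<forall>x\<in>affine_simplex A. G (0, x) = char_map K A \<tau> x"
    and GB: "\<forall>x\<in>simplex_boundary A. \<forall>s\<in>{0..1}. G (s, x) = k (s, x)"
    by blast
  have G1: "continuous_map (simplex_top A) (realization K) (\<lambda>x. G (1, x))"
    by (rule continuous_map_slice[OF G]) simp
  have "G (1, x) = char_map K B (\<rho> B) x" if B: "B \<subset> A" "B \<noteq> {}" "x \<in> affine_simplex B" for B x
  proof -
    have "x \<in> simplex_boundary A" using B unfolding simplex_boundary_iff[OF A(1)] by blast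
    then show ?thesis using GB b[OF B] by (simp add: k_def D'(2))
  qed
  from complete_mc_simplex[OF K A(1) card A(3) G1 \<rho>K \<rho>_bd this]
  obtain \<mu> where \<mu>: "\<mu> \<in> simplices K A" and \<mu>_bd: "\<forall>B. B \<subset> A \<and> B \<noteq> {} \<longrightarrow> bd K A B \<mu> = \<rho> B"
    and G\<mu>: "homotopic_rel (simplex_boundary A) (simplex_top A) (realization K) (\<lambda>x. G (1, x)) (char_map K A \<mu>)"
    by blast
  have \<mu>b: "char_map K A \<mu> x = b x" "b x \<in> topspace (realization L)" if x_bd: "x \<in> simplex_boundary A" for x
  proof -
    obtain B where B: "B \<subset> A" "B \<noteq> {}" and x: "x \<in> affine_simplex B"
      using x_bd unfolding simplex_boundary_iff[OF A(1)] by blast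
    show "char_map K A \<mu> x = b x"
      using char_map_face[OF \<mu> _ B(2) x] b[OF B x] \<mu>_bd B by auto
    show "b x \<in> topspace (realization L)"
      using char_map_in_realization[OF \<rho>L[OF B] x] char_map_submulticomplex[OF sub \<rho>L[OF B] x] b[OF B x]
      by simp
  qed
  \<comment> \<open>Completeness only places \<open>\<mu>\<close> in \<open>K\<close>, although its
    proper faces lie in \<open>L\<close>. The deformation \<open>D\<close> is stationary on
    \<open>L\<close>, so it moves \<open>\<mu>\<close> to \<open>\<sigma>\<close> relative to the
    boundary.\<close>
  define \<sigma> where "\<sigma> = simap r A \<mu>"
  have \<sigma>: "\<sigma> \<in> simplices L A" unfolding \<sigma>_def by (rule realization_map_retraction(1)[OF r V \<mu>])
  have \<sigma>K: "\<sigma> \<in> simplices K A" by (rule submulticomplexD(4)[OF sub \<sigma>])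
  have "homotopic_rel (simplex_boundary A) (simplex_top A) (realization K) (char_map K A \<mu>) (char_map K A \<sigma>)"
  proof (rule homotopic_relI[OF continuous_map_track[OF D(1) \<mu>]])
    fix x assume "x \<in> topspace (simplex_top A)"
    then show "D (fst (1, x), char_map K A \<mu> (snd (1, x))) = char_map K A \<sigma> x"
      using realization_map_retraction(2)[OF r V \<mu>] by (simp add: D(3) \<sigma>_def)
    show "D (fst (0, x), char_map K A \<mu> (snd (0, x))) = char_map K A \<mu> x"
      by (simp add: D(2))
  next
    fix s :: real and x assume "s \<in> {0..1}" "x \<in> simplex_boundary A"
    then show "D (fst (s, x), char_map K A \<mu> (snd (s, x))) = char_map K A \<mu> x"
      using D(4) \<mu>b by simp
  qed (use simplex_boundary_subset in auto)
  from homotopic_rel_trans[OF G\<mu> this]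
  have G\<sigma>: "homotopic_rel (simplex_boundary A) (simplex_top A) (realization K) (\<lambda>x. G (1, x)) (char_map K A \<sigma>)" .
  have \<sigma>b: "char_map K A \<sigma> x = b x" if "x \<in> simplex_boundary A" for x
    using homotopic_rel_eq_on[OF G\<sigma> that] homotopic_rel_eq_on[OF G\<mu> that] \<mu>b(1)[OF that] by simp
  \<comment> \<open>\<open>F0\<close> runs \<open>G\<close> backwards to \<open>\<tau>\<close>, and
    \<open>F1\<close> carries \<open>\<sigma>\<close> to its image under \<open>r'\<close>. Both
    follow \<open>D'\<close> on the boundary and start at homotopic maps, so their ends are
    homotopic.\<close>
  define F0 F1 where "F0 = (\<lambda>z. G (1 - fst z, snd z))" and "F1 = (\<lambda>z. D' (fst z, char_map K A \<sigma> (snd z)))"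
  have "homotopic_rel (simplex_boundary A) (simplex_top A) (realization K) (\<lambda>x. F0 (1, x)) (\<lambda>x. F1 (1, x))"
  proof (rule simplex_transport_unique[OF A(1,2)])
    show "continuous_map (prod_topology unit_interval (simplex_top A)) (realization K) F0"
      unfolding F0_def by (rule continuous_map_reverse[OF G])
    show "continuous_map (prod_topology unit_interval (simplex_top A)) (realization K) F1"
      unfolding F1_def by (rule continuous_map_track[OF D'(1) \<sigma>K])
    show "homotopic_rel (simplex_boundary A) (simplex_top A) (realization K) (\<lambda>x. F0 (0, x)) (\<lambda>x. F1 (0, x))"
      using G\<sigma> by (simp add: F0_def F1_def D'(2))
    fix x and s :: real assume "x \<in> simplex_boundary A" "s \<in> {0..1}"
    then show "F1 (s, x) = F0 (s, x)"
      using GB \<sigma>b by (simp add: F0_def F1_def k_def)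
  qed
  then have "homotopic_rel (simplex_boundary A) (simplex_top A) (realization K)
      (char_map K A \<tau>) (char_map K A (simap r' A \<sigma>))"
  proof (rule homotopic_rel_cong)
    fix x assume "x \<in> topspace (simplex_top A)"
    then have x: "x \<in> affine_simplex A" by simp
    show "F0 (1, x) = char_map K A \<tau> x" using G0 x by (simp add: F0_def)
    show "F1 (1, x) = char_map K A (simap r' A \<sigma>) x"
      using realization_map_retraction(2)[OF r' V' \<sigma>K x] by (simp add: F1_def D'(3))
  qed (simp add: simplex_boundary_subset)
  from minimal_mc_retract_simplex[OF min' r' V' \<tau> realization_map_retraction(1)[OF r' V' \<sigma>K] this]
  show ?thesis using \<sigma> by blast
qed

lemma retraction_bij: "bij_betw (simap r' A) (simplices L A) (simplices L' A)"
proof (induction A rule: measure_induct_rule[where f = card])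
  case (less A)
  show ?case
  proof (cases "finite A")
    \<comment> \<open>The cardinality of an infinite set is 0, so induction says nothing about its
      subsets; but no simplices live over infinite sets.\<close>
    case False
    then have "simplices L A = {}" "simplices L' A = {}"
      using vertex_set submulticomplexD(4)[OF sub] submulticomplexD(4)[OF sub'] by blast+
    then show ?thesis by (simp add: bij_betw_def)
  next
    case True
    then have IH: "bij_betw (simap r' B) (simplices L B) (simplices L' B)" if "B \<subset> A" for B
      using less psubset_card_mono[OF True that] by blast
    have "inj_on (simap r' B) (simplices L B)" if "B \<subset> A" for B
      using IH[OF that] by (simp add: bij_betw_def)
    then have "inj_on (simap r' A) (simplices L A)"
      by (intro inj_onI) (rule retraction_inj_step)
    moreover have "simap r' A ` simplices L A \<subseteq> simplices L' A"
      using realization_map_retraction(1)[OF r' V' submulticomplexD(4)[OF sub]] by blast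
    moreover have "simplices L' A \<subseteq> simap r' A ` simplices L A"
      using retraction_surj_step[OF _ IH] by blast
    ultimately show ?thesis by (simp add: bij_betw_def)
  qed
qed

text \<open>The inverse is taken over each vertex set separately. It commutes with the boundary maps
  because \<open>r'\<close> does and is injective on the simplices of \<open>L\<close> over each
  face.\<close>

lemma simplicially_isomorphic_retracts: "simplicially_isomorphic L L'"
proof -
  define \<psi> :: "('v, 's, 'v, 's) smap"
    where "\<psi> = \<lparr>vmap = (\<lambda>v. v), simap = (\<lambda>A. inv_into (simplices L A) (simap r' A))\<rparr>"
  note L = submulticomplexD[OF sub] and L' = submulticomplexD[OF sub']
  have im: "vmap r' ` A = A" if "\<sigma> \<in> simplices K A" for A \<sigma>
    using vertex_set[OF that] retraction_vmap[OF r' V'] by force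
  have inv: "inv_into (simplices L A) (simap r' A) \<tau> \<in> simplices L A"
    "simap r' A (inv_into (simplices L A) (simap r' A) \<tau>) = \<tau>" if "\<tau> \<in> simplices L' A" for A \<tau>
  proof -
    have "\<tau> \<in> simap r' A ` simplices L A" using retraction_bij[of A] that by (simp add: bij_betw_def)
    then show "inv_into (simplices L A) (simap r' A) \<tau> \<in> simplices L A"
      "simap r' A (inv_into (simplices L A) (simap r' A) \<tau>) = \<tau>"
      by (rule inv_into_into, rule f_inv_into_f)
  qed
  have inj: "inj_on (simap r' A) (simplices L A)" for A
    using retraction_bij[of A] by (simp add: bij_betw_def)
  have sm: "simplicial_map K L' r'" using r' by (simp add: simplicial_retraction_def)
  have 1: "simplicial_map L L' r'"
    unfolding simplicial_map_def
  proof (intro conjI allI ballI impI)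
    show "vmap r' ` vertices L \<subseteq> vertices L'" using simplicial_mapD(1)[OF sm] V by simp
    fix A \<sigma> assume \<sigma>: "\<sigma> \<in> simplices L A"
    show "simap r' A \<sigma> \<in> simplices L' (vmap r' ` A)" by (rule simplicial_mapD(2)[OF sm L(4)[OF \<sigma>]])
    fix B assume "B \<subseteq> A \<and> B \<noteq> {}"
    then show "bd L' (vmap r' ` A) (vmap r' ` B) (simap r' A \<sigma>) = simap r' B (bd L A B \<sigma>)"
      using simplicial_mapD(3)[OF sm L(4)[OF \<sigma>]] L(5)[OF \<sigma>] by simp
  qed
  have 2: "simplicial_map L' L \<psi>"
    unfolding simplicial_map_def \<psi>_def
  proof (simp add: V V', intro conjI allI ballI impI inv(1))
    fix A B \<tau> assume \<tau>: "\<tau> \<in> simplices L' A" and B: "B \<subseteq> A \<and> B \<noteq> {}"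
    define \<sigma> where "\<sigma> = inv_into (simplices L A) (simap r' A) \<tau>"
    have \<sigma>: "\<sigma> \<in> simplices L A" "simap r' A \<sigma> = \<tau>" using inv[OF \<tau>] by (simp_all add: \<sigma>_def)
    have "simap r' B (bd L A B \<sigma>) = bd L' A B \<tau>"
      using retraction_bd[OF r' V' L(4)[OF \<sigma>(1)]] L(5)[OF \<sigma>(1)] L'(5)[OF \<tau>] \<sigma>(2) B by simp
    moreover have "bd L A B \<sigma> \<in> simplices L B"
      using multicomplex.bd_closed[OF L(1) \<sigma>(1)] B by blast
    ultimately show "bd L A B \<sigma> = inv_into (simplices L B) (simap r' B) (bd L' A B \<tau>)"
      using inv_into_f_f[OF inj] by metis
  qed
  have 3: "smap_eq_on L (smap_comp \<psi> r') smap_id"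
    unfolding smap_eq_on_def smap_comp_def smap_id_def \<psi>_def
    using retraction_vmap[OF r' V'] V im[OF L(4)] inv_into_f_f[OF inj] by simp
  have 4: "smap_eq_on L' (smap_comp r' \<psi>) smap_id"
    unfolding smap_eq_on_def smap_comp_def smap_id_def \<psi>_def
    using retraction_vmap[OF r' V'] V' inv(2) by simp
  show ?thesis
    unfolding simplicially_isomorphic_def using 1 2 3 4 by blast
qed

end

theorem theorem3p4p6:
  fixes K :: "('v, 's) multicomplex"
  assumes "multicomplex K" and "complete_mc K"
  shows "(\<exists>L. minimal_retract K L) \<and>
    (\<forall>L L'. minimal_retract K L \<and> minimal_retract K L' \<longrightarrow> simplicially_isomorphic L L')"
proof (intro conjI allI impI)
  show "\<exists>L. minimal_retract K L"
    using multicomplex.minimal_retract_minimal_sub[OF assms] by blast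
next
  fix L L' assume "minimal_retract K L \<and> minimal_retract K L'"
  then have L: "minimal_retract K L" and L': "minimal_retract K L'" by auto
  obtain r D where rD: "simplicial_retraction K L r"
      "continuous_map (prod_topology unit_interval (realization K)) (realization K) D"
      "\<forall>x. D (0, x) = x" "\<forall>x. D (1, x) = realization_map r x"
      "\<forall>s\<in>{0..1}. \<forall>x\<in>topspace (realization L). D (s, x) = x"
    using minimal_retractD(4)[OF L] by blast
  obtain r' D' where rD': "simplicial_retraction K L' r'"
      "continuous_map (prod_topology unit_interval (realization K)) (realization K) D'"
      "\<forall>x. D' (0, x) = x" "\<forall>x. D' (1, x) = realization_map r' x"
    using minimal_retractD(4)[OF L'] by blast
  show "simplicially_isomorphic L L'"
    by (rule simplicially_isomorphic_retracts[OF assms minimal_retractD(1)[OF L] minimal_retractD(1)[OF L']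
          minimal_retractD(2)[OF L] minimal_retractD(2)[OF L'] minimal_retractD(3)[OF L]
          minimal_retractD(3)[OF L'] rD(1) rD'(1) rD(2-5) rD'(2-4)])
qed

end
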